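(* Let $m$ be a positive integer, $0<\alpha<n$, $1<p<\frac{n}{\alpha}$, $\frac1p-\frac1q=\frac{\alpha}{n}$, $w\in A_{(p,q)}$ and $b\in BMO(\mathbb{R}^n)$. Let $P(x,y)=\sum_{|\beta|\le k,|\gamma|\le l}a_{\beta\gamma}x^{\beta}y^{\gamma}$ be a nontrivial real-valued polynomial on $\mathbb{R}^n\times\mathbb{R}^n$. Suppose the kernel $K_\alpha(x,y)$ (defined for $x\neq y$) satisfies, for some constant $C_0$, $$|K_{\alpha}(x,y)|\le\frac{C_0}{|x-y|^{n-\alpha}},\qquad |\nabla_{x}K_{\alpha}(x,y)|+|\nabla_{y}K_{\alpha}(x,y)|\le\frac{C_0}{|x-y|^{n+1-\alpha}},$$ and that the operator $\widetilde{T}_{\alpha}: f\mapsto\int_{\mathbb{R}^{n}}K_{\alpha}(x,y)f(y)\,dy$ is bounded on $L^{2}(\mathbb{R}^n)$. Then there exists a constant $C>0$ such that the $m$-th order commutator $$(T_{\alpha,b}^{m}f)(x)=\int_{\mathbb{R}^{n}}e^{iP(x,y)}K_{\alpha}(x,y)\,(b(x)-b(y))^{m}f(y)\,dy$$ satisfies $$\|T^{m}_{\alpha,b}f\|_{L^{q}(w^{q})}\le C\|f\|_{L^{p}(w^{p})}\quad\text{for all } f\in L^p(w^p).$$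
   Context: A polynomial $P(x,y)$ on $\mathbb{R}^n\times\mathbb{R}^n$ is called nontrivial if it is not of the form $P_0(x)+P_1(y)$ with $P_0,P_1$ polynomials on $\mathbb{R}^n$. Multi-index notation is used: $x^\beta=x_1^{\beta_1}\cdots x_n^{\beta_n}$, $|\beta|=\beta_1+\cdots+\beta_n$. A weight is a non-negative locally integrable function on $\mathbb{R}^n$, and for a weight $v$ and $1<r<\infty$, $\|f\|_{L^r(v)}=\left(\int_{\mathbb{R}^n}|f(x)|^rv(x)\,dx\right)^{1/r}$. For $1<p,q<\infty$ and $1/p+1/p'=1$, $w\in A_{(p,q)}$ means $$\sup_{Q}\left(\frac{1}{|Q|}\int_{Q}w(x)^{q}\,dx\right)^{1/q}\left(\frac{1}{|Q|}\int_{Q}w(x)^{-p'}\,dx\right)^{1/p'}<\infty,$$ where the supremum is over all cubes $Q\subset\mathbb{R}^n$. A function $b\in L^1_{loc}(\mathbb{R}^n)$ belongs to $BMO(\mathbb{R}^n)$ if $\|b\|_{BMO(\mathbb{R}^n)}=\sup_{Q}\frac{1}{|Q|}\int_{Q}|b-b_{Q}|<\infty$, where $b_{Q}=\frac{1}{|Q|}\int_{Q}b$ and $Q$ ranges over cubes. *)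

theory Defs
  imports "HOL-Analysis.Analysis"
begin

definition multi_deg :: "('n::finite \<Rightarrow> nat) \<Rightarrow> nat" where
  "multi_deg \<beta> = (\<Sum>i\<in>UNIV. \<beta> i)"

definition multi_pow :: "real ^ 'n \<Rightarrow> ('n::finite \<Rightarrow> nat) \<Rightarrow> real" where
  "multi_pow x \<beta> = (\<Prod>i\<in>UNIV. (x $ i) ^ \<beta> i)"

definition nontrivial_poly :: "(real ^ 'n \<Rightarrow> real ^ 'n \<Rightarrow> real) \<Rightarrow> bool" where
  "nontrivial_poly P \<longleftrightarrow>
     \<not> (\<exists>P0 P1. real_polynomial_function P0 \<and> real_polynomial_function P1 \<and>
             (\<forall>x y. P x y = P0 x + P1 y))"

definition cubes :: "(real ^ 'n) set set" where
  "cubes = {cbox a (\<chi> i. a $ i + h) | a h. 0 < h}"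

definition avg :: "(real ^ 'n) set \<Rightarrow> (real ^ 'n \<Rightarrow> 'b::{banach,second_countable_topology}) \<Rightarrow> 'b" where
  "avg Q f = (LINT x:Q|lebesgue. f x) /\<^sub>R measure lebesgue Q"

definition locally_integrable ::
  "(real ^ 'n \<Rightarrow> 'b::{banach,second_countable_topology}) \<Rightarrow> bool" where
  "locally_integrable f \<longleftrightarrow> (\<forall>S. compact S \<longrightarrow> set_integrable lebesgue S f)"

definition weight :: "(real ^ 'n \<Rightarrow> real) \<Rightarrow> bool" where
  "weight v \<longleftrightarrow> (\<forall>x. 0 \<le> v x) \<and> locally_integrable v"

definition Lp_space :: "real \<Rightarrow> (real ^ 'n \<Rightarrow> real) \<Rightarrow> (real ^ 'n \<Rightarrow> complex) set" where
  "Lp_space r v = {f. f \<in> borel_measurable lebesgue \<and>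
                      integrable lebesgue (\<lambda>x. norm (f x) powr r * v x)}"

definition Lp_norm :: "real \<Rightarrow> (real ^ 'n \<Rightarrow> real) \<Rightarrow> (real ^ 'n \<Rightarrow> complex) \<Rightarrow> real" where
  "Lp_norm r v f = (LINT x|lebesgue. norm (f x) powr r * v x) powr (1 / r)"

(* Mathematically w^(-p') is infinite where w = 0, so a finite supremum forces w > 0
   almost everywhere.  As 0 powr s = 0 and the Bochner integral of a non-integrable
   function is 0, positivity and the two integrability conditions are spelled out. *)
definition A_pq :: "real \<Rightarrow> real \<Rightarrow> (real ^ 'n \<Rightarrow> real) set" where
  "A_pq p q = {w. weight w \<and> (AE x in lebesgue. 0 < w x) \<and>
     (let p' = p / (p - 1) in
       (\<forall>Q\<in>cubes. set_integrable lebesgue Q (\<lambda>x. w x powr q) \<and>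
                  set_integrable lebesgue Q (\<lambda>x. w x powr (- p'))) \<and>
       bdd_above ((\<lambda>Q. avg Q (\<lambda>x. w x powr q) powr (1 / q) *
                       avg Q (\<lambda>x. w x powr (- p')) powr (1 / p')) ` cubes))}"

definition BMO :: "(real ^ 'n \<Rightarrow> complex) set" where
  "BMO = {b. locally_integrable b \<and>
             bdd_above ((\<lambda>Q. avg Q (\<lambda>x. norm (b x - avg Q b))) ` cubes)}"

definition grad :: "(real ^ 'n \<Rightarrow> complex) \<Rightarrow> real ^ 'n \<Rightarrow> complex ^ 'n" where
  "grad f x = (\<chi> j. frechet_derivative f (at x) (axis j 1))"

(* The values of K on the diagonal are irrelevant. *)
definition fractional_kernel ::
  "real \<Rightarrow> real \<Rightarrow> (real ^ 'n \<Rightarrow> real ^ 'n \<Rightarrow> complex) \<Rightarrow> bool" where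
  "fractional_kernel \<alpha> C0 K \<longleftrightarrow>
     (\<forall>x y. x \<noteq> y \<longrightarrow>
        norm (K x y) \<le> C0 / norm (x - y) powr (real CARD('n) - \<alpha>) \<and>
        (\<lambda>u. K u y) differentiable (at x) \<and> (\<lambda>v. K x v) differentiable (at y) \<and>
        norm (grad (\<lambda>u. K u y) x) + norm (grad (\<lambda>v. K x v) y)
          \<le> C0 / norm (x - y) powr (real CARD('n) + 1 - \<alpha>))"

definition kernel_op ::
  "(real ^ 'n \<Rightarrow> real ^ 'n \<Rightarrow> complex) \<Rightarrow> (real ^ 'n \<Rightarrow> complex) \<Rightarrow> real ^ 'n \<Rightarrow> complex" where
  "kernel_op K f x = (LINT y|lebesgue. K x y * f y)"

definition kernel_converges ::
  "(real ^ 'n \<Rightarrow> real ^ 'n \<Rightarrow> complex) \<Rightarrow> (real ^ 'n \<Rightarrow> complex) \<Rightarrow> bool" where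
  "kernel_converges K f \<longleftrightarrow> (AE x in lebesgue. integrable lebesgue (\<lambda>y. K x y * f y))"

(* The size condition does not make the integral converge for every f in L^2.  The bound is
   required on the natural domain of the operator, the f in L^2 for which the integral
   converges absolutely for almost every x; for a fractional kernel this contains the bounded
   functions of compact support, which are dense. *)
definition bounded_on_L2 :: "(real ^ 'n \<Rightarrow> real ^ 'n \<Rightarrow> complex) \<Rightarrow> bool" where
  "bounded_on_L2 K \<longleftrightarrow>
     (\<exists>C. \<forall>f\<in>Lp_space 2 (\<lambda>_. 1). kernel_converges K f \<longrightarrow>
        kernel_op K f \<in> Lp_space 2 (\<lambda>_. 1) \<and>
        Lp_norm 2 (\<lambda>_. 1) (kernel_op K f) \<le> C * Lp_norm 2 (\<lambda>_. 1) f)"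

definition commutator_kernel ::
  "(real ^ 'n \<Rightarrow> real ^ 'n \<Rightarrow> real) \<Rightarrow> (real ^ 'n \<Rightarrow> real ^ 'n \<Rightarrow> complex) \<Rightarrow>
   (real ^ 'n \<Rightarrow> complex) \<Rightarrow> nat \<Rightarrow> real ^ 'n \<Rightarrow> real ^ 'n \<Rightarrow> complex" where
  "commutator_kernel P K b m x y =
     exp (\<i> * complex_of_real (P x y)) * K x y * (b x - b y) ^ m"

end

theory Submission imports Defs begin

text \<open>
  The factor \<open>exp (\<i> P(x, y))\<close> has modulus one, so by the size bound on \<open>K\<close> the commutator is dominated by
  the positive operator with kernel \<open>|b(x) - b(y)|^m |x - y|^(\<alpha> - n)\<close>. A power is at most a multiple of an
  exponential, and \<open>exp (\<epsilon> |b(x) - b(y)|)\<close> is bounded by the sum over the four signs \<open>s, t = \<plusminus>1\<close> of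
  \<open>exp (\<epsilon> \<beta>(x)) exp (- \<epsilon> \<beta>(y))\<close> with \<open>\<beta> = s Re b + t Im b\<close>. The exponentials can be absorbed into the function
  and the weight, and the commutator estimate becomes the estimate of the Riesz potential from
  \<open>L^p(W^p)\<close> to \<open>L^q(W^q)\<close> for the four weights \<open>W = w exp (\<epsilon> \<beta>)\<close>. Two facts remain.

  First, \<open>W\<close> is again an \<open>A_(p,q)\<close> weight when \<open>\<epsilon>\<close> is small (\<open>Apq_cells_exp_bmo\<close>). Both \<open>w^q\<close> and \<open>w^(-p')\<close>
  are \<open>A_\<infinity>\<close> weights, because a set filling half of a cube carries a fixed proportion of their mass
  (\<open>half_mass\<close>). For such a weight \<open>v\<close> the John-Nirenberg inequality holds with respect to the measure
  \<open>v dx\<close> (\<open>weighted_john_nirenberg\<close>), so on a cube \<open>exp (\<epsilon> \<beta>)\<close> may be replaced by the constant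
  \<open>exp (\<epsilon> \<beta>_Q)\<close>, and these constants cancel in the \<open>A_(p,q)\<close> product.

  Second, the Riesz potential satisfies the Muckenhoupt-Wheeden estimate with a constant depending only on the
  \<open>A_(p,q)\<close> constant (\<open>riesz_potential_weighted_bound\<close>). Each truncation of the kernel is dominated by
  dyadic kernels over \<open>2^n\<close> shifted grids (\<open>riesz_kernel_le_dyadic\<close>). The dyadic operator (\<open>dyadic_op_bound\<close>)
  is tested against \<open>(T f)^(q - 1) w^q\<close>. Principal cubes reduce the resulting bilinear sum to a sparse one, the \<open>A_(p,q)\<close>
  condition splits each term into a factor for \<open>w^(-p')\<close> and a factor for \<open>w^q\<close>, and the Carleson
  embedding theorem (\<open>carleson_embedding\<close>) is applied to each of them.
\<close>

section \<open>Shifted dyadic grids\<close>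

definition half_open_cube :: "real ^ 'n \<Rightarrow> real \<Rightarrow> (real ^ 'n) set" where
  "half_open_cube a h = {x. \<forall>i. a $ i \<le> x $ i \<and> x $ i < a $ i + h}"

text \<open>
  The dyadic cell of side \<open>2^(-k)\<close> containing \<open>y\<close>, in the grid with origin \<open>u\<close>. Carrying the origin as a
  parameter makes translated grids available without translating functions or weights; describing cells by
  floors makes the partition into cells immediate.
\<close>
definition cell :: "real ^ 'n \<Rightarrow> int \<Rightarrow> real ^ 'n \<Rightarrow> (real ^ 'n) set" where
  "cell u k y = {x. \<forall>i. \<lfloor>2 powi k * (x $ i - u $ i)\<rfloor> = \<lfloor>2 powi k * (y $ i - u $ i)\<rfloor>}"

lemma half_open_cube_between:
  "box a (\<chi> i. a $ i + h) \<subseteq> half_open_cube a h"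
  "half_open_cube a h \<subseteq> cbox a (\<chi> i. a $ i + h)"
  by (auto simp: half_open_cube_def mem_box_cart less_imp_le)

lemma half_open_cube_borel [measurable]: "half_open_cube (a :: real ^ 'n) h \<in> sets borel"
proof -
  have "half_open_cube a h = (\<Inter>i. {x. a $ i \<le> x $ i} \<inter> {x. x $ i < a $ i + h})"
    by (auto simp: half_open_cube_def)
  also have "\<dots> \<in> sets borel"
    by (intro sets.countable_INT'') auto
  finally show ?thesis .
qed

lemma emeasure_cube:
  fixes a :: "real ^ 'n"
  assumes "0 \<le> h"
  shows "emeasure lborel (cbox a (\<chi> i. a $ i + h)) = ennreal (h ^ CARD('n))"
    and "emeasure lborel (box a (\<chi> i. a $ i + h)) = ennreal (h ^ CARD('n))"
proof -
  have le: "a \<bullet> b \<le> (\<chi> i. a $ i + h) \<bullet> b" if "b \<in> Basis" for b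
    using that assms by (auto simp: Basis_vec_def inner_axis)
  have "(\<Prod>b\<in>Basis. ((\<chi> i. a $ i + h) - a) \<bullet> b) = (\<Prod>b\<in>(Basis :: (real ^ 'n) set). h)"
    by (rule prod.cong) (auto simp: Basis_vec_def inner_axis)
  also have "\<dots> = h ^ CARD('n)" by simp
  finally have *: "(\<Prod>b\<in>Basis. ((\<chi> i. a $ i + h) - a) \<bullet> b) = h ^ CARD('n)" .
  show "emeasure lborel (cbox a (\<chi> i. a $ i + h)) = ennreal (h ^ CARD('n))"
    using le * by (subst emeasure_lborel_cbox) auto
  show "emeasure lborel (box a (\<chi> i. a $ i + h)) = ennreal (h ^ CARD('n))"
    using le * by (subst emeasure_lborel_box) auto
qed

lemma emeasure_half_open_cube:
  fixes a :: "real ^ 'n"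
  assumes "0 \<le> h"
  shows "emeasure lborel (half_open_cube a h) = ennreal (h ^ CARD('n))"
proof (rule antisym)
  show "emeasure lborel (half_open_cube a h) \<le> ennreal (h ^ CARD('n))"
    using emeasure_mono[OF half_open_cube_between(2)[of a h], of lborel] emeasure_cube(1)[OF assms, of a] by simp
  show "ennreal (h ^ CARD('n)) \<le> emeasure lborel (half_open_cube a h)"
    using emeasure_mono[OF half_open_cube_between(1)[of a h], of lborel] emeasure_cube(2)[OF assms, of a] by simp
qed

lemma AE_half_open_cube_iff:
  fixes a :: "real ^ 'n"
  assumes "0 \<le> h"
  shows "AE x in lborel. x \<in> half_open_cube a h \<longleftrightarrow> x \<in> cbox a (\<chi> i. a $ i + h)"
proof -
  let ?C = "cbox a (\<chi> i. a $ i + h)" and ?H = "half_open_cube a h"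
  have "emeasure lborel (?C - ?H) = emeasure lborel ?C - emeasure lborel ?H"
    using half_open_cube_between(2)[of a h] emeasure_half_open_cube[OF assms, of a]
    by (intro emeasure_Diff) auto
  also have "\<dots> = 0" using emeasure_half_open_cube[OF assms, of a] emeasure_cube[OF assms, of a] by simp
  finally have "?C - ?H \<in> null_sets lborel" by (auto simp: null_sets_def)
  then have "AE x in lborel. x \<notin> ?C - ?H" by (rule AE_not_in)
  then show ?thesis
    by (rule eventually_mono) (use half_open_cube_between(2)[of a h] in auto)
qed

lemma cell_refl [simp]: "y \<in> cell u k y"
  by (simp add: cell_def)

lemma cell_eq_iff: "x \<in> cell u k y \<longleftrightarrow> cell u k x = cell u k y"
  by (auto simp: cell_def)

lemma cell_eqI: "x \<in> cell u k y \<Longrightarrow> cell u k x = cell u k y"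
  by (simp add: cell_eq_iff)

text \<open>
  A coarser floor is determined by a finer one; this is what makes the cells nested.
\<close>
lemma floor_rescale:
  fixes t :: real
  assumes "j \<le> k"
  shows "\<lfloor>2 powi j * t\<rfloor> = \<lfloor>2 powi k * t\<rfloor> div 2 ^ nat (k - j)"
proof -
  have "(2::real) powi k = 2 powi j * 2 powi (k - j)"
    by (subst power_int_add[symmetric]) auto
  also have "(2::real) powi (k - j) = 2 ^ nat (k - j)"
    using assms by (simp add: power_int_def)
  finally have "2 powi j * t = (2 powi k * t) / of_int (2 ^ nat (k - j))"
    by simp
  then show ?thesis by (simp only: floor_divide_real_eq_div zero_le_power zero_le_numeral)
qed

lemma cell_mono: "j \<le> k \<Longrightarrow> cell u k y \<subseteq> cell u j y"
  unfolding cell_def by (auto simp: floor_rescale[of j k])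

lemma cell_subset_or_disjoint:
  assumes "j \<le> k"
  shows "cell u k x \<subseteq> cell u j y \<or> cell u k x \<inter> cell u j y = {}"
proof (cases "cell u k x \<inter> cell u j y = {}")
  case False
  then obtain z where "z \<in> cell u k x" "z \<in> cell u j y" by auto
  then have "cell u k x = cell u k z" "cell u j y = cell u j z" by (simp_all add: cell_eqI)
  then show ?thesis using cell_mono[OF assms, of u z] by simp
qed simp

lemma cell_eq_half_open_cube:
  "cell u k y = half_open_cube (\<chi> i. u $ i + of_int \<lfloor>2 powi k * (y $ i - u $ i)\<rfloor> * 2 powi (- k)) (2 powi (- k))"
proof -
  have "\<lfloor>2 powi k * (s - v)\<rfloor> = z \<longleftrightarrow> v + of_int z * 2 powi (- k) \<le> s \<and> s < v + of_int z * 2 powi (- k) + 2 powi (- k)"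
    for s v :: real and z :: int
  proof -
    have "\<lfloor>2 powi k * (s - v)\<rfloor> = z \<longleftrightarrow> of_int z \<le> 2 powi k * (s - v) \<and> 2 powi k * (s - v) < of_int z + 1"
      by (simp add: floor_eq_iff)
    also have "\<dots> \<longleftrightarrow> of_int z / 2 powi k \<le> s - v \<and> s - v < (of_int z + 1) / 2 powi k"
      by (simp add: pos_divide_le_eq pos_less_divide_eq mult.commute)
    finally show ?thesis by (simp add: power_int_minus field_simps)
  qed
  then show ?thesis by (auto simp: cell_def half_open_cube_def)
qed

lemma cell_borel [measurable]: "cell u k y \<in> sets borel"
  by (simp add: cell_eq_half_open_cube)

lemma emeasure_cell: "emeasure lborel (cell (u :: real ^ 'n) k y) = ennreal ((2 powi (- k)) ^ CARD('n))"
  unfolding cell_eq_half_open_cube by (rule emeasure_half_open_cube) simp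

lemma measure_cell: "measure lborel (cell (u :: real ^ 'n) k y) = (2 powi (- k)) ^ CARD('n)"
  by (simp add: measure_def emeasure_cell)

lemma measure_cell_pos: "0 < measure lborel (cell u k y)"
  by (simp add: measure_cell)

text \<open>
  The volume of a cell determines its level, so cells can be handled as plain sets.
\<close>
lemma cell_level_le:
  fixes u :: "real ^ 'n"
  assumes "cell u k x \<subseteq> cell u j y"
  shows "j \<le> k"
proof (rule ccontr)
  assume "\<not> j \<le> k"
  then have "(2::real) powi (- j) < 2 powi (- k)" by (intro power_int_strict_increasing) auto
  then have "((2::real) powi (- j)) ^ CARD('n) < (2 powi (- k)) ^ CARD('n)"
    by (intro power_strict_mono) auto
  moreover have "measure lborel (cell u k x) \<le> measure lborel (cell u j y)"
    using assms by (intro measure_mono_fmeasurable) (auto simp: fmeasurable_def emeasure_cell)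
  ultimately show False unfolding measure_cell by linarith
qed

text \<open>
  A cell of level \<open>j\<close> is determined by the integer vector of floors, and inside a cell of level \<open>k\<close> each
  coordinate of that vector is confined to an interval of length \<open>2^(j - k)\<close>.
\<close>
lemma finite_subcells:
  fixes u :: "real ^ 'n"
  shows "finite {cell u j x | x. x \<in> cell u k y}"
proof (cases "k \<le> j")
  case True
  define z where "z i = \<lfloor>2 powi k * (y $ i - u $ i)\<rfloor>" for i
  define D where "D = (2::int) ^ nat (j - k)"
  define c where "c f = {x. \<forall>i. \<lfloor>2 powi j * (x $ i - u $ i)\<rfloor> = f i}" for f :: "'n \<Rightarrow> int"
  have D: "D > 0" by (simp add: D_def)
  have "{cell u j x | x. x \<in> cell u k y} \<subseteq> c ` (\<Pi>\<^sub>E i\<in>UNIV. {z i * D .. z i * D + D})"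
  proof clarify
    fix x assume "x \<in> cell u k y"
    then have eq: "\<lfloor>2 powi j * (x $ i - u $ i)\<rfloor> div D = z i" for i
      unfolding cell_def z_def D_def mem_Collect_eq floor_rescale[OF True, symmetric] by blast
    have "z i * D \<le> \<lfloor>2 powi j * (x $ i - u $ i)\<rfloor> \<and> \<lfloor>2 powi j * (x $ i - u $ i)\<rfloor> \<le> z i * D + D" for i
    proof -
      let ?a = "\<lfloor>2 powi j * (x $ i - u $ i)\<rfloor>"
      have "z i * D + ?a mod D = ?a" unfolding eq[of i, symmetric] by (rule div_mult_mod_eq)
      moreover have "0 \<le> ?a mod D" "?a mod D < D" using D by simp_all
      ultimately show ?thesis by linarith
    qed
    then have "(\<lambda>i. \<lfloor>2 powi j * (x $ i - u $ i)\<rfloor>) \<in> (\<Pi>\<^sub>E i\<in>UNIV. {z i * D .. z i * D + D})"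
      by (intro PiE_I) simp_all
    moreover have "cell u j x = c (\<lambda>i. \<lfloor>2 powi j * (x $ i - u $ i)\<rfloor>)"
      unfolding cell_def c_def ..
    ultimately show "cell u j x \<in> c ` (\<Pi>\<^sub>E i\<in>UNIV. {z i * D .. z i * D + D})"
      by (intro image_eqI)
  qed
  note sub = this
  have "finite (\<Pi>\<^sub>E i\<in>(UNIV :: 'n set). {z i * D .. z i * D + D})"
    by (rule finite_PiE) simp_all
  then have "finite (c ` (\<Pi>\<^sub>E i\<in>UNIV. {z i * D .. z i * D + D}))"
    by (rule finite_imageI)
  with sub show ?thesis by (rule finite_subset)
next
  case False
  have "{cell u j x | x. x \<in> cell u k y} \<subseteq> {cell u j y}"
  proof clarify
    fix x assume "x \<in> cell u k y"
    then have "x \<in> cell u j y" using cell_mono[of j k u y] False by auto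
    then show "cell u j x = cell u j y" by (rule cell_eqI)
  qed
  then show ?thesis by (rule finite_subset) simp
qed

definition grid :: "real ^ 'n \<Rightarrow> (real ^ 'n) set set" where
  "grid u = {cell u k y | k y. True}"

lemma countable_grid: "countable (grid (u :: real ^ 'n))"
proof -
  have "grid u \<subseteq> range (\<lambda>(k :: int, f :: 'n \<Rightarrow> int). {x. \<forall>i. \<lfloor>2 powi k * (x $ i - u $ i)\<rfloor> = f i})"
  proof
    fix Q assume "Q \<in> grid u"
    then obtain k y where "Q = cell u k y" by (auto simp: grid_def)
    then show "Q \<in> range (\<lambda>(k :: int, f :: 'n \<Rightarrow> int). {x. \<forall>i. \<lfloor>2 powi k * (x $ i - u $ i)\<rfloor> = f i})"
      unfolding cell_def by (intro image_eqI[of _ _ "(k, \<lambda>i. \<lfloor>2 powi k * (y $ i - u $ i)\<rfloor>)"]) simp_all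
  qed
  then show ?thesis by (rule countable_subset) (rule countable_image, rule countableI_type)
qed

definition laminar :: "'a set set \<Rightarrow> bool" where
  "laminar F \<longleftrightarrow> (\<forall>A\<in>F. \<forall>B\<in>F. A \<subseteq> B \<or> B \<subseteq> A \<or> A \<inter> B = {})"

lemma laminar_grid: "laminar (grid u)"
  unfolding laminar_def
proof (intro ballI)
  fix A B assume "A \<in> grid u" "B \<in> grid u"
  then obtain k y j z where AB: "A = cell u k y" "B = cell u j z" by (auto simp: grid_def)
  consider "j \<le> k" | "k \<le> j" by linarith
  then show "A \<subseteq> B \<or> B \<subseteq> A \<or> A \<inter> B = {}"
  proof cases
    case 1
    from cell_subset_or_disjoint[OF this, of u y z] show ?thesis unfolding AB by (elim disjE) simp_all
  next
    case 2
    from cell_subset_or_disjoint[OF this, of u z y] show ?thesis unfolding AB by (elim disjE) (simp_all add: Int_commute)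
  qed
qed

lemma laminar_subset: "laminar G \<Longrightarrow> F \<subseteq> G \<Longrightarrow> laminar F"
  unfolding laminar_def by (simp add: subset_iff)

section \<open>Principal cubes and the Carleson embedding\<close>

text \<open>
  The members of \<open>S\<close> are the principal sets: those on which \<open>a\<close> more than doubles compared with
  every principal set strictly above. The recursion runs downwards along inclusion, so a finite family is
  handled by removing a minimal set, which influences no other choice.
\<close>
lemma principal_selection:
  fixes a :: "'a set \<Rightarrow> real"
  assumes "finite F"
  shows "\<exists>S\<subseteq>F. \<forall>R\<in>F. R \<in> S \<longleftrightarrow> (\<forall>P\<in>S. R \<subset> P \<longrightarrow> 2 * a P < a R)"
  using assms
proof (induction "card F" arbitrary: F)
  case 0
  then show ?case by auto
next
  case (Suc n)
  then have "F \<noteq> {}" by auto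
  from finite_has_minimal[OF Suc.prems this]
  obtain R where R: "R \<in> F" and R_min: "\<forall>b\<in>F. b \<le> R \<longrightarrow> R = b" by (elim bexE)
  have card: "n = card (F - {R})" and fin: "finite (F - {R})" using Suc.hyps(2) Suc.prems R by simp_all
  from Suc.hyps(1)[OF card fin]
  obtain S where S: "S \<subseteq> F - {R}" and sel: "\<forall>Q\<in>F - {R}. Q \<in> S \<longleftrightarrow> (\<forall>P\<in>S. Q \<subset> P \<longrightarrow> 2 * a P < a Q)"
    by (elim exE conjE)
  define S' where "S' = (if \<forall>P\<in>S. R \<subset> P \<longrightarrow> 2 * a P < a R then insert R S else S)"
  have S'_eq: "Q \<in> S' \<longleftrightarrow> (if Q = R then \<forall>P\<in>S. R \<subset> P \<longrightarrow> 2 * a P < a R else Q \<in> S)" for Q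
    using S by (auto simp: S'_def)
  have "Q \<in> S' \<longleftrightarrow> (\<forall>P\<in>S'. Q \<subset> P \<longrightarrow> 2 * a P < a Q)" if "Q \<in> F" for Q
  proof -
    have "\<not> Q \<subset> R" using R_min that by blast
    then have "(\<forall>P\<in>S'. Q \<subset> P \<longrightarrow> 2 * a P < a Q) \<longleftrightarrow> (\<forall>P\<in>S. Q \<subset> P \<longrightarrow> 2 * a P < a Q)"
      by (simp add: S'_def)
    moreover have "Q \<in> S' \<longleftrightarrow> (\<forall>P\<in>S. Q \<subset> P \<longrightarrow> 2 * a P < a Q)"
    proof (cases "Q = R")
      case False
      then have "Q \<in> F - {R}" using that by simp
      with bspec[OF sel this] False show ?thesis by (simp only: S'_eq if_False)
    qed (simp add: S'_eq)
    ultimately show ?thesis by (simp only:)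
  qed
  moreover have "S' \<subseteq> F" using S R unfolding S'_def by (simp split: if_split) blast
  ultimately show ?case by (intro exI[of _ S'] conjI ballI)
qed

lemma principal_parent:
  fixes a :: "'a set \<Rightarrow> real"
  assumes "\<And>R. R \<in> F \<Longrightarrow> R \<in> S \<longleftrightarrow> (\<forall>P\<in>S. R \<subset> P \<longrightarrow> 2 * a P < a R)" and "Q \<in> F" and "0 \<le> a Q"
  shows "\<exists>P\<in>S. Q \<subseteq> P \<and> a Q \<le> 2 * a P"
proof (cases "Q \<in> S")
  case True
  then show ?thesis using assms(3) by (intro bexI[of _ Q]) auto
next
  case False
  then show ?thesis using assms(1)[OF assms(2)] by (metis linorder_not_less psubset_imp_subset)
qed

text \<open>
  Among values that pairwise differ by a factor greater than two, the sum of powers is a geometric series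
  headed by the largest value.
\<close>
lemma sum_powr_separated:
  fixes a :: "'i \<Rightarrow> real"
  assumes "finite T" and "0 < s"
    and "\<And>i. i \<in> T \<Longrightarrow> 0 \<le> a i"
    and "\<And>i j. i \<in> T \<Longrightarrow> j \<in> T \<Longrightarrow> i \<noteq> j \<Longrightarrow> 2 * a i < a j \<or> 2 * a j < a i"
    and "\<And>i. i \<in> T \<Longrightarrow> a i \<le> B" and "0 \<le> B"
  shows "(\<Sum>i\<in>T. a i powr s) \<le> B powr s / (1 - 2 powr (- s))"
  using assms(1,3-)
proof (induction "card T" arbitrary: T B)
  case 0
  have "(2::real) powr (- s) < 1" using assms(2) by (simp add: powr_less_one)
  with 0 show ?case by auto
next
  case (Suc n)
  have r: "(2::real) powr (- s) < 1" using assms(2) by (simp add: powr_less_one)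
  define t where "t = (2::real) powr (- s)"
  have t: "0 < t" "t < 1" using r by (auto simp: t_def)
  have ne: "T \<noteq> {}" using Suc by auto
  obtain i where i: "i \<in> T" "\<And>j. j \<in> T \<Longrightarrow> a j \<le> a i"
  proof -
    have "Max (a ` T) \<in> a ` T" using Suc.prems(1) ne by (intro Max_in) auto
    then obtain i where "i \<in> T" "a i = Max (a ` T)" by auto
    moreover have "a j \<le> Max (a ` T)" if "j \<in> T" for j using that Suc.prems(1) by simp
    ultimately show ?thesis using that by metis
  qed
  have sm: "a j \<le> a i / 2" if "j \<in> T - {i}" for j
    using Suc.prems(3)[of i j] Suc.prems(2)[of i] Suc.prems(2)[of j] i(1) i(2)[of j] that by force
  have "(\<Sum>j\<in>T - {i}. a j powr s) \<le> (a i / 2) powr s / (1 - 2 powr (- s))"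
  proof (rule Suc.hyps(1))
    show "n = card (T - {i})" using Suc.hyps(2) Suc.prems(1) i(1) by simp
    show "0 \<le> a i / 2" using Suc.prems(2)[OF i(1)] by simp
    show "finite (T - {i})" using Suc.prems(1) by simp
    show "0 \<le> a j" if "j \<in> T - {i}" for j using Suc.prems(2) that by blast
    show "2 * a j < a l \<or> 2 * a l < a j" if "j \<in> T - {i}" "l \<in> T - {i}" "j \<noteq> l" for j l
      using Suc.prems(3) that by blast
  qed (rule sm)
  also have "(a i / 2) powr s = a i powr s * t"
    using Suc.prems(2)[OF i(1)] by (simp add: t_def powr_divide powr_minus_divide)
  finally have "(\<Sum>j\<in>T. a j powr s) \<le> a i powr s + a i powr s * t / (1 - t)"
    using Suc.prems(1) i(1) by (subst sum.remove[of _ i]) (auto simp: t_def)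
  also have "\<dots> = a i powr s / (1 - t)" using t by (simp add: field_simps)
  also have "\<dots> \<le> B powr s / (1 - t)"
    using t Suc.prems(2)[OF i(1)] Suc.prems(4)[OF i(1)] assms(2) by (intro divide_right_mono powr_mono2) simp_all
  finally show ?case by (simp add: t_def)
qed

text \<open>
  With \<open>D = 1 / (1 - 2^(1 - r))\<close> the sum of the geometric series in the exponent \<open>r - 1\<close>, this is
  \<open>D (2 D)^(r - 1)\<close>, the price of absorbing \<open>c D t^(r - 1)\<close> into half of \<open>t^r\<close>.
\<close>
definition carleson_const :: "real \<Rightarrow> real" where
  "carleson_const r = (1 / (1 - 2 powr (- (r - 1)))) * (2 / (1 - 2 powr (- (r - 1)))) powr (r - 1)"

lemma carleson_const_nonneg: "1 < r \<Longrightarrow> 0 \<le> carleson_const r"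
  using powr_less_one[of 2 "- (r - 1)"] by (simp add: carleson_const_def)

text \<open>
  The largest value \<open>t\<close> controls both sums: the left side is at most \<open>c D t^(r - 1)\<close>. If \<open>t\<close> is large compared
  with \<open>c\<close> this is absorbed by \<open>t^r / 2\<close>, otherwise it is at most a multiple of \<open>c^r\<close>.
\<close>
lemma separated_absorption:
  fixes a :: "'i \<Rightarrow> real"
  assumes "finite T" and "1 < r" and "0 \<le> c"
    and a0: "\<And>i. i \<in> T \<Longrightarrow> 0 \<le> a i"
    and sep: "\<And>i j. i \<in> T \<Longrightarrow> j \<in> T \<Longrightarrow> i \<noteq> j \<Longrightarrow> 2 * a i < a j \<or> 2 * a j < a i"
  shows "c * (\<Sum>i\<in>T. a i powr (r - 1)) \<le> (\<Sum>i\<in>T. a i powr r) / 2 + carleson_const r * c powr r"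
proof (cases "T = {}")
  case True
  then show ?thesis using carleson_const_nonneg[OF assms(2)] by simp
next
  case False
  define D where "D = 1 / (1 - 2 powr (- (r - 1)))"
  have D: "0 < D" using assms(2) powr_less_one[of 2 "- (r - 1)"] by (simp add: D_def)
  have "Max (a ` T) \<in> a ` T" using assms(1) False by (intro Max_in) auto
  then obtain k where k: "k \<in> T" "a k = Max (a ` T)" by auto
  have mx: "a j \<le> a k" if "j \<in> T" for j unfolding k(2) using that assms(1) by simp
  have k0: "0 \<le> a k" using a0[OF k(1)] .
  have "(\<Sum>i\<in>T. a i powr (r - 1)) \<le> a k powr (r - 1) / (1 - 2 powr (- (r - 1)))"
    using assms(1,2) a0 sep mx k0 by (intro sum_powr_separated) simp_all
  then have le: "c * (\<Sum>i\<in>T. a i powr (r - 1)) \<le> c * (D * a k powr (r - 1))"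
    using assms(3) by (intro mult_left_mono) (auto simp: D_def)
  have C: "carleson_const r = D * (2 * D) powr (r - 1)"
    by (simp add: carleson_const_def D_def)
  show ?thesis
  proof (cases "2 * c * D \<le> a k")
    case True
    then have "c * D * a k powr (r - 1) \<le> a k / 2 * a k powr (r - 1)"
      by (intro mult_right_mono) auto
    also have "\<dots> = a k powr r / 2"
      using k0 powr_mult_base[of "a k" "r - 1"] by simp
    also have "\<dots> \<le> (\<Sum>i\<in>T. a i powr r) / 2"
      using assms(1) k by (intro divide_right_mono member_le_sum) auto
    finally have "c * (D * a k powr (r - 1)) \<le> (\<Sum>i\<in>T. a i powr r) / 2" by (simp only: mult.assoc)
    moreover have "0 \<le> carleson_const r * c powr r" using carleson_const_nonneg[OF assms(2)] by simp
    ultimately show ?thesis using le by linarith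
  next
    case False
    then have "c * D * a k powr (r - 1) \<le> c * D * (2 * D * c) powr (r - 1)"
      using D assms(2,3) k0 by (intro mult_left_mono powr_mono2) (auto simp: mult_ac)
    also have "\<dots> = carleson_const r * c powr r"
    proof -
      have "(2 * D * c) powr (r - 1) = (2 * D) powr (r - 1) * c powr (r - 1)"
        using D assms(3) by (subst powr_mult) simp_all
      moreover have "c * c powr (r - 1) = c powr r" using powr_mult_base[of c "r - 1"] assms(3) by simp
      ultimately show ?thesis unfolding C by (metis mult.assoc mult.commute)
    qed
    finally show ?thesis using le sum_nonneg[of T "\<lambda>i. a i powr r"] by (simp add: algebra_simps)
  qed
qed

lemma sum_set_integral_disjoint_le:
  fixes g :: "'a \<Rightarrow> real"
  assumes "finite G" and "disjoint_family_on E G"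
    and E: "\<And>Q. Q \<in> G \<Longrightarrow> E Q \<subseteq> P" "\<And>Q. Q \<in> G \<Longrightarrow> E Q \<in> sets M"
    and g: "set_integrable M P g" "\<And>x. 0 \<le> g x" and P: "P \<in> sets M"
  shows "(\<Sum>Q\<in>G. LINT x:E Q|M. g x) \<le> (LINT x:P|M. g x)"
proof -
  have int: "set_integrable M (E Q) g" if "Q \<in> G" for Q
    using set_integrable_subset[OF g(1)] E that by blast
  have "(\<Sum>Q\<in>G. LINT x:E Q|M. g x) = (LINT x|M. (\<Sum>Q\<in>G. indicator (E Q) x * g x))"
    using int by (simp add: set_lebesgue_integral_def set_integrable_def)
  also have "\<dots> \<le> (LINT x|M. indicator P x * g x)"
  proof (rule integral_mono)
    show "integrable M (\<lambda>x. \<Sum>Q\<in>G. indicator (E Q) x * g x)"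
      using int by (auto simp: set_integrable_def)
    show "integrable M (\<lambda>x. indicator P x * g x)"
      using g by (simp add: set_integrable_def)
    fix x
    have "(\<Sum>Q\<in>G. indicator (E Q) x) = (indicator (\<Union>Q\<in>G. E Q) x :: real)"
      using indicator_UN_disjoint[OF assms(1,2)] by metis
    also have "\<dots> \<le> indicator P x" using E(1) by (auto simp: indicator_def)
    finally show "(\<Sum>Q\<in>G. indicator (E Q) x * g x) \<le> indicator P x * g x"
      using g(2)[of x] by (simp add: sum_distrib_right[symmetric] mult_right_mono)
  qed
  finally show ?thesis by (simp add: set_lebesgue_integral_def)
qed

text \<open>
  The weak type inequality of the dyadic maximal function: in a laminar family the maximal members are disjoint and have
  the same union.
\<close>
lemma laminar_weak_type:
  fixes g :: "'a \<Rightarrow> real"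
  assumes "finite G" "laminar G" and G: "\<And>R. R \<in> G \<Longrightarrow> R \<subseteq> P \<and> R \<in> fmeasurable M"
    and g: "set_integrable M P g" "\<And>x. 0 \<le> g x" and P: "P \<in> sets M"
    and avg: "\<And>R. R \<in> G \<Longrightarrow> l * measure M R \<le> (LINT x:R|M. g x)" and "0 \<le> l"
  shows "l * measure M (\<Union>G) \<le> (LINT x:P|M. g x)"
proof -
  define H where "H = {R \<in> G. \<forall>R'\<in>G. \<not> R \<subset> R'}"
  have H: "H \<subseteq> G" "finite H" using assms(1) by (auto simp: H_def)
  have "\<Union>G \<subseteq> \<Union>H"
  proof
    fix x assume "x \<in> \<Union>G"
    then obtain R where R: "R \<in> G" "x \<in> R" by auto
    obtain Q where "Q \<in> G" "R \<subseteq> Q" "\<forall>b\<in>G. Q \<subseteq> b \<longrightarrow> Q = b"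
      using finite_has_maximal2[OF assms(1) R(1)] by auto
    then show "x \<in> \<Union>H" using R(2) by (auto simp: H_def)
  qed
  then have eq: "\<Union>G = \<Union>H" using H by auto
  have disj: "disjoint_family_on (\<lambda>Q. Q) H"
    unfolding disjoint_family_on_def
  proof (intro ballI impI)
    fix A B assume AB: "A \<in> H" "B \<in> H" "A \<noteq> B"
    then have "\<not> A \<subset> B" "\<not> B \<subset> A" "A \<in> G" "B \<in> G" by (simp_all add: H_def)
    with AB(3) assms(2) show "A \<inter> B = {}" unfolding laminar_def by blast
  qed
  have "l * measure M (\<Union>G) \<le> l * (\<Sum>R\<in>H. measure M R)"
    unfolding eq using G H assms(8) measure_UNION_le[OF H(2), of "\<lambda>R. R" M] by (intro mult_left_mono) auto
  also have "\<dots> \<le> (\<Sum>R\<in>H. LINT x:R|M. g x)"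
    unfolding sum_distrib_left using H avg by (intro sum_mono) auto
  also have "\<dots> \<le> (LINT x:P|M. g x)"
    using H G g P disj by (intro sum_set_integral_disjoint_le) auto
  finally show ?thesis .
qed

text \<open>
  The averages of \<open>\<phi>\<close> are taken with respect to the measure \<open>v dM\<close>. Passing to the principal sets of these averages
  loses a factor \<open>2^r\<close>, and the disjoint sets \<open>E Q\<close> assigned to one principal set have
  total mass at most its own. For the sum \<open>Z\<close> over the principal sets, one average is unfolded into an
  integral of \<open>\<phi>\<close>; at each point the remaining powers are separated by factors of two, and
  \<open>separated_absorption\<close> gives \<open>Z\<close> bounded by \<open>Z / 2\<close> plus the right side.
\<close>
lemma carleson_embedding:
  fixes v \<phi> :: "'a \<Rightarrow> real"
  assumes F: "finite F" "laminar F" "F \<subseteq> sets M"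
    and r: "1 < r"
    and v: "\<And>x. 0 \<le> v x" and \<phi>: "\<And>x. 0 \<le> \<phi> x"
    and int: "\<And>Q. Q \<in> F \<Longrightarrow> set_integrable M Q v" "\<And>Q. Q \<in> F \<Longrightarrow> 0 < (LINT x:Q|M. v x)"
      "\<And>Q. Q \<in> F \<Longrightarrow> set_integrable M Q (\<lambda>x. \<phi> x * v x)" "integrable M (\<lambda>x. \<phi> x powr r * v x)"
    and E: "\<And>Q. Q \<in> F \<Longrightarrow> E Q \<subseteq> Q" "\<And>Q. Q \<in> F \<Longrightarrow> E Q \<in> sets M" "disjoint_family_on E F"
      "\<And>Q. Q \<in> F \<Longrightarrow> (LINT x:Q|M. v x) \<le> \<kappa> * (LINT x:E Q|M. v x)" and \<kappa>: "0 \<le> \<kappa>"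
  shows "(\<Sum>Q\<in>F. (LINT x:Q|M. v x) * ((LINT x:Q|M. \<phi> x * v x) / (LINT x:Q|M. v x)) powr r)
    \<le> \<kappa> * 2 powr r * (2 * carleson_const r) * (LINT x|M. \<phi> x powr r * v x)"
proof -
  define V where "V Q = (LINT x:Q|M. v x)" for Q
  define a where "a Q = (LINT x:Q|M. \<phi> x * v x) / V Q" for Q
  have V: "0 < V Q" if "Q \<in> F" for Q using int(2) that by (simp add: V_def)
  have a0: "0 \<le> a Q" if "Q \<in> F" for Q
    unfolding a_def set_lebesgue_integral_def
    by (intro divide_nonneg_pos V[OF that] Bochner_Integration.integral_nonneg scaleR_nonneg_nonneg mult_nonneg_nonneg v \<phi>) simp
  from principal_selection[OF F(1), of a]
  obtain S where S: "S \<subseteq> F" and S2: "\<forall>R\<in>F. R \<in> S \<longleftrightarrow> (\<forall>P\<in>S. R \<subset> P \<longrightarrow> 2 * a P < a R)"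
    by (elim exE conjE)
  have sel: "R \<in> S \<longleftrightarrow> (\<forall>P\<in>S. R \<subset> P \<longrightarrow> 2 * a P < a R)" if "R \<in> F" for R
    using bspec[OF S2 that] .
  have finS: "finite S" using S F(1) finite_subset by auto
  define \<pi> where "\<pi> Q = (SOME P. P \<in> S \<and> Q \<subseteq> P \<and> a Q \<le> 2 * a P)" for Q
  have \<pi>: "\<pi> Q \<in> S \<and> Q \<subseteq> \<pi> Q \<and> a Q \<le> 2 * a (\<pi> Q)" if "Q \<in> F" for Q
    unfolding \<pi>_def by (rule someI_ex) (use principal_parent[of F S a Q, OF sel that a0[OF that]] in blast)
  have "(\<Sum>Q\<in>F. V Q * a Q powr r) \<le> (\<Sum>Q\<in>F. \<kappa> * V (E Q) * (2 powr r * a (\<pi> Q) powr r))"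
  proof (rule sum_mono)
    fix Q assume Q: "Q \<in> F"
    have "a Q powr r \<le> (2 * a (\<pi> Q)) powr r"
      using \<pi>[OF Q] a0[OF Q] r by (intro powr_mono2) auto
    also have "\<dots> = 2 powr r * a (\<pi> Q) powr r" using a0 \<pi>[OF Q] S by (subst powr_mult) auto
    finally show "V Q * a Q powr r \<le> \<kappa> * V (E Q) * (2 powr r * a (\<pi> Q) powr r)"
      using E(4)[OF Q] V[OF Q] by (intro mult_mono) (auto simp: V_def)
  qed
  also have "\<dots> = \<kappa> * 2 powr r * (\<Sum>Q\<in>F. a (\<pi> Q) powr r * V (E Q))"
    by (simp add: sum_distrib_left algebra_simps)
  also have "(\<Sum>Q\<in>F. a (\<pi> Q) powr r * V (E Q)) = (\<Sum>P\<in>S. \<Sum>Q | Q \<in> F \<and> \<pi> Q = P. a (\<pi> Q) powr r * V (E Q))"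
    using F(1) finS \<pi> by (intro sum.group[symmetric]) auto
  also have "\<dots> \<le> (\<Sum>P\<in>S. a P powr r * V P)"
  proof (rule sum_mono)
    fix P assume P: "P \<in> S"
    have "(\<Sum>Q | Q \<in> F \<and> \<pi> Q = P. V (E Q)) \<le> V P"
      unfolding V_def
    proof (rule sum_set_integral_disjoint_le)
      show "disjoint_family_on E {Q \<in> F. \<pi> Q = P}" using E(3) by (auto simp: disjoint_family_on_def)
      show "E Q \<subseteq> P" if "Q \<in> {Q \<in> F. \<pi> Q = P}" for Q using that E(1)[of Q] \<pi>[of Q] by auto
    qed (use F P S E int v in auto)
    then have "a P powr r * (\<Sum>Q | Q \<in> F \<and> \<pi> Q = P. V (E Q)) \<le> a P powr r * V P"
      by (intro mult_left_mono) auto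
    then show "(\<Sum>Q | Q \<in> F \<and> \<pi> Q = P. a (\<pi> Q) powr r * V (E Q)) \<le> a P powr r * V P"
      by (simp add: sum_distrib_left)
  qed
  finally have 1: "(\<Sum>Q\<in>F. V Q * a Q powr r) \<le> \<kappa> * 2 powr r * (\<Sum>P\<in>S. a P powr r * V P)"
    using \<kappa> by (simp add: mult_left_mono)
  define Z where "Z = (\<Sum>P\<in>S. a P powr r * V P)"
  have i1: "integrable M (\<lambda>x. indicator P x * (\<phi> x * v x))" "integrable M (\<lambda>x. indicator P x * v x)" if "P \<in> S" for P
    using int(1,3)[of P] S that by (auto simp: set_integrable_def)
  have "Z = (\<Sum>P\<in>S. a P powr (r - 1) * (LINT x:P|M. \<phi> x * v x))"
    unfolding Z_def
  proof (rule sum.cong[OF refl])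
    fix P assume "P \<in> S"
    then have P: "P \<in> F" using S by auto
    have "a P powr r = a P powr (r - 1) * a P"
      using a0[OF P] r by (cases "a P = 0") (auto simp: powr_diff)
    then show "a P powr r * V P = a P powr (r - 1) * (LINT x:P|M. \<phi> x * v x)"
      using V[OF P] by (simp add: a_def)
  qed
  also have "\<dots> = (LINT x|M. (\<Sum>P\<in>S. a P powr (r - 1) * (indicator P x * (\<phi> x * v x))))"
    using i1 by (simp add: set_lebesgue_integral_def)
  also have "\<dots> \<le> (LINT x|M. (\<Sum>P\<in>S. a P powr r * (indicator P x * v x)) / 2 + carleson_const r * (\<phi> x powr r * v x))"
  proof (rule integral_mono)
    show "integrable M (\<lambda>x. \<Sum>P\<in>S. a P powr (r - 1) * (indicator P x * (\<phi> x * v x)))"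
      using i1 by (intro Bochner_Integration.integrable_sum integrable_mult_right) auto
    show "integrable M (\<lambda>x. (\<Sum>P\<in>S. a P powr r * (indicator P x * v x)) / 2 + carleson_const r * (\<phi> x powr r * v x))"
      using i1 int(4) by (intro Bochner_Integration.integrable_add integrable_divide Bochner_Integration.integrable_sum integrable_mult_right) auto
    fix x assume "x \<in> space M"
    define T where "T = {P \<in> S. x \<in> P}"
    have sum_T: "(\<Sum>P\<in>S. h P * indicator P x) = (\<Sum>P\<in>T. h P)" for h :: "'a set \<Rightarrow> real"
      unfolding T_def by (subst sum.inter_filter[OF finS]) (auto simp: indicator_def intro!: sum.cong)
    have "\<phi> x * (\<Sum>P\<in>T. a P powr (r - 1)) \<le> (\<Sum>P\<in>T. a P powr r) / 2 + carleson_const r * \<phi> x powr r"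
    proof (rule separated_absorption)
      show "2 * a P < a R \<or> 2 * a R < a P" if "P \<in> T" "R \<in> T" "P \<noteq> R" for P R
      proof -
        have PR: "P \<in> S" "R \<in> S" "x \<in> P" "x \<in> R" using that by (auto simp: T_def)
        then have "P \<subset> R \<or> R \<subset> P" using F(2) S that(3) unfolding laminar_def by blast
        then show ?thesis using sel[of P] sel[of R] PR S by blast
      qed
      show "0 \<le> a P" if "P \<in> T" for P using that a0[of P] S by (auto simp: T_def)
    qed (use finS r \<phi> in \<open>simp_all add: T_def\<close>)
    then have "v x * (\<phi> x * (\<Sum>P\<in>S. a P powr (r - 1) * indicator P x))
      \<le> v x * ((\<Sum>P\<in>S. a P powr r * indicator P x) / 2 + carleson_const r * \<phi> x powr r)"
      unfolding sum_T using v by (intro mult_left_mono) auto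
    then show "(\<Sum>P\<in>S. a P powr (r - 1) * (indicator P x * (\<phi> x * v x)))
      \<le> (\<Sum>P\<in>S. a P powr r * (indicator P x * v x)) / 2 + carleson_const r * (\<phi> x powr r * v x)"
      by (simp add: sum_distrib_left algebra_simps)
  qed
  also have "\<dots> = (\<Sum>P\<in>S. a P powr r * V P) / 2 + carleson_const r * (LINT x|M. \<phi> x powr r * v x)"
    using i1 int(4) by (simp add: V_def set_lebesgue_integral_def)
  finally have "Z \<le> 2 * carleson_const r * (LINT x|M. \<phi> x powr r * v x)"
    unfolding Z_def[symmetric] by simp
  then have "\<kappa> * 2 powr r * Z \<le> \<kappa> * 2 powr r * (2 * carleson_const r * (LINT x|M. \<phi> x powr r * v x))"
    using \<kappa> by (intro mult_left_mono) auto
  with 1 show ?thesis by (simp add: Z_def V_def a_def algebra_simps)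
qed

section \<open>Half-mass property and sparse families\<close>

text \<open>
  Young's inequality without its sharp constants: compare \<open>t\<close> with \<open>s^(p - 1)\<close>.
\<close>
lemma mult_le_powr_add_powr:
  fixes s t p :: real
  assumes "0 \<le> s" "0 \<le> t" "1 < p"
  shows "s * t \<le> s powr p + t powr (p / (p - 1))"
proof (cases "t \<le> s powr (p - 1)")
  case True
  then have "s * t \<le> s * s powr (p - 1)" using assms by (intro mult_left_mono)
  also have "\<dots> = s powr p" using powr_mult_base[OF assms(1), of "p - 1"] by simp
  finally show ?thesis using powr_ge_zero[of t "p / (p - 1)"] by linarith
next
  case False
  then have "(s powr (p - 1)) powr (1 / (p - 1)) \<le> t powr (1 / (p - 1))"
    using assms by (intro powr_mono2) auto
  then have "s \<le> t powr (1 / (p - 1))" using assms by (simp add: powr_powr)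
  then have "s * t \<le> t * t powr (1 / (p - 1))" using mult_right_mono[OF _ assms(2)] by (metis mult.commute)
  also have "\<dots> = t powr (p / (p - 1))"
    using powr_mult_base[OF assms(2), of "1 / (p - 1)"] assms(3) by (simp add: field_simps)
  finally show ?thesis using powr_ge_zero[of s p] by linarith
qed

lemma set_integral_pos:
  fixes v :: "'a \<Rightarrow> real"
  assumes "Q \<in> sets M" "emeasure M Q \<noteq> 0" "set_integrable M Q v" "\<And>x. 0 < v x"
  shows "0 < (LINT x:Q|M. v x)"
proof -
  have nn: "0 \<le> indicator Q x * v x" for x using assms(4)[of x] by (simp add: indicator_def)
  have "(LINT x|M. indicator Q x * v x) \<noteq> 0"
  proof
    assume "(LINT x|M. indicator Q x * v x) = 0"
    then have "AE x in M. indicator Q x * v x = 0"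
      using assms(3) nn by (subst (asm) integral_nonneg_eq_0_iff_AE) (auto simp: set_integrable_def)
    then have "AE x in M. x \<notin> Q"
    proof (rule eventually_mono)
      fix x assume "indicator Q x * v x = 0"
      then show "x \<notin> Q" using assms(4)[of x] by (auto simp: indicator_def)
    qed
    then have "emeasure M Q = 0" using assms(1) by (subst (asm) AE_iff_measurable[of Q]) (auto dest: sets.sets_into_space)
    with assms(2) show False by simp
  qed
  moreover have "0 \<le> (LINT x|M. indicator Q x * v x)" using nn by (rule Bochner_Integration.integral_nonneg)
  ultimately show ?thesis by (simp add: set_lebesgue_integral_def)
qed

text \<open>
  By the Chebyshev inequality \<open>v'\<close> exceeds four times its average on at most a quarter of \<open>Q\<close>. On what is
  left of \<open>E\<close>, still a quarter of \<open>Q\<close>, the relation \<open>v^s v'^t = 1\<close> turns the upper bound for \<open>v'\<close> into a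
  lower bound for \<open>v\<close>, which the Muckenhoupt condition compares with the average of \<open>v\<close>.
\<close>
lemma half_mass:
  fixes v v' :: "'a \<Rightarrow> real"
  assumes Q: "Q \<in> fmeasurable M" and E: "E \<subseteq> Q" "E \<in> sets M" "measure M Q \<le> 2 * measure M E" and m: "0 < measure M Q"
    and pos: "\<And>x. 0 < v x" "\<And>x. 0 < v' x" and meas: "v' \<in> borel_measurable M"
    and int: "set_integrable M Q v" "set_integrable M Q v'"
    and st: "0 < s" "0 < t" "\<And>x. v x powr s * v' x powr t = 1"
    and A: "(LINT x:Q|M. v x) powr s * (LINT x:Q|M. v' x) powr t \<le> A * measure M Q powr (s + t)" "0 \<le> A"
  shows "(LINT x:Q|M. v x) \<le> 4 * (A * 4 powr t) powr (1 / s) * (LINT x:E|M. v x)"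
proof -
  define \<mu> where "\<mu> = measure M Q"
  define V1 where "V1 = (LINT x:Q|M. v x)"
  define V2 where "V2 = (LINT x:Q|M. v' x)"
  have Qs: "Q \<in> sets M" and Qnz: "emeasure M Q \<noteq> 0" using Q m by (auto simp: measure_def)
  have V: "0 < V1" "0 < V2" using set_integral_pos[OF Qs Qnz] int pos by (auto simp: V1_def V2_def)
  have \<mu>: "0 < \<mu>" using m by (simp add: \<mu>_def)
  \<comment> \<open>four times the average of \<open>v'\<close>\<close>
  define d where "d = 4 * V2 / \<mu>"
  have d: "0 < d" using V \<mu> by (simp add: d_def)
  define B where "B = {x \<in> space M. d < v' x} \<inter> Q"
  have Bs: "B \<in> sets M" using meas Qs unfolding B_def by measurable
  have BQ: "B \<subseteq> Q" by (auto simp: B_def)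
  have Bf: "B \<in> fmeasurable M" using Q BQ Bs by (rule fmeasurableI2)
  have intB: "set_integrable M B v'" using int(2) Bs BQ by (rule set_integrable_subset)
  have "d * measure M B = (LINT x:B|M. d)"
    using Bf by (simp add: set_lebesgue_integral_def fmeasurable_def)
  also have "\<dots> \<le> (LINT x:B|M. v' x)"
  proof (rule set_integral_mono)
    show "set_integrable M B (\<lambda>_. d)" using Bf by (auto simp: set_integrable_def fmeasurable_def)
  qed (use intB in \<open>auto simp: B_def\<close>)
  also have "\<dots> \<le> V2"
    unfolding V2_def set_lebesgue_integral_def
    using intB int(2) BQ pos(2) less_imp_le by (intro integral_mono) (auto simp: set_integrable_def indicator_def)
  finally have "measure M B \<le> V2 / d" using d by (simp add: pos_le_divide_eq mult.commute)
  also have "\<dots> = \<mu> / 4" using V \<mu> by (simp add: d_def)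
  finally have mB: "measure M B \<le> \<mu> / 4" .
  define E' where "E' = E - B"
  have E's: "E' \<in> sets M" "E' \<subseteq> Q" "E' \<subseteq> E" using E Bs by (auto simp: E'_def)
  have Ef: "E \<in> fmeasurable M" "E' \<in> fmeasurable M" using Q E E's by (auto intro: fmeasurableI2)
  have "measure M E \<le> measure M (E' \<union> B)"
    using E E's Ef Bf by (intro measure_mono_fmeasurable fmeasurable.Un) (auto simp: E'_def)
  also have "\<dots> \<le> measure M E' + measure M B" using E's Bs by (intro measure_Un_le)
  finally have mE': "\<mu> / 4 \<le> measure M E'" using mB E(3) by (simp add: \<mu>_def)
  define c where "c = d powr (- (t / s))"
  have v1c: "c \<le> v x" if "x \<in> E'" for x
  proof -
    have "v' x \<le> d"
      using that E's(2) sets.sets_into_space[OF Qs] by (fastforce simp: E'_def B_def)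
    then have le: "d powr (- t) \<le> v' x powr (- t)" using pos(2)[of x] st(2) d by (simp add: powr_mono2')
    have "v x powr s = v' x powr (- t)" using st(3)[of x] pos(2)[of x]
      by (simp add: powr_minus field_simps)
    then have "(d powr (- t)) powr (1 / s) \<le> (v x powr s) powr (1 / s)"
      using le st(1) by (intro powr_mono2) auto
    then show ?thesis using st(1) pos(1)[of x] by (simp add: powr_powr c_def)
  qed
  have intE: "set_integrable M E v" "set_integrable M E' v"
    using set_integrable_subset[OF int(1)] E E's by auto
  have "c * (\<mu> / 4) \<le> c * measure M E'" using mE' by (intro mult_left_mono) (auto simp: c_def)
  also have "\<dots> = (LINT x:E'|M. c)"
    using Ef by (simp add: set_lebesgue_integral_def fmeasurable_def)
  also have "\<dots> \<le> (LINT x:E'|M. v x)"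
  proof (rule set_integral_mono)
    show "set_integrable M E' (\<lambda>_. c)" using Ef by (auto simp: set_integrable_def fmeasurable_def)
  qed (use intE v1c in auto)
  also have "\<dots> \<le> (LINT x:E|M. v x)"
    unfolding set_lebesgue_integral_def
    using intE E's(3) pos(1) less_imp_le by (intro integral_mono) (auto simp: set_integrable_def indicator_def)
  finally have low: "c * \<mu> / 4 \<le> (LINT x:E|M. v x)" by simp
  have "V1 powr s \<le> A * \<mu> powr (s + t) / V2 powr t"
    using A(1) V by (simp add: V1_def V2_def \<mu>_def pos_le_divide_eq)
  then have "(V1 powr s) powr (1 / s) \<le> (A * \<mu> powr (s + t) / V2 powr t) powr (1 / s)"
    using st(1) by (intro powr_mono2) auto
  then have "V1 \<le> (A * \<mu> powr (s + t) / V2 powr t) powr (1 / s)"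
    using st(1) V by (simp add: powr_powr)
  also have "A * \<mu> powr (s + t) / V2 powr t = (A * 4 powr t) * (\<mu> powr s * d powr (- t))"
    using \<mu> V unfolding d_def by (simp add: powr_add powr_divide powr_mult powr_minus field_simps)
  also have "\<dots> powr (1 / s) = (A * 4 powr t) powr (1 / s) * (\<mu> * c)"
    using A(2) \<mu> d st(1) by (simp add: powr_mult powr_powr c_def)
  also have "\<dots> \<le> (A * 4 powr t) powr (1 / s) * (4 * (LINT x:E|M. v x))"
    using low by (intro mult_left_mono) (auto simp: mult.commute)
  finally show ?thesis by (simp add: V1_def algebra_simps)
qed

text \<open>
  Strictly below a principal set the principal averages have at least doubled, so by the weak type inequality
  these sets cover at most half of it.
\<close>
lemma principal_sparse:
  fixes f :: "'a \<Rightarrow> real"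
  assumes F: "finite S" "laminar S" "\<And>R. R \<in> S \<Longrightarrow> R \<in> fmeasurable M \<and> 0 < measure M R"
    and f: "\<And>R. R \<in> S \<Longrightarrow> set_integrable M R f" "\<And>x. 0 \<le> f x"
    and sel: "\<And>P R. P \<in> S \<Longrightarrow> R \<in> S \<Longrightarrow> R \<subset> P \<Longrightarrow>
      2 * ((LINT x:P|M. f x) / measure M P) < (LINT x:R|M. f x) / measure M R"
    and P: "P \<in> S"
  shows "measure M P \<le> 2 * measure M (P - \<Union>{R \<in> S. R \<subset> P})"
proof -
  define G where "G = {R \<in> S. R \<subset> P}"
  define l where "l = 2 * ((LINT x:P|M. f x) / measure M P)"
  have Pf: "P \<in> fmeasurable M" "0 < measure M P" using F(3)[OF P] by auto
  have fin: "finite G" using F(1) by (simp add: G_def)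
  have GS: "G \<subseteq> S" by (auto simp: G_def)
  have nn: "0 \<le> (LINT x:R|M. f x)" for R
    unfolding set_lebesgue_integral_def using f(2) by (intro Bochner_Integration.integral_nonneg) simp
  have Uf: "\<Union>G \<in> fmeasurable M"
    using fin GS F(3) by (intro fmeasurable.finite_Union) auto
  have avg: "l * measure M R \<le> (LINT x:R|M. f x)" if "R \<in> G" for R
  proof -
    have "l < (LINT x:R|M. f x) / measure M R" "0 < measure M R"
      using sel[OF P, of R] that F(3)[of R] by (auto simp: G_def l_def)
    then show ?thesis by (simp add: pos_less_divide_eq less_imp_le)
  qed
  have "measure M (\<Union>G) \<le> measure M P / 2"
  proof (cases "(LINT x:P|M. f x) = 0")
    case True
    have "R \<notin> G" for R
    proof
      assume R: "R \<in> G"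
      have "(LINT x:R|M. f x) \<le> (LINT x:P|M. f x)"
        using sum_set_integral_disjoint_le[of "{R}" "\<lambda>R. R" P M f] R F(3)[of R] f Pf P
        by (auto simp: G_def disjoint_family_on_def)
      then have "(LINT x:R|M. f x) / measure M R \<le> 0" using True by (simp add: divide_nonpos_nonneg)
      moreover have "0 < (LINT x:R|M. f x) / measure M R" using sel[OF P, of R] R True by (simp add: G_def)
      ultimately show False by simp
    qed
    then have "G = {}" by blast
    then show ?thesis by simp
  next
    case False
    then have l: "0 < l" using nn[of P] Pf by (simp add: l_def)
    have "l * measure M (\<Union>G) \<le> (LINT x:P|M. f x)"
    proof (rule laminar_weak_type[OF fin])
      show "laminar G" using laminar_subset[OF F(2) GS] .
      show "R \<subseteq> P \<and> R \<in> fmeasurable M" if "R \<in> G" for R using that F(3)[of R] by (auto simp: G_def)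
    qed (use f P Pf avg l in auto)
    also have "\<dots> = l * (measure M P / 2)" using Pf by (simp add: l_def)
    finally show ?thesis using l by simp
  qed
  moreover have "measure M (P - \<Union>G) = measure M P - measure M (\<Union>G)"
    using Pf Uf by (intro measure_Diff) (auto simp: G_def fmeasurable_def)
  ultimately show ?thesis by (simp add: G_def)
qed

text \<open>
  As \<open>q'\<close> is at most \<open>p / (p - 1)\<close>, a bound for the \<open>q'\<close>-th powers also controls the dual powers of \<open>p\<close>.
  Normalising \<open>t\<close> by \<open>X^(1 / q')\<close> makes the estimate homogeneous, so that the inequality
  \<open>mult_le_powr_add_powr\<close> can take the place of the Hoelder inequality.
\<close>
lemma sum_bilinear_off_diagonal:
  fixes s t :: "'i \<Rightarrow> real"
  assumes "finite S" "\<And>i. i \<in> S \<Longrightarrow> 0 \<le> s i" "\<And>i. i \<in> S \<Longrightarrow> 0 \<le> t i"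
    and pq: "1 < p" "0 < q'" "q' \<le> p / (p - 1)"
    and K: "(\<Sum>i\<in>S. s i powr p) \<le> K1" "(\<Sum>i\<in>S. t i powr q') \<le> K2 * X" and "0 < X" "0 \<le> K2"
  shows "(\<Sum>i\<in>S. s i * t i) \<le> (K1 + K2 * (K2 + 1) powr ((p / (p - 1) - q') / q')) * X powr (1 / q')"
proof -
  define \<tau> where "\<tau> i = t i / X powr (1 / q')" for i
  have Xp: "0 < X powr (1 / q')" using assms by simp
  have \<tau>0: "0 \<le> \<tau> i" if "i \<in> S" for i using assms(3)[OF that] by (simp add: \<tau>_def)
  have \<tau>q: "\<tau> i powr q' = t i powr q' / X" if "i \<in> S" for i
    using assms(3)[OF that] assms by (simp add: \<tau>_def powr_divide powr_powr)
  have "(\<Sum>i\<in>S. \<tau> i powr q') = (\<Sum>i\<in>S. t i powr q') / X"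
    using \<tau>q by (simp add: sum_divide_distrib)
  also have "\<dots> \<le> K2" using K(2) \<open>0 < X\<close> by (simp add: pos_divide_le_eq)
  finally have K2: "(\<Sum>i\<in>S. \<tau> i powr q') \<le> K2" .
  have \<tau>p: "\<tau> i powr (p / (p - 1)) \<le> \<tau> i powr q' * (K2 + 1) powr ((p / (p - 1) - q') / q')" if i: "i \<in> S" for i
  proof -
    have "\<tau> i powr q' \<le> (\<Sum>i\<in>S. \<tau> i powr q')" using assms(1) i by (intro member_le_sum) auto
    then have "\<tau> i powr q' \<le> K2 + 1" using K2 by linarith
    then have "(\<tau> i powr q') powr ((p / (p - 1) - q') / q') \<le> (K2 + 1) powr ((p / (p - 1) - q') / q')"
      using pq by (intro powr_mono2) auto
    then have "\<tau> i powr (p / (p - 1) - q') \<le> (K2 + 1) powr ((p / (p - 1) - q') / q')"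
      using pq by (simp add: powr_powr)
    then have "\<tau> i powr q' * \<tau> i powr (p / (p - 1) - q') \<le> \<tau> i powr q' * (K2 + 1) powr ((p / (p - 1) - q') / q')"
      by (intro mult_left_mono) auto
    then show ?thesis by (simp add: powr_add[symmetric])
  qed
  have "(\<Sum>i\<in>S. s i * \<tau> i) \<le> (\<Sum>i\<in>S. s i powr p + \<tau> i powr q' * (K2 + 1) powr ((p / (p - 1) - q') / q'))"
  proof (rule sum_mono)
    fix i assume i: "i \<in> S"
    show "s i * \<tau> i \<le> s i powr p + \<tau> i powr q' * (K2 + 1) powr ((p / (p - 1) - q') / q')"
      using mult_le_powr_add_powr[OF assms(2)[OF i] \<tau>0[OF i] pq(1)] \<tau>p[OF i] by linarith
  qed
  also have "\<dots> = (\<Sum>i\<in>S. s i powr p) + (\<Sum>i\<in>S. \<tau> i powr q') * (K2 + 1) powr ((p / (p - 1) - q') / q')"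
    by (simp add: sum.distrib sum_distrib_right)
  also have "\<dots> \<le> K1 + K2 * (K2 + 1) powr ((p / (p - 1) - q') / q')"
    using K(1) K2 by (intro add_mono mult_right_mono) auto
  finally have "(\<Sum>i\<in>S. s i * \<tau> i) * X powr (1 / q') \<le> (K1 + K2 * (K2 + 1) powr ((p / (p - 1) - q') / q')) * X powr (1 / q')"
    by (intro mult_right_mono) auto
  moreover have "(\<Sum>i\<in>S. s i * \<tau> i) * X powr (1 / q') = (\<Sum>i\<in>S. s i * t i)"
    using Xp by (simp add: \<tau>_def sum_distrib_right)
  ultimately show ?thesis by simp
qed

text \<open>
  Cells of one level are disjoint, and each further level contributes a factor \<open>2^(-\<alpha>)\<close>. This is where \<open>\<alpha> > 0\<close>
  enters: the sum over all cells below a principal cell collapses to that cell.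
\<close>
lemma sum_subcells_powr_le:
  fixes u :: "real ^ 'n" and g :: "real ^ 'n \<Rightarrow> real"
  assumes H: "finite H" "H \<subseteq> grid u" "\<And>Q. Q \<in> H \<Longrightarrow> Q \<subseteq> P" and P: "P \<in> grid u"
    and g: "set_integrable lborel P g" "\<And>x. 0 \<le> g x" and \<alpha>: "0 < \<alpha>"
  shows "(\<Sum>Q\<in>H. measure lborel Q powr (\<alpha> / CARD('n)) * (LINT x:Q|lborel. g x))
    \<le> 1 / (1 - 2 powr (- \<alpha>)) * (measure lborel P powr (\<alpha> / CARD('n)) * (LINT x:P|lborel. g x))"
proof -
  obtain k y where Pc: "P = cell u k y" using P by (auto simp: grid_def)
  have sd: "measure lborel (cell u j z) powr (\<alpha> / CARD('n)) = 2 powr (- \<alpha> * j)" for j z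
  proof -
    have "measure lborel (cell u j z) = (2 powr (- real_of_int j)) powr CARD('n)"
      unfolding measure_cell using powr_real_of_int'[of 2 "- j"] by (simp add: powr_realpow)
    then show ?thesis by (simp add: powr_powr algebra_simps)
  qed
  define lev where "lev Q = (SOME j. \<exists>z. Q = cell u j z)" for Q
  have lev: "\<exists>z. Q = cell u (lev Q) z" if "Q \<in> H" for Q
  proof -
    have "\<exists>j z. Q = cell u j z" using that H(2) by (auto simp: grid_def)
    then show ?thesis unfolding lev_def by (rule someI_ex)
  qed
  have lev_ge: "k \<le> lev Q" if "Q \<in> H" for Q
  proof -
    from lev[OF that] obtain z where "Q = cell u (lev Q) z" ..
    with H(3)[OF that] Pc show ?thesis using cell_level_le by metis
  qed
  define I where "I = (LINT x:P|lborel. g x)"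
  have I0: "0 \<le> I" unfolding I_def set_lebesgue_integral_def
    using g(2) by (intro Bochner_Integration.integral_nonneg) simp
  have level_sum: "(\<Sum>Q | Q \<in> H \<and> lev Q = j. LINT x:Q|lborel. g x) \<le> I" for j
    unfolding I_def
  proof (rule sum_set_integral_disjoint_le)
    show "disjoint_family_on (\<lambda>Q. Q) {Q \<in> H. lev Q = j}"
      unfolding disjoint_family_on_def
    proof (intro ballI impI)
      fix Q R assume QR: "Q \<in> {Q \<in> H. lev Q = j}" "R \<in> {Q \<in> H. lev Q = j}" "Q \<noteq> R"
      then obtain z z' where eq: "Q = cell u j z" "R = cell u j z'" using lev by force
      show "Q \<inter> R = {}"
      proof (rule ccontr)
        assume "Q \<inter> R \<noteq> {}"
        then obtain x where "x \<in> cell u j z" "x \<in> cell u j z'" using eq by auto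
        then have "Q = R" using eq cell_eqI by metis
        with QR show False by simp
      qed
    qed
    show "Q \<in> sets lborel" if "Q \<in> {Q \<in> H. lev Q = j}" for Q using that lev[of Q] by auto
  qed (use H g Pc in auto)
  define r where "r = (2::real) powr (- \<alpha>)"
  have r: "0 < r" "r < 1" using \<alpha> by (auto simp: r_def intro: powr_less_one)
  have "(\<Sum>Q\<in>H. measure lborel Q powr (\<alpha> / CARD('n)) * (LINT x:Q|lborel. g x))
    = (\<Sum>Q\<in>H. 2 powr (- \<alpha> * lev Q) * (LINT x:Q|lborel. g x))"
    using lev sd by (intro sum.cong refl) metis
  also have "\<dots> = (\<Sum>j\<in>lev ` H. \<Sum>Q | Q \<in> H \<and> lev Q = j. 2 powr (- \<alpha> * lev Q) * (LINT x:Q|lborel. g x))"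
    using H(1) by (intro sum.group[symmetric]) auto
  also have "\<dots> = (\<Sum>j\<in>lev ` H. 2 powr (- \<alpha> * j) * (\<Sum>Q | Q \<in> H \<and> lev Q = j. LINT x:Q|lborel. g x))"
    by (simp add: sum_distrib_left)
  also have "\<dots> \<le> (\<Sum>j\<in>lev ` H. 2 powr (- \<alpha> * j) * I)"
    using level_sum by (intro sum_mono mult_left_mono) auto
  also have "\<dots> = (\<Sum>j\<in>lev ` H. 2 powr (- \<alpha> * j)) * I" by (simp add: sum_distrib_right)
  also have "(\<Sum>j\<in>lev ` H. 2 powr (- \<alpha> * j)) = (\<Sum>j\<in>lev ` H. 2 powr (- \<alpha> * k) * r ^ nat (j - k))"
  proof (rule sum.cong[OF refl])
    fix j assume "j \<in> lev ` H"
    then have "k \<le> j" using lev_ge by auto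
    then have "r ^ nat (j - k) = 2 powr (- \<alpha> * (j - k))"
      by (simp add: r_def powr_realpow[symmetric] powr_powr)
    then show "2 powr (- \<alpha> * j) = 2 powr (- \<alpha> * k) * r ^ nat (j - k)"
      by (simp add: powr_add[symmetric] algebra_simps)
  qed
  also have "\<dots> = 2 powr (- \<alpha> * k) * (\<Sum>j\<in>lev ` H. r ^ nat (j - k))" by (simp add: sum_distrib_left)
  also have "(\<Sum>j\<in>lev ` H. r ^ nat (j - k)) = (\<Sum>i\<in>(\<lambda>j. nat (j - k)) ` lev ` H. r ^ i)"
  proof (rule sum.reindex_cong[symmetric])
    show "inj_on (\<lambda>j. nat (j - k)) (lev ` H)"
    proof (rule inj_onI)
      fix i j assume "i \<in> lev ` H" "j \<in> lev ` H" and eq: "nat (i - k) = nat (j - k)"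
      then have "k \<le> i" "k \<le> j" using lev_ge by auto
      with eq show "i = j" by simp
    qed
  qed auto
  also have "\<dots> \<le> (\<Sum>i. r ^ i)"
    using H(1) r by (intro sum_le_suminf summable_geometric) auto
  also have "\<dots> = 1 / (1 - r)" using r by (intro suminf_geometric) auto
  finally have "(\<Sum>Q\<in>H. measure lborel Q powr (\<alpha> / CARD('n)) * (LINT x:Q|lborel. g x))
     \<le> 2 powr (- \<alpha> * k) * (1 / (1 - r)) * I" using I0 by (simp add: mult_left_mono mult_right_mono)
  then show ?thesis unfolding Pc sd by (simp add: I_def r_def Pc algebra_simps)
qed

section \<open>The dyadic fractional integral\<close>

text \<open>
  The \<open>A_(p,q)\<close> condition for positive Borel weights on the cells of all shifted grids, with explicit constant \<open>A\<close>. The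
  averages are multiplied out to integrals; \<open>(p - 1) / p\<close> is \<open>1 / p'\<close>.
\<close>
definition Apq_cells :: "real \<Rightarrow> real \<Rightarrow> real \<Rightarrow> (real ^ 'n \<Rightarrow> real) \<Rightarrow> bool" where
  "Apq_cells p q A w \<longleftrightarrow> w \<in> borel_measurable borel \<and> (\<forall>x. 0 < w x) \<and>
     (\<forall>u. \<forall>Q\<in>grid u. set_integrable lborel Q (\<lambda>x. w x powr q) \<and>
        set_integrable lborel Q (\<lambda>x. w x powr (- (p / (p - 1)))) \<and>
        (LINT x:Q|lborel. w x powr q) powr (1 / q) *
          (LINT x:Q|lborel. w x powr (- (p / (p - 1)))) powr ((p - 1) / p)
          \<le> A * measure lborel Q powr (1 / q + (p - 1) / p))"

definition dyadic_coeff :: "real \<Rightarrow> (real ^ 'n) set \<Rightarrow> real" where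
  "dyadic_coeff \<alpha> Q = measure lborel Q powr (\<alpha> / CARD('n) - 1)"

text \<open>
  The dyadic fractional integral over the family \<open>F\<close>.
\<close>
definition dyadic_op :: "real \<Rightarrow> (real ^ 'n) set set \<Rightarrow> (real ^ 'n \<Rightarrow> real) \<Rightarrow> real ^ 'n \<Rightarrow> real" where
  "dyadic_op \<alpha> F f x = (\<Sum>Q\<in>F. dyadic_coeff \<alpha> Q * (LINT y:Q|lborel. f y) * indicator Q x)"

lemma grid_fmeasurable:
  assumes "Q \<in> grid u" shows "Q \<in> sets borel" "Q \<in> fmeasurable lborel" "0 < measure lborel Q" "emeasure lborel Q \<noteq> 0"
proof -
  obtain k y where Q: "Q = cell u k y" using assms by (auto simp: grid_def)
  show "Q \<in> sets borel" by (simp add: Q)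
  show "Q \<in> fmeasurable lborel" by (simp add: Q fmeasurable_def emeasure_cell)
  show "0 < measure lborel Q" by (simp add: Q measure_cell_pos)
  then show "emeasure lborel Q \<noteq> 0" by (auto simp: measure_def)
qed

lemma Apq_cellsD:
  assumes "Apq_cells p q A w"
  shows "w \<in> borel_measurable borel" "\<And>x. 0 < w x"
    and "\<And>Q. Q \<in> grid u \<Longrightarrow> set_integrable lborel Q (\<lambda>x. w x powr q)"
    and "\<And>Q. Q \<in> grid u \<Longrightarrow> set_integrable lborel Q (\<lambda>x. w x powr (- (p / (p - 1))))"
    and "\<And>Q. Q \<in> grid u \<Longrightarrow> (LINT x:Q|lborel. w x powr q) powr (1 / q) *
      (LINT x:Q|lborel. w x powr (- (p / (p - 1)))) powr ((p - 1) / p)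
      \<le> A * measure lborel Q powr (1 / q + (p - 1) / p)"
  using assms unfolding Apq_cells_def by blast+

text \<open>
  The two halves are \<open>half_mass\<close> with the roles of \<open>w^q\<close> and \<open>w^(-p')\<close> exchanged.
\<close>
lemma Apq_cells_half_mass:
  fixes w :: "real ^ 'n \<Rightarrow> real"
  assumes w: "Apq_cells p q A w" and pq: "1 < p" "1 < q" "0 \<le> A" and Q: "Q \<in> grid u"
    and E: "E \<subseteq> Q" "E \<in> sets borel" "measure lborel Q \<le> 2 * measure lborel E"
  shows "(LINT x:Q|lborel. w x powr q) \<le> 4 * (A * 4 powr ((p - 1) / p)) powr q * (LINT x:E|lborel. w x powr q)"
    and "(LINT x:Q|lborel. w x powr (- (p / (p - 1)))) \<le>
      4 * (A * 4 powr (1 / q)) powr (p / (p - 1)) * (LINT x:E|lborel. w x powr (- (p / (p - 1))))"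
proof -
  note meas = Apq_cellsD(1)[OF w] and pos = Apq_cellsD(2)[OF w]
  have nz: "w x \<noteq> 0" for x using pos[of x] by simp
  note int = Apq_cellsD(3)[OF w Q] Apq_cellsD(4)[OF w Q] and A = Apq_cellsD(5)[OF w Q]
  have one: "(w x powr q) powr (1 / q) * (w x powr (- (p / (p - 1)))) powr ((p - 1) / p) = 1" for x
  proof -
    have "q * (1 / q) + (- (p / (p - 1))) * ((p - 1) / p) = 0" using pq by simp
    then show ?thesis unfolding powr_powr powr_add[symmetric] using pos[of x] by simp
  qed
  have "(LINT x:Q|lborel. w x powr q) \<le> 4 * (A * 4 powr ((p - 1) / p)) powr (1 / (1 / q)) * (LINT x:E|lborel. w x powr q)"
  proof (rule half_mass[where v' = "\<lambda>x. w x powr (- (p / (p - 1)))"])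
    show "(w x powr q) powr (1 / q) * (w x powr (- (p / (p - 1)))) powr ((p - 1) / p) = 1" for x by (rule one)
  qed (use grid_fmeasurable[OF Q] E int A pos nz meas pq in \<open>simp_all\<close>)
  then show "(LINT x:Q|lborel. w x powr q) \<le> 4 * (A * 4 powr ((p - 1) / p)) powr q * (LINT x:E|lborel. w x powr q)"
    by simp
  have "(LINT x:Q|lborel. w x powr (- (p / (p - 1)))) \<le>
      4 * (A * 4 powr (1 / q)) powr (1 / ((p - 1) / p)) * (LINT x:E|lborel. w x powr (- (p / (p - 1))))"
  proof (rule half_mass[where v' = "\<lambda>x. w x powr q"])
    show "(w x powr (- (p / (p - 1)))) powr ((p - 1) / p) * (w x powr q) powr (1 / q) = 1" for x
      using one[of x] by (simp only: mult.commute)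
    show "(LINT x:Q|lborel. w x powr (- (p / (p - 1)))) powr ((p - 1) / p) * (LINT x:Q|lborel. w x powr q) powr (1 / q)
      \<le> A * measure lborel Q powr ((p - 1) / p + 1 / q)"
      using A by (simp only: mult.commute add.commute)
  qed (use grid_fmeasurable[OF Q] E int pos nz meas pq in \<open>simp_all\<close>)
  then show "(LINT x:Q|lborel. w x powr (- (p / (p - 1)))) \<le>
      4 * (A * 4 powr (1 / q)) powr (p / (p - 1)) * (LINT x:E|lborel. w x powr (- (p / (p - 1))))"
    by simp
qed

text \<open>
  A quantitative form of the \<open>A_\<infinity>\<close> condition: sets filling at least half of a cell carry at least the
  proportion \<open>1 / \<kappa>\<close> of its mass.
\<close>
definition A_infinity_cells :: "real \<Rightarrow> (real ^ 'n \<Rightarrow> real) \<Rightarrow> bool" where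
  "A_infinity_cells \<kappa> v \<longleftrightarrow> v \<in> borel_measurable borel \<and> (\<forall>x. 0 < v x) \<and>
     (\<forall>u. \<forall>Q\<in>grid u. set_integrable lborel Q v \<and>
        (\<forall>E. E \<subseteq> Q \<longrightarrow> E \<in> sets borel \<longrightarrow> measure lborel Q \<le> 2 * measure lborel E \<longrightarrow>
           (LINT x:Q|lborel. v x) \<le> \<kappa> * (LINT x:E|lborel. v x)))"

lemma A_infinity_cellsD:
  assumes "A_infinity_cells \<kappa> v"
  shows "v \<in> borel_measurable borel" "\<And>x. 0 < v x" "\<And>Q. Q \<in> grid u \<Longrightarrow> set_integrable lborel Q v"
    and "\<And>Q E. Q \<in> grid u \<Longrightarrow> E \<subseteq> Q \<Longrightarrow> E \<in> sets borel \<Longrightarrow> measure lborel Q \<le> 2 * measure lborel E \<Longrightarrow>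
      (LINT x:Q|lborel. v x) \<le> \<kappa> * (LINT x:E|lborel. v x)"
  using assms unfolding A_infinity_cells_def by blast+

lemma Apq_cells_A_infinity:
  assumes w: "Apq_cells p q A w" and pq: "1 < p" "1 < q" "0 \<le> A"
  shows "A_infinity_cells (4 * (A * 4 powr ((p - 1) / p)) powr q) (\<lambda>x. w x powr q)"
    and "A_infinity_cells (4 * (A * 4 powr (1 / q)) powr (p / (p - 1))) (\<lambda>x. w x powr (- (p / (p - 1))))"
proof -
  note [measurable] = Apq_cellsD(1)[OF w]
  have pos: "0 < w x powr s" for x s using Apq_cellsD(2)[OF w, of x] by simp
  show "A_infinity_cells (4 * (A * 4 powr ((p - 1) / p)) powr q) (\<lambda>x. w x powr q)"
    unfolding A_infinity_cells_def
  proof (intro conjI allI ballI impI)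
    show "(\<lambda>x. w x powr q) \<in> borel_measurable borel" by measurable
  qed (rule pos, erule Apq_cellsD(3)[OF w], rule Apq_cells_half_mass(1)[OF w pq], assumption+)
  show "A_infinity_cells (4 * (A * 4 powr (1 / q)) powr (p / (p - 1))) (\<lambda>x. w x powr (- (p / (p - 1))))"
    unfolding A_infinity_cells_def
  proof (intro conjI allI ballI impI)
    show "(\<lambda>x. w x powr (- (p / (p - 1)))) \<in> borel_measurable borel" by measurable
  qed (rule pos, erule Apq_cellsD(4)[OF w], rule Apq_cells_half_mass(2)[OF w pq], assumption+)
qed

lemma Apq_cells_integrable_on:
  fixes w f :: "real ^ 'n \<Rightarrow> real"
  assumes w: "Apq_cells p q A w" and p: "1 < p" and Q: "Q \<in> grid u"
    and f: "f \<in> borel_measurable borel" "\<And>x. 0 \<le> f x" "integrable lborel (\<lambda>x. f x powr p * w x powr p)"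
  shows "set_integrable lborel Q f"
  unfolding set_integrable_def
proof (rule Bochner_Integration.integrable_bound)
  note meas = Apq_cellsD(1)[OF w] and pos = Apq_cellsD(2)[OF w]
  show "integrable lborel (\<lambda>x. f x powr p * w x powr p + indicator Q x *\<^sub>R w x powr (- (p / (p - 1))))"
  proof (rule Bochner_Integration.integrable_add[OF f(3)])
    show "integrable lborel (\<lambda>x. indicator Q x *\<^sub>R w x powr (- (p / (p - 1))))"
      using Apq_cellsD(4)[OF w Q] by (simp add: set_integrable_def)
  qed
  show "(\<lambda>x. indicator Q x *\<^sub>R f x) \<in> borel_measurable lborel" using f(1) grid_fmeasurable(1)[OF Q] by simp
  have le: "f x \<le> f x powr p * w x powr p + w x powr (- (p / (p - 1)))" for x
  proof -
    have "(f x * w x) * (1 / w x) \<le> (f x * w x) powr p + (1 / w x) powr (p / (p - 1))"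
      using pos[of x] f(2)[of x] p by (intro mult_le_powr_add_powr) auto
    then show ?thesis using pos[of x] f(2)[of x] by (simp add: powr_mult powr_divide powr_minus_divide)
  qed
  show "AE x in lborel. norm (indicator Q x *\<^sub>R f x)
    \<le> norm (f x powr p * w x powr p + indicator Q x *\<^sub>R w x powr (- (p / (p - 1))))"
    using le f(2) by (intro AE_I2) (auto simp: indicator_def)
qed

text \<open>
  Integrating \<open>T f\<close> against \<open>g = (T f)^(q - 1) w^q\<close> turns \<open>X\<close>, the \<open>q\<close>-th power of the norm, into a sum over
  \<open>Q\<close> in \<open>F\<close>. The sum is grouped by principal cubes for the averages of \<open>f\<close>, each group collapses to
  its principal cube, and the two Carleson embeddings give \<open>X\<close> at most a multiple of \<open>X^(1 / q')\<close>. The family is finite, so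
  \<open>T f\<close> is bounded, \<open>X\<close> is finite, and \<open>X^(1 / q')\<close> can be cancelled. The constant does not depend on the family, the grid or the weight.
\<close>
lemma dyadic_op_bound:
  fixes \<alpha> p q A :: real
  assumes \<alpha>: "0 < \<alpha>" and p: "1 < p" and q: "0 < q" "1 / p - 1 / q = \<alpha> / CARD('n)" and A: "0 \<le> A"
  shows "\<exists>C\<ge>0. \<forall>(w :: real ^ 'n \<Rightarrow> real) u F f. Apq_cells p q A w \<longrightarrow> finite F \<longrightarrow> F \<subseteq> grid u \<longrightarrow>
    f \<in> borel_measurable borel \<longrightarrow> (\<forall>x. 0 \<le> f x) \<longrightarrow> integrable lborel (\<lambda>x. f x powr p * w x powr p) \<longrightarrow>
    (LINT x|lborel. f x powr p * w x powr p) \<le> 1 \<longrightarrow>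
    integrable lborel (\<lambda>x. dyadic_op \<alpha> F f x powr q * w x powr q) \<and>
    (LINT x|lborel. dyadic_op \<alpha> F f x powr q * w x powr q) \<le> C"
proof -
  define n where "n = real CARD('n)"
  have n: "0 < n" by (simp add: n_def)
  define p' where "p' = p / (p - 1)"
  define q' where "q' = q / (q - 1)"
  have "0 < \<alpha> / CARD('n)" using \<alpha> by simp
  then have "1 / q < 1 / p" using q(2) by linarith
  then have pq: "p < q" using p q by (simp add: field_simps)
  have q1: "1 < q" using p pq by simp
  have p'1: "1 < p'" "1 < q'" using p q1 by (simp_all add: p'_def q'_def field_simps)
  have qp': "q' \<le> p'" using p q1 pq by (simp add: p'_def q'_def field_simps)
  \<comment> \<open>the constants of \<open>Apq_cells_half_mass\<close> for \<open>w^(-p')\<close> and \<open>w^q\<close>\<close>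
  define \<kappa>1 where "\<kappa>1 = 4 * (A * 4 powr (1 / q)) powr p'"
  define \<kappa>2 where "\<kappa>2 = 4 * (A * 4 powr ((p - 1) / p)) powr q"
  define K1 where "K1 = \<kappa>1 * 2 powr p * (2 * carleson_const p)"
  define K2 where "K2 = \<kappa>2 * 2 powr q' * (2 * carleson_const q')"
  have K: "0 \<le> K1" "0 \<le> K2" "0 \<le> \<kappa>1" "0 \<le> \<kappa>2" using carleson_const_nonneg[OF p] carleson_const_nonneg[OF p'1(2)]
    by (simp_all add: K1_def K2_def \<kappa>1_def \<kappa>2_def)
  define K3 where "K3 = K1 + K2 * (K2 + 1) powr ((p' - q') / q')"
  define C\<alpha> where "C\<alpha> = 1 / (1 - 2 powr (- \<alpha>))"
  have C\<alpha>: "0 < C\<alpha>" using \<alpha> powr_less_one[of 2 "- \<alpha>"] by (simp add: C\<alpha>_def)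
  define C where "C = (2 * C\<alpha> * A * K3) powr q"
  have "integrable lborel (\<lambda>x. dyadic_op \<alpha> F f x powr q * w x powr q) \<and>
    (LINT x|lborel. dyadic_op \<alpha> F f x powr q * w x powr q) \<le> C"
    if w: "Apq_cells p q A w" and F: "finite F" "F \<subseteq> grid u"
      and f: "f \<in> borel_measurable borel" "\<forall>x. 0 \<le> f x" "integrable lborel (\<lambda>x. f x powr p * w x powr p)"
       "(LINT x|lborel. f x powr p * w x powr p) \<le> 1" for w f :: "real ^ 'n \<Rightarrow> real" and u F
  proof -
    note meas = Apq_cellsD(1)[OF w] and pos = Apq_cellsD(2)[OF w]
    have fm [measurable]: "f \<in> borel_measurable lborel" and wm [measurable]: "w \<in> borel_measurable lborel"
      using f(1) meas by simp_all
    have f0: "0 \<le> f x" for x using f(2) by simp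
    have grd: "Q \<in> sets borel" "Q \<in> sets lborel" "Q \<in> fmeasurable lborel" "0 < measure lborel Q" "emeasure lborel Q \<noteq> 0"
      if "Q \<in> F" for Q using grid_fmeasurable[of Q u] F(2) that by auto
    define \<mu> where "\<mu> Q = measure lborel Q" for Q :: "(real ^ 'n) set"
    define U where "U x = w x powr q" for x
    define \<sigma> where "\<sigma> x = w x powr (- p')" for x
    define US where "US Q = (LINT x:Q|lborel. U x)" for Q
    define SS where "SS Q = (LINT x:Q|lborel. \<sigma> x)" for Q
    have Upos: "0 < U x" "0 < \<sigma> x" for x using pos[of x] by (simp_all add: U_def \<sigma>_def)
    have intU: "set_integrable lborel Q U" "set_integrable lborel Q \<sigma>" if "Q \<in> F" for Q
    proof -
      have "Q \<in> grid u" using that F(2) by auto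
      then show "set_integrable lborel Q U" "set_integrable lborel Q \<sigma>"
        using Apq_cellsD(3,4)[OF w] unfolding U_def \<sigma>_def p'_def by blast+
    qed
    have Spos: "0 < US Q" "0 < SS Q" if "Q \<in> F" for Q
      unfolding US_def SS_def using grd[OF that] intU[OF that] Upos by (auto intro!: set_integral_pos)
    have A_ineq: "US Q powr (1 / q) * SS Q powr ((p - 1) / p) \<le> A * \<mu> Q powr (1 / q + (p - 1) / p)" if "Q \<in> F" for Q
    proof -
      have "Q \<in> grid u" using that F(2) by auto
      then show ?thesis using Apq_cellsD(5)[OF w] unfolding U_def \<sigma>_def p'_def US_def SS_def \<mu>_def by blast
    qed
    define \<phi> where "\<phi> x = f x * w x powr p'" for x
    have \<phi>0: "0 \<le> \<phi> x" for x using f0 by (simp add: \<phi>_def)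
    have \<phi>\<sigma>: "\<phi> x * \<sigma> x = f x" for x using pos[of x] by (simp add: \<phi>_def \<sigma>_def powr_minus)
    have \<phi>p: "\<phi> x powr p * \<sigma> x = f x powr p * w x powr p" for x
    proof -
      have "p' * (p - 1) = p" using p by (simp add: p'_def)
      then have "p' * p + - p' = p" by (simp add: right_diff_distrib)
      then have "(w x powr p') powr p * \<sigma> x = w x powr p"
        unfolding \<sigma>_def powr_powr powr_add[symmetric] by simp
      then show ?thesis using f0[of x] by (simp add: \<phi>_def powr_mult)
    qed
    have intf: "set_integrable lborel Q f" if "Q \<in> F" for Q
      using Apq_cells_integrable_on[OF w p _ f(1) f0 f(3)] F(2) that by blast
    define I where "I Q = (LINT y:Q|lborel. f y)" for Q
    have I0: "0 \<le> I Q" for Q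
      unfolding I_def set_lebesgue_integral_def using f0 by (intro Bochner_Integration.integral_nonneg) simp
    define T where "T x = dyadic_op \<alpha> F f x" for x
    define c where "c Q = \<mu> Q powr (\<alpha> / n - 1)" for Q
    have T_eq: "T x = (\<Sum>Q\<in>F. c Q * I Q * indicator Q x)" for x
      by (simp add: T_def dyadic_op_def dyadic_coeff_def c_def \<mu>_def n_def I_def)
    define B where "B = (\<Sum>Q\<in>F. c Q * I Q)"
    have T0: "0 \<le> T x" for x unfolding T_eq using I0 by (intro sum_nonneg) (simp add: c_def)
    have TB: "T x \<le> B" for x
      unfolding T_eq B_def using I0 by (intro sum_mono) (auto simp: c_def indicator_def)
    have B0: "0 \<le> B" using T0 TB order_trans by blast
    have Tm [measurable]: "T \<in> borel_measurable lborel"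
      unfolding T_eq using grd by (intro borel_measurable_sum borel_measurable_times borel_measurable_const borel_measurable_indicator) auto
    have Um [measurable]: "U \<in> borel_measurable lborel" unfolding U_def by measurable
    have intTs: "set_integrable lborel Q (\<lambda>x. T x powr s * U x)" if "0 \<le> s" "Q \<in> F" for s Q
      unfolding set_integrable_def
    proof (rule Bochner_Integration.integrable_bound)
      show "integrable lborel (\<lambda>x. B powr s * (indicator Q x *\<^sub>R U x))"
        using intU(1)[OF that(2)] by (simp add: set_integrable_def)
      show "(\<lambda>x. indicator Q x *\<^sub>R (T x powr s * U x)) \<in> borel_measurable lborel"
        using grd(2)[OF that(2)] by measurable
      have "T x powr s * U x \<le> B powr s * U x" for x
        using TB T0 Upos[of x] that by (intro mult_right_mono powr_mono2) auto
      then show "AE x in lborel. norm (indicator Q x *\<^sub>R (T x powr s * U x)) \<le> norm (B powr s * (indicator Q x *\<^sub>R U x))"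
        using less_imp_le[OF Upos(1)] by (intro AE_I2) (auto simp: indicator_def)
    qed
    \<comment> \<open>the test function, chosen so that \<open>T g = T^q w^q\<close>\<close>
    define g where "g x = T x powr (q - 1) * U x" for x
    have g0: "0 \<le> g x" for x using Upos[of x] by (simp add: g_def)
    have intg: "set_integrable lborel Q g" if "Q \<in> F" for Q
      unfolding g_def using intTs that q1 by simp
    define G where "G Q = (LINT x:Q|lborel. g x)" for Q
    have G0: "0 \<le> G Q" for Q
      unfolding G_def set_lebesgue_integral_def using g0 by (intro Bochner_Integration.integral_nonneg) simp
    have TU: "T x powr q * U x = (\<Sum>Q\<in>F. c Q * I Q * (indicator Q x * g x))" for x
    proof -
      have "T x powr q = T x * T x powr (q - 1)" using powr_mult_base[OF T0, of x "q - 1"] by simp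
      then have "T x powr q * U x = T x * g x" by (simp add: g_def)
      then show ?thesis by (subst (asm) (2) T_eq) (simp add: sum_distrib_right mult.assoc)
    qed
    have int_g': "integrable lborel (\<lambda>x. indicator Q x * g x)" if "Q \<in> F" for Q
      using intg[OF that] by (simp add: set_integrable_def)
    have int_TU: "integrable lborel (\<lambda>x. T x powr q * U x)"
      unfolding TU using int_g' by (intro Bochner_Integration.integrable_sum integrable_mult_right) auto
    define X where "X = (LINT x|lborel. T x powr q * U x)"
    have X0: "0 \<le> X" unfolding X_def using less_imp_le[OF Upos(1)] by (intro Bochner_Integration.integral_nonneg) simp
    have X_sum: "X = (\<Sum>Q\<in>F. c Q * I Q * G Q)"
      unfolding X_def TU using int_g' by (simp add: G_def set_lebesgue_integral_def)
    define a where "a Q = I Q / \<mu> Q" for Q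
    have a0: "0 \<le> a Q" for Q using I0 by (simp add: a_def \<mu>_def)
    from principal_selection[OF F(1), of a]
    obtain S where S: "S \<subseteq> F" and S2: "\<forall>R\<in>F. R \<in> S \<longleftrightarrow> (\<forall>P\<in>S. R \<subset> P \<longrightarrow> 2 * a P < a R)"
      by (elim exE conjE)
    have sel: "R \<in> S \<longleftrightarrow> (\<forall>P\<in>S. R \<subset> P \<longrightarrow> 2 * a P < a R)" if "R \<in> F" for R
      using bspec[OF S2 that] .
    have finS: "finite S" using S F(1) finite_subset by auto
    have SF: "P \<in> F" if "P \<in> S" for P using S that by auto
    have lamF: "laminar F" using laminar_subset[OF laminar_grid F(2)] .
    have lamS: "laminar S" using laminar_subset[OF lamF S] .
    define \<pi> where "\<pi> Q = (SOME P. P \<in> S \<and> Q \<subseteq> P \<and> a Q \<le> 2 * a P)" for Q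
    have \<pi>: "\<pi> Q \<in> S \<and> Q \<subseteq> \<pi> Q \<and> a Q \<le> 2 * a (\<pi> Q)" if "Q \<in> F" for Q
      unfolding \<pi>_def by (rule someI_ex) (use principal_parent[of F S a Q, OF sel that a0] in blast)
    have cI: "c Q * I Q = \<mu> Q powr (\<alpha> / n) * a Q" if "Q \<in> F" for Q
      using grd(4)[OF that] by (simp add: c_def a_def \<mu>_def powr_diff)
    have "X \<le> (\<Sum>Q\<in>F. 2 * a (\<pi> Q) * (\<mu> Q powr (\<alpha> / n) * G Q))"
      unfolding X_sum
    proof (rule sum_mono)
      fix Q assume Q: "Q \<in> F"
      have "a Q * (\<mu> Q powr (\<alpha> / n) * G Q) \<le> 2 * a (\<pi> Q) * (\<mu> Q powr (\<alpha> / n) * G Q)"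
        using \<pi>[OF Q] G0 by (intro mult_right_mono) auto
      then show "c Q * I Q * G Q \<le> 2 * a (\<pi> Q) * (\<mu> Q powr (\<alpha> / n) * G Q)"
        unfolding cI[OF Q] by (simp only: mult_ac)
    qed
    also have "\<dots> = (\<Sum>P\<in>S. \<Sum>Q | Q \<in> F \<and> \<pi> Q = P. 2 * a (\<pi> Q) * (\<mu> Q powr (\<alpha> / n) * G Q))"
      using F(1) finS \<pi> by (intro sum.group[symmetric]) auto
    also have "\<dots> = (\<Sum>P\<in>S. 2 * a P * (\<Sum>Q | Q \<in> F \<and> \<pi> Q = P. \<mu> Q powr (\<alpha> / n) * G Q))"
      by (simp add: sum_distrib_left)
    also have "\<dots> \<le> (\<Sum>P\<in>S. 2 * a P * (C\<alpha> * (\<mu> P powr (\<alpha> / n) * G P)))"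
    proof (intro sum_mono mult_left_mono)
      fix P assume P: "P \<in> S"
      show "(\<Sum>Q | Q \<in> F \<and> \<pi> Q = P. \<mu> Q powr (\<alpha> / n) * G Q) \<le> C\<alpha> * (\<mu> P powr (\<alpha> / n) * G P)"
        unfolding \<mu>_def n_def G_def C\<alpha>_def
      proof (rule sum_subcells_powr_le)
        show "Q \<subseteq> P" if "Q \<in> {Q \<in> F. \<pi> Q = P}" for Q using \<pi>[of Q] that by auto
        show "P \<in> grid u" using SF[OF P] F(2) by auto
      qed (use F P SF intg g0 \<alpha> in auto)
    qed (use a0 in auto)
    also have "\<dots> = 2 * C\<alpha> * (\<Sum>P\<in>S. c P * I P * G P)"
      unfolding sum_distrib_left using cI SF by (intro sum.cong refl) (simp add: mult_ac)
    finally have X1: "X \<le> 2 * C\<alpha> * (\<Sum>P\<in>S. c P * I P * G P)" .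
    \<comment> \<open>the part of a principal cube outside the smaller ones; these parts are disjoint and fill half of their cubes\<close>
    define E where "E P = P - \<Union>{R \<in> S. R \<subset> P}" for P
    have Eb: "E P \<in> sets borel" if "P \<in> S" for P
      unfolding E_def using grd(1) SF that finS by (intro sets.Diff sets.finite_Union) auto
    have ES: "E P \<subseteq> P" for P by (auto simp: E_def)
    have Edisj: "disjoint_family_on E S"
      unfolding disjoint_family_on_def
    proof (intro ballI impI)
      fix P R assume PR: "P \<in> S" "R \<in> S" "P \<noteq> R"
      then consider "P \<subset> R" | "R \<subset> P" | "P \<inter> R = {}" using lamS unfolding laminar_def by blast
      then show "E P \<inter> E R = {}" by cases (use PR in \<open>auto simp: E_def\<close>)
    qed
    have Emass: "measure lborel P \<le> 2 * measure lborel (E P)" if "P \<in> S" for P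
      unfolding E_def
    proof (rule principal_sparse[where f = f])
      fix P R assume "P \<in> S" "R \<in> S" "R \<subset> P"
      then show "2 * ((LINT x:P|lborel. f x) / measure lborel P) < (LINT x:R|lborel. f x) / measure lborel R"
        using sel[of R] SF by (auto simp: a_def I_def \<mu>_def)
    qed (use finS lamS grd SF intf f0 that in auto)
    have SSE: "SS P \<le> \<kappa>1 * (LINT x:E P|lborel. \<sigma> x)" and USE: "US P \<le> \<kappa>2 * (LINT x:E P|lborel. U x)" if "P \<in> S" for P
    proof -
      have "P \<in> grid u" using SF[OF that] F(2) by auto
      note * = Apq_cells_half_mass[OF w p q1 A this ES Eb[OF that] Emass[OF that]]
      show "SS P \<le> \<kappa>1 * (LINT x:E P|lborel. \<sigma> x)" using *(2) by (simp only: SS_def \<kappa>1_def \<sigma>_def p'_def)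
      show "US P \<le> \<kappa>2 * (LINT x:E P|lborel. U x)" using *(1) by (simp only: US_def \<kappa>2_def U_def)
    qed
    have "(\<Sum>P\<in>S. SS P * ((LINT x:P|lborel. \<phi> x * \<sigma> x) / SS P) powr p)
      \<le> \<kappa>1 * 2 powr p * (2 * carleson_const p) * (LINT x|lborel. \<phi> x powr p * \<sigma> x)"
      unfolding SS_def
    proof (rule carleson_embedding[OF finS lamS _ p, where E = E])
      show "S \<subseteq> sets lborel" using SF grd(2) by auto
      show "set_integrable lborel P (\<lambda>x. \<phi> x * \<sigma> x)" if "P \<in> S" for P unfolding \<phi>\<sigma> using intf SF[OF that] .
      show "integrable lborel (\<lambda>x. \<phi> x powr p * \<sigma> x)" unfolding \<phi>p by (rule f(3))
      show "(LINT x:P|lborel. \<sigma> x) \<le> \<kappa>1 * (LINT x:E P|lborel. \<sigma> x)" if "P \<in> S" for P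
        using SSE[OF that] by (simp only: SS_def)
      show "0 < (LINT x:P|lborel. \<sigma> x)" if "P \<in> S" for P using Spos(2)[OF SF[OF that]] by (simp only: SS_def)
      show "0 \<le> \<sigma> x" for x using less_imp_le[OF Upos(2)] .
      show "set_integrable lborel P \<sigma>" if "P \<in> S" for P using intU(2)[OF SF[OF that]] .
    qed (use \<phi>0 ES Eb Edisj K in auto)
    also have "\<dots> \<le> K1 * 1"
      unfolding \<phi>p K1_def[symmetric] using f(4) K by (intro mult_left_mono) auto
    finally have sum1: "(\<Sum>P\<in>S. SS P * (I P / SS P) powr p) \<le> K1" by (simp add: \<phi>\<sigma> I_def)
    have qq: "(T x powr (q - 1)) powr q' * U x = T x powr q * U x" for x
      using q1 by (simp add: powr_powr q'_def)
    have "(\<Sum>P\<in>S. US P * ((LINT x:P|lborel. T x powr (q - 1) * U x) / US P) powr q')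
      \<le> \<kappa>2 * 2 powr q' * (2 * carleson_const q') * (LINT x|lborel. (T x powr (q - 1)) powr q' * U x)"
      unfolding US_def
    proof (rule carleson_embedding[OF finS lamS _ p'1(2), where E = E])
      show "S \<subseteq> sets lborel" using SF grd(2) by auto
      show "set_integrable lborel P (\<lambda>x. T x powr (q - 1) * U x)" if "P \<in> S" for P
        using intTs[of "q - 1" P] SF[OF that] q1 by simp
      show "integrable lborel (\<lambda>x. (T x powr (q - 1)) powr q' * U x)" unfolding qq by (rule int_TU)
      show "(LINT x:P|lborel. U x) \<le> \<kappa>2 * (LINT x:E P|lborel. U x)" if "P \<in> S" for P
        using USE[OF that] by (simp only: US_def)
      show "0 < (LINT x:P|lborel. U x)" if "P \<in> S" for P using Spos(1)[OF SF[OF that]] by (simp only: US_def)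
      show "0 \<le> U x" for x using less_imp_le[OF Upos(1)] .
      show "set_integrable lborel P U" if "P \<in> S" for P using intU(1)[OF SF[OF that]] .
    qed (use ES Eb Edisj K in auto)
    then have sum2: "(\<Sum>P\<in>S. US P * (G P / US P) powr q') \<le> K2 * X"
      unfolding qq K2_def X_def by (simp only: G_def g_def)
    have "X \<le> C"
    proof (cases "X = 0")
      case True
      then show ?thesis by (simp add: C_def)
    next
      case False
      then have Xp: "0 < X" using X0 by simp
      \<comment> \<open>the factors for \<open>w^(-p')\<close> and \<open>w^q\<close> into which the \<open>A_(p,q)\<close> condition splits each term\<close>
      define s where "s P = SS P powr (1 / p) * (I P / SS P)" for P
      define t where "t P = US P powr (1 / q') * (G P / US P)" for P
      have "(\<Sum>P\<in>S. c P * I P * G P) \<le> (\<Sum>P\<in>S. A * (s P * t P))"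
      proof (rule sum_mono)
        fix P assume "P \<in> S"
        then have P: "P \<in> F" by (rule SF)
        have m: "0 < \<mu> P" using grd(4)[OF P] by (simp add: \<mu>_def)
        have e1: "1 / q + (p - 1) / p = 1 - \<alpha> / n" using q(2) p by (simp add: n_def field_simps)
        have "US P powr (1 / q) * SS P powr ((p - 1) / p) * c P \<le> A * \<mu> P powr (1 - \<alpha> / n) * c P"
          using A_ineq[OF P] unfolding e1 by (intro mult_right_mono) (auto simp: c_def)
        also have "\<dots> = A" using m by (simp add: c_def powr_add[symmetric])
        finally have "(s P * t P) * (US P powr (1 / q) * SS P powr ((p - 1) / p) * c P) \<le> (s P * t P) * A"
          using Spos[OF P] I0 G0 by (intro mult_left_mono) (auto simp: s_def t_def)
        moreover have "s P * SS P powr ((p - 1) / p) = I P"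
        proof -
          have "1 / p + (p - 1) / p = 1" using p by (simp add: field_simps)
          then have "SS P powr (1 / p) * SS P powr ((p - 1) / p) = SS P"
            unfolding powr_add[symmetric] using Spos[OF P] by simp
          then show ?thesis using Spos[OF P] by (simp add: s_def field_simps)
        qed
        moreover have "t P * US P powr (1 / q) = G P"
        proof -
          have "1 / q' + 1 / q = 1" using q1 by (simp add: q'_def field_simps)
          then have "US P powr (1 / q') * US P powr (1 / q) = US P"
            unfolding powr_add[symmetric] using Spos[OF P] by simp
          then show ?thesis using Spos[OF P] by (simp add: t_def field_simps)
        qed
        ultimately have "I P * G P * c P \<le> s P * t P * A"
          by (metis (no_types, opaque_lifting) mult.assoc mult.commute mult.left_commute)
        then show "c P * I P * G P \<le> A * (s P * t P)" by (simp only: mult_ac)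
      qed
      also have "\<dots> = A * (\<Sum>P\<in>S. s P * t P)" by (simp add: sum_distrib_left)
      also have "\<dots> \<le> A * (K3 * X powr (1 / q'))"
        unfolding K3_def p'_def
      proof (intro mult_left_mono sum_bilinear_off_diagonal finS)
        show "0 \<le> s P" if "P \<in> S" for P using Spos[OF SF[OF that]] I0 by (simp add: s_def)
        show "0 \<le> t P" if "P \<in> S" for P using Spos[OF SF[OF that]] G0 by (simp add: t_def)
        have "s P powr p = SS P * (I P / SS P) powr p" if "P \<in> S" for P
          unfolding s_def using Spos[OF SF[OF that]] I0[of P] p by (subst powr_mult) (auto simp: powr_powr)
        then show "(\<Sum>P\<in>S. s P powr p) \<le> K1" using sum1 by simp
        have "t P powr q' = US P * (G P / US P) powr q'" if "P \<in> S" for P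
          unfolding t_def using Spos[OF SF[OF that]] G0[of P] p'1 by (subst powr_mult) (auto simp: powr_powr)
        then show "(\<Sum>P\<in>S. t P powr q') \<le> K2 * X" using sum2 by simp
        show "q' \<le> p / (p - 1)" using qp' by (simp add: p'_def)
      qed (use p p'1 K Xp A in auto)
      finally have "(\<Sum>P\<in>S. c P * I P * G P) \<le> A * (K3 * X powr (1 / q'))" .
      then have "2 * C\<alpha> * (\<Sum>P\<in>S. c P * I P * G P) \<le> 2 * C\<alpha> * (A * (K3 * X powr (1 / q')))"
        using C\<alpha> by (intro mult_left_mono) auto
      with X1 have "X \<le> 2 * C\<alpha> * A * K3 * X powr (1 / q')" by (simp add: mult.assoc)
      moreover have "X = X powr (1 / q) * X powr (1 / q')"
      proof -
        have "1 / q + 1 / q' = 1" using q1 by (simp add: q'_def field_simps)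
        then show ?thesis unfolding powr_add[symmetric] using Xp by simp
      qed
      ultimately have "X powr (1 / q) * X powr (1 / q') \<le> 2 * C\<alpha> * A * K3 * X powr (1 / q')" by simp
      then have "X powr (1 / q) \<le> 2 * C\<alpha> * A * K3" using Xp by simp
      then have "(X powr (1 / q)) powr q \<le> C" unfolding C_def using q1 by (intro powr_mono2) auto
      then show ?thesis using Xp q1 by (simp add: powr_powr)
    qed
    then show ?thesis using int_TU by (simp add: X_def T_def U_def)
  qed
  moreover have "0 \<le> C" by (simp add: C_def)
  ultimately show ?thesis by blast
qed

section \<open>From the dyadic operator to the Riesz potential\<close>

text \<open>
  Real powers of extended nonnegative reals, with \<open>\<infinity>\<close> fixed: a Riesz potential may be infinite at some points
  before it is known to be finite almost everywhere.
\<close>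
definition epow :: "ennreal \<Rightarrow> real \<Rightarrow> ennreal" where
  "epow x r = (if x = top then top else ennreal (enn2real x powr r))"

lemma epow_ennreal: "0 \<le> a \<Longrightarrow> epow (ennreal a) r = ennreal (a powr r)"
  by (simp add: epow_def)

lemma epow_top [simp]: "epow top r = top"
  by (simp add: epow_def)

lemma epow_mono:
  assumes "x \<le> y" "0 \<le> r" shows "epow x r \<le> epow y r"
proof (cases "y = top")
  case False
  then have "y < top" by (simp add: less_top)
  then have "enn2real x \<le> enn2real y" "x \<noteq> top" using assms(1) by (auto simp: enn2real_mono top_unique)
  then show ?thesis using False assms(2) by (simp add: epow_def ennreal_leI powr_mono2)
qed simp

lemma measurable_epow [measurable (raw)]:
  assumes [measurable]: "f \<in> borel_measurable M" shows "(\<lambda>x. epow (f x) r) \<in> borel_measurable M"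
  unfolding epow_def by measurable

lemma epow_SUP:
  fixes X :: "nat \<Rightarrow> ennreal"
  assumes X: "incseq X" and r: "0 < r"
  shows "epow (SUP n. X n) r = (SUP n. epow (X n) r)"
proof (cases "(SUP n. X n) = top")
  case True
  have "(SUP n. epow (X n) r) = top"
    unfolding SUP_eq_top_iff
  proof (intro allI impI)
    fix b :: ennreal assume "b < top"
    then obtain c where c: "0 \<le> c" "b = ennreal c" by (cases b) auto
    have "ennreal ((c + 1) powr (1 / r)) < top" by simp
    moreover have "\<forall>b<top. \<exists>n. b < X n" using True SUP_eq_top_iff[of X UNIV] by simp
    ultimately obtain n where n: "ennreal ((c + 1) powr (1 / r)) < X n" by blast
    have "b < ennreal (c + 1)" using c by (simp add: ennreal_less_iff)
    also have "\<dots> = epow (ennreal ((c + 1) powr (1 / r))) r" using c r by (simp add: epow_ennreal powr_powr)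
    also have "\<dots> \<le> epow (X n) r" using n r by (intro epow_mono) auto
    finally show "\<exists>n\<in>UNIV. b < epow (X n) r" by auto
  qed
  then show ?thesis by (simp only: True epow_top)
next
  case False
  define L where "L = (SUP n. X n)"
  have Lf: "L < top" using False unfolding L_def less_top .
  have Xf: "X n < top" for n using Lf SUP_upper[of n UNIV X] by (auto simp: L_def intro: order.strict_trans1)
  have "X \<longlonglongrightarrow> L" unfolding L_def using LIMSEQ_SUP[OF X] .
  then have "(\<lambda>n. enn2real (X n)) \<longlonglongrightarrow> enn2real L"
    using Lf by (intro tendsto_enn2real) auto
  then have "(\<lambda>n. enn2real (X n) powr r) \<longlonglongrightarrow> enn2real L powr r"
    using r by (intro tendsto_powr') (auto intro: tendsto_const)
  then have "(\<lambda>n. ennreal (enn2real (X n) powr r)) \<longlonglongrightarrow> ennreal (enn2real L powr r)"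
    by (rule tendsto_ennrealI)
  then have 1: "(\<lambda>n. epow (X n) r) \<longlonglongrightarrow> epow L r"
    using Xf Lf by (simp add: epow_def less_top[symmetric] less_imp_neq)
  have "incseq (\<lambda>n. epow (X n) r)" using X r by (auto simp: incseq_def intro!: epow_mono)
  from LIMSEQ_unique[OF 1 LIMSEQ_SUP[OF this]] show ?thesis by (simp add: L_def)
qed

lemma epow_cmult:
  assumes "0 < c" shows "epow (ennreal c * x) r = ennreal (c powr r) * epow x r"
proof (cases "x = top")
  case True
  then show ?thesis using assms by (simp add: ennreal_mult_top)
next
  case False
  then obtain a where "0 \<le> a" "x = ennreal a" by (cases x) auto
  then show ?thesis using assms by (simp add: ennreal_mult[symmetric] epow_ennreal powr_mult)
qed

text \<open>
  A sum is at most the number of its terms times the largest of them.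
\<close>
lemma epow_sum_le:
  fixes a :: "'i \<Rightarrow> ennreal"
  assumes "finite S" "S \<noteq> {}" "0 \<le> r"
  shows "epow (\<Sum>i\<in>S. a i) r \<le> ennreal (card S powr r) * (\<Sum>i\<in>S. epow (a i) r)"
proof -
  have "Max (a ` S) \<in> a ` S" using assms by (intro Max_in) auto
  then obtain k where k: "k \<in> S" "Max (a ` S) = a k" by auto
  have c: "0 < real (card S)" using assms by (simp add: card_gt_0_iff)
  have "(\<Sum>i\<in>S. a i) \<le> (\<Sum>i\<in>S. a k)"
    unfolding k(2)[symmetric] using assms(1) by (intro sum_mono) simp
  also have "\<dots> = ennreal (card S) * a k" by (simp add: ennreal_of_nat_eq_real_of_nat)
  finally have "epow (\<Sum>i\<in>S. a i) r \<le> epow (ennreal (card S) * a k) r" using assms(3) by (rule epow_mono)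
  also have "\<dots> = ennreal (card S powr r) * epow (a k) r" using c by (rule epow_cmult)
  also have "\<dots> \<le> ennreal (card S powr r) * (\<Sum>i\<in>S. epow (a i) r)"
    using assms(1) k(1) by (intro mult_left_mono member_le_sum) auto
  finally show ?thesis .
qed

text \<open>
  The enumeration exhausts a grid by finite families, for which the dyadic operator is bounded.
\<close>
definition grid_upto :: "real ^ 'n \<Rightarrow> nat \<Rightarrow> (real ^ 'n) set set" where
  "grid_upto u K = from_nat_into (grid u) ` {..<K}"

lemma grid_upto: "finite (grid_upto u K)" "grid_upto u K \<subseteq> grid u" "K \<le> L \<Longrightarrow> grid_upto u K \<subseteq> grid_upto u L"
  "Q \<in> grid u \<Longrightarrow> \<exists>K. Q \<in> grid_upto u K"
proof -
  have "grid u \<noteq> {}" by (auto simp: grid_def)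
  then show "grid_upto u K \<subseteq> grid u" using from_nat_into[of "grid u"] by (auto simp: grid_upto_def)
  show "\<exists>K. Q \<in> grid_upto u K" if Q: "Q \<in> grid u"
  proof -
    obtain i where "from_nat_into (grid u) i = Q" using from_nat_into_surj[OF countable_grid Q] by auto
    then have "Q \<in> grid_upto u (Suc i)" unfolding grid_upto_def by blast
    then show ?thesis ..
  qed
qed (auto simp: grid_upto_def)

definition dyadic_kernel :: "real \<Rightarrow> (real ^ 'n) set set \<Rightarrow> real ^ 'n \<Rightarrow> real ^ 'n \<Rightarrow> real" where
  "dyadic_kernel \<alpha> F x y = (\<Sum>Q\<in>F. dyadic_coeff \<alpha> Q * (indicator Q x * indicator Q y))"

lemma dyadic_kernel_mono: "finite G \<Longrightarrow> F \<subseteq> G \<Longrightarrow> dyadic_kernel \<alpha> F x y \<le> dyadic_kernel \<alpha> G x y"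
  unfolding dyadic_kernel_def by (intro sum_mono2) (auto simp: dyadic_coeff_def)

lemma dyadic_op_nonneg: "(\<And>x. 0 \<le> f x) \<Longrightarrow> 0 \<le> dyadic_op \<alpha> F f x"
  unfolding dyadic_op_def dyadic_coeff_def set_lebesgue_integral_def
  by (intro sum_nonneg mult_nonneg_nonneg Bochner_Integration.integral_nonneg) auto

lemma dyadic_op_measurable: "F \<subseteq> grid u \<Longrightarrow> dyadic_op \<alpha> F f \<in> borel_measurable borel"
  unfolding dyadic_op_def[abs_def]
  by (intro borel_measurable_sum borel_measurable_times borel_measurable_const borel_measurable_indicator)
    (auto dest: grid_fmeasurable(1))

lemma nn_integral_dyadic_kernel:
  fixes f :: "real ^ 'n \<Rightarrow> real"
  assumes F: "finite F" "F \<subseteq> grid u" and f: "f \<in> borel_measurable borel" "\<And>x. 0 \<le> f x"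
    "\<And>Q. Q \<in> F \<Longrightarrow> set_integrable lborel Q f"
  shows "(\<integral>\<^sup>+y. ennreal (f y) * ennreal (dyadic_kernel \<alpha> F x y) \<partial>lborel) = ennreal (dyadic_op \<alpha> F f x)"
proof -
  have int: "integrable lborel (\<lambda>y. indicator Q y * f y)" if "Q \<in> F" for Q
    using f(3)[OF that] by (simp add: set_integrable_def)
  have eq: "f y * dyadic_kernel \<alpha> F x y = (\<Sum>Q\<in>F. dyadic_coeff \<alpha> Q * indicator Q x * (indicator Q y * f y))" for y
    by (simp add: dyadic_kernel_def sum_distrib_left mult_ac)
  have k0: "0 \<le> dyadic_kernel \<alpha> F x y" for y unfolding dyadic_kernel_def by (intro sum_nonneg) (auto simp: dyadic_coeff_def)
  have "(\<integral>\<^sup>+y. ennreal (f y) * ennreal (dyadic_kernel \<alpha> F x y) \<partial>lborel) = (\<integral>\<^sup>+y. ennreal (f y * dyadic_kernel \<alpha> F x y) \<partial>lborel)"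
    using f(2) k0 by (simp add: ennreal_mult)
  also have "\<dots> = ennreal (LINT y|lborel. f y * dyadic_kernel \<alpha> F x y)"
  proof (rule nn_integral_eq_integral)
    show "integrable lborel (\<lambda>y. f y * dyadic_kernel \<alpha> F x y)"
      unfolding eq using int by (intro Bochner_Integration.integrable_sum integrable_mult_right) auto
  qed (use f(2) k0 in auto)
  also have "(LINT y|lborel. f y * dyadic_kernel \<alpha> F x y)
    = (\<Sum>Q\<in>F. LINT y|lborel. dyadic_coeff \<alpha> Q * indicator Q x * (indicator Q y * f y))"
    unfolding eq by (rule Bochner_Integration.integral_sum) (rule integrable_mult_right[OF int])
  also have "\<dots> = (\<Sum>Q\<in>F. dyadic_coeff \<alpha> Q * indicator Q x * (LINT y|lborel. indicator Q y * f y))"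
    by (simp only: integral_mult_right_zero)
  also have "\<dots> = dyadic_op \<alpha> F f x"
    unfolding dyadic_op_def set_lebesgue_integral_def real_scaleR_def by (intro sum.cong refl) algebra
  finally show ?thesis .
qed

text \<open>
  The one-third trick. If both pairs of floors differ, then an integer and an integer shifted by \<open>2^M / 3\<close> both
  separate \<open>s\<close> from \<open>t\<close> and hence are closer than \<open>1 / 3\<close>. Then \<open>2^M\<close> is a multiple of three.
\<close>
lemma floor_shift_third:
  fixes s t :: real and M :: nat
  assumes "\<bar>s - t\<bar> < 1 / 3"
  shows "\<lfloor>s\<rfloor> = \<lfloor>t\<rfloor> \<or> \<lfloor>s - 2 ^ M / 3\<rfloor> = \<lfloor>t - 2 ^ M / 3\<rfloor>"
proof (rule ccontr)
  assume "\<not> ?thesis"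
  then have ne: "\<lfloor>s\<rfloor> \<noteq> \<lfloor>t\<rfloor>" "\<lfloor>s - 2 ^ M / 3\<rfloor> \<noteq> \<lfloor>t - 2 ^ M / 3\<rfloor>" by auto
  have between: "\<exists>a::int. min x y < a \<and> a \<le> max x y" if "\<lfloor>x\<rfloor> \<noteq> \<lfloor>y\<rfloor>" for x y :: real
  proof (intro exI conjI)
    show "min x y < of_int \<lfloor>max x y\<rfloor>"
      using that by (auto simp: min_def max_def) (metis floor_less_cancel floor_mono floor_of_int le_less linorder_not_less)+
    show "of_int \<lfloor>max x y\<rfloor> \<le> max x y" by simp
  qed
  obtain a :: int where a: "min s t < a" "a \<le> max s t" using between[OF ne(1)] by auto
  obtain b :: int where b: "min s t - 2 ^ M / 3 < b" "b \<le> max s t - 2 ^ M / 3"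
    using between[OF ne(2)] by (auto simp: min_def max_def split: if_splits)
  have "\<bar>of_int a - (of_int b + 2 ^ M / 3)\<bar> < (1 / 3 :: real)"
    using a b assms by (auto simp: min_def max_def abs_if split: if_splits)
  then have "\<bar>of_int (3 * (a - b) - 2 ^ M)\<bar> < (1 :: real)" by (simp add: abs_if split: if_splits)
  then have "\<bar>3 * (a - b) - 2 ^ M\<bar> < 1" by linarith
  then have "3 * (a - b) = 2 ^ M" by simp
  then have "(3::int) dvd 2 ^ M" by (metis dvd_triv_left)
  then have "(3::int) dvd 2" using prime_dvd_power[of "3::int" 2 M] by simp
  then show False by simp
qed

text \<open>
  One origin for each set of coordinates that are to be shifted. The amount \<open>2^N / 3\<close> serves every scale up to
  \<open>2^N\<close>, because \<open>2^N / 3\<close> is a number of the form \<open>2^M / 3\<close> in units of each such scale.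
\<close>
definition third_shift :: "nat \<Rightarrow> 'n set \<Rightarrow> real ^ 'n" where
  "third_shift N S = (\<chi> i. if i \<in> S then 2 ^ N / 3 else 0)"

text \<open>
  The side \<open>2^j\<close> is chosen larger than \<open>3 d\<close> and at most \<open>6 d\<close>, where \<open>d\<close> is the maximum distance of \<open>x\<close> and
  \<open>y\<close>. Shifting exactly the coordinates in which the unshifted grid separates the two points puts them
  into a common cell, whose coefficient is comparable to the kernel.
\<close>
lemma riesz_kernel_le_dyadic:
  fixes x y :: "real ^ 'n" and \<alpha> :: real
  assumes \<alpha>: "\<alpha> \<le> CARD('n)" and xy: "x \<noteq> y" "infnorm (x - y) < 2 ^ N / 3"
  shows "\<exists>S. \<exists>Q\<in>grid (third_shift N S). x \<in> Q \<and> y \<in> Q \<and>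
    norm (x - y) powr (\<alpha> - CARD('n)) \<le> 6 powr (CARD('n) - \<alpha>) * dyadic_coeff \<alpha> Q"
proof -
  define d where "d = infnorm (x - y)"
  have d: "0 < d" using xy(1) by (simp add: d_def infnorm_pos_lt)
  define j where "j = \<lfloor>log 2 (3 * d)\<rfloor> + 1"
  have "log 2 (3 * d) < N" using xy(2) d by (simp add: d_def log_less_iff powr_realpow)
  then have jN: "j \<le> int N" unfolding j_def by linarith
  have lo: "3 * d < 2 powr j"
  proof -
    have "log 2 (3 * d) < j" unfolding j_def by linarith
    then show ?thesis using d by (simp add: log_less_iff)
  qed
  have hi: "2 powr j \<le> 6 * d"
  proof -
    have "real_of_int j - 1 \<le> log 2 (3 * d)" unfolding j_def by simp
    then have "2 powr (real_of_int j - 1) \<le> 3 * d" using d by (simp add: le_log_iff)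
    then show ?thesis by (simp add: powr_diff)
  qed
  have pj: "(2::real) powi (- (- j)) = 2 powr j" by (simp add: powr_real_of_int'[symmetric])
  \<comment> \<open>the coordinates in which the unshifted grid separates \<open>x\<close> from \<open>y\<close>\<close>
  define S where "S = {i. \<lfloor>2 powi (- j) * x $ i\<rfloor> \<noteq> \<lfloor>2 powi (- j) * y $ i\<rfloor>}"
  define u where "u = (third_shift N S :: real ^ 'n)"
  have "\<lfloor>2 powi (- j) * (x $ i - u $ i)\<rfloor> = \<lfloor>2 powi (- j) * (y $ i - u $ i)\<rfloor>" for i
  proof (cases "i \<in> S")
    case False
    then show ?thesis by (simp add: u_def third_shift_def S_def)
  next
    case True
    have "\<bar>2 powi (- j) * x $ i - 2 powi (- j) * y $ i\<bar> = 2 powi (- j) * \<bar>(x - y) $ i\<bar>"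
      by (simp add: abs_mult right_diff_distrib[symmetric])
    also have "\<dots> \<le> 2 powi (- j) * d"
      unfolding d_def by (intro mult_left_mono component_le_infnorm_cart) simp
    also have "\<dots> < 1 / 3"
      using lo pj by (simp add: power_int_minus field_simps)
    finally have sm: "\<bar>2 powi (- j) * x $ i - 2 powi (- j) * y $ i\<bar> < 1 / 3" .
    have "(2::real) powi (- j) * 2 ^ N = 2 ^ nat (int N - j)"
      using jN by (subst power_int_of_nat[symmetric], subst power_int_add[symmetric]) (auto simp: power_int_def)
    then have sh: "2 powi (- j) * u $ i = 2 ^ nat (int N - j) / 3"
      using True by (simp add: u_def third_shift_def)
    show ?thesis
      using floor_shift_third[OF sm, of "nat (int N - j)"] True by (simp add: S_def right_diff_distrib sh)
  qed
  then have inQ: "x \<in> cell u (- j) y" by (simp add: cell_def)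
  have "dyadic_coeff \<alpha> (cell u (- j) y) = 2 powr (j * (\<alpha> - CARD('n)))"
  proof -
    have "measure lborel (cell u (- j) y) = 2 powr (j * CARD('n))"
      unfolding measure_cell pj by (simp add: powr_realpow[symmetric] powr_powr)
    then show ?thesis by (simp add: dyadic_coeff_def powr_powr right_diff_distrib)
  qed
  also have "\<dots> = (2 powr j) powr (\<alpha> - CARD('n))" by (simp add: powr_powr)
  also have "\<dots> \<ge> (6 * d) powr (\<alpha> - CARD('n))" using hi \<alpha> by (intro powr_mono2') auto
  finally have "(6 * d) powr (\<alpha> - CARD('n)) \<le> dyadic_coeff \<alpha> (cell u (- j) y)" .
  moreover have "(6 * norm (x - y)) powr (\<alpha> - CARD('n)) \<le> (6 * d) powr (\<alpha> - CARD('n))"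
    using \<alpha> d infnorm_le_norm[of "x - y"] by (intro powr_mono2') (auto simp: d_def)
  ultimately have "(6 * norm (x - y)) powr (\<alpha> - CARD('n)) \<le> dyadic_coeff \<alpha> (cell u (- j) y)" by (rule order.trans[rotated])
  then have "6 powr (CARD('n) - \<alpha>) * (6 powr (\<alpha> - CARD('n)) * norm (x - y) powr (\<alpha> - CARD('n)))
      \<le> 6 powr (CARD('n) - \<alpha>) * dyadic_coeff \<alpha> (cell u (- j) y)"
    by (intro mult_left_mono) (auto simp: powr_mult)
  then have "norm (x - y) powr (\<alpha> - CARD('n)) \<le> 6 powr (CARD('n) - \<alpha>) * dyadic_coeff \<alpha> (cell u (- j) y)"
    by (simp add: mult.assoc[symmetric] powr_add[symmetric])
  moreover have "cell u (- j) y \<in> grid (third_shift N S)" by (auto simp: grid_def u_def)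
  ultimately show ?thesis using inQ by (intro exI[of _ S] bexI[of _ "cell u (- j) y"]) auto
qed

definition riesz_potential :: "real \<Rightarrow> (real ^ 'n \<Rightarrow> real) \<Rightarrow> real ^ 'n \<Rightarrow> ennreal" where
  "riesz_potential \<alpha> f x = (\<integral>\<^sup>+y. ennreal (f y) * ennreal (norm (x - y) powr (\<alpha> - CARD('n))) \<partial>lborel)"

lemma riesz_potential_measurable [measurable]:
  assumes [measurable]: "f \<in> borel_measurable borel"
  shows "riesz_potential \<alpha> f \<in> borel_measurable borel"
proof -
  have "(\<lambda>x. \<integral>\<^sup>+y. ennreal (f y) * ennreal (norm (x - y) powr (\<alpha> - CARD('a))) \<partial>lborel) \<in> borel_measurable borel"
    by (intro sigma_finite_measure.borel_measurable_nn_integral sigma_finite_lborel) measurable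
  then show ?thesis by (simp add: riesz_potential_def[abs_def])
qed


lemma nn_integral_epow_dyadic_SUP:
  fixes w f :: "real ^ 'n \<Rightarrow> real"
  assumes f: "\<And>x. 0 \<le> f x" "\<And>Q. Q \<in> grid u \<Longrightarrow> set_integrable lborel Q f" and w: "w \<in> borel_measurable borel" and q: "0 < q"
    and bound: "\<And>K. (\<integral>\<^sup>+x. ennreal (dyadic_op \<alpha> (grid_upto u K) f x powr q * w x powr q) \<partial>lborel) \<le> C"
  shows "(\<integral>\<^sup>+x. epow (SUP K. ennreal (dyadic_op \<alpha> (grid_upto u K) f x)) q * ennreal (w x powr q) \<partial>lborel) \<le> C"
proof -
  have I0: "0 \<le> (LINT y:Q|lborel. f y)" for Q
    unfolding set_lebesgue_integral_def using f(1) by (intro Bochner_Integration.integral_nonneg) simp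
  have inc: "dyadic_op \<alpha> (grid_upto u K) f x \<le> dyadic_op \<alpha> (grid_upto u L) f x" if "K \<le> L" for K L x
    unfolding dyadic_op_def using grid_upto(1) grid_upto(3)[OF that] I0
    by (intro sum_mono2) (auto simp: dyadic_coeff_def)
  then have incs: "incseq (\<lambda>K. ennreal (dyadic_op \<alpha> (grid_upto u K) f x))" for x
    by (auto simp: incseq_def intro!: ennreal_leI)
  have [measurable]: "(\<lambda>x. dyadic_op \<alpha> (grid_upto u K) f x) \<in> borel_measurable borel" for K
    using dyadic_op_measurable[OF grid_upto(2)] .
  note w [measurable]
  have T0: "0 \<le> dyadic_op \<alpha> (grid_upto u K) f x" for K x using f(1) by (rule dyadic_op_nonneg)
  have "(\<integral>\<^sup>+x. epow (SUP K. ennreal (dyadic_op \<alpha> (grid_upto u K) f x)) q * ennreal (w x powr q) \<partial>lborel)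
    = (\<integral>\<^sup>+x. (SUP K. ennreal (dyadic_op \<alpha> (grid_upto u K) f x powr q * w x powr q)) \<partial>lborel)"
    using incs q T0 by (simp add: epow_SUP epow_ennreal SUP_mult_right_ennreal ennreal_mult)
  also have "\<dots> = (SUP K. \<integral>\<^sup>+x. ennreal (dyadic_op \<alpha> (grid_upto u K) f x powr q * w x powr q) \<partial>lborel)"
  proof (rule nn_integral_monotone_convergence_SUP)
    show "incseq (\<lambda>K x. ennreal (dyadic_op \<alpha> (grid_upto u K) f x powr q * w x powr q))"
      using inc T0 q by (auto simp: incseq_def le_fun_def intro!: ennreal_leI mult_right_mono powr_mono2)
  qed measurable
  also have "\<dots> \<le> C" using bound by (rule SUP_least)
  finally show ?thesis .
qed

text \<open>
  The truncation keeps the pairs of points that the shifts \<open>third_shift N\<close> can place in a common cell.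
\<close>
definition truncated_riesz :: "real \<Rightarrow> nat \<Rightarrow> (real ^ 'n \<Rightarrow> real) \<Rightarrow> real ^ 'n \<Rightarrow> ennreal" where
  "truncated_riesz \<alpha> N f x =
    (\<integral>\<^sup>+y. ennreal (f y) * (ennreal (norm (x - y) powr (\<alpha> - CARD('n))) * indicator {y. infnorm (x - y) < 2 ^ N / 3} y) \<partial>lborel)"

lemma borel_measurable_infnorm [measurable]: "infnorm \<in> borel_measurable (borel :: 'a::euclidean_space measure)"
  by (intro borel_measurable_continuous_onI continuous_at_imp_continuous_on ballI continuous_infnorm continuous_ident)

lemma truncated_riesz_measurable [measurable]:
  fixes f :: "real ^ 'n \<Rightarrow> real"
  assumes [measurable]: "f \<in> borel_measurable borel"
  shows "truncated_riesz \<alpha> N f \<in> borel_measurable borel"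
proof -
  have "(\<lambda>x. \<integral>\<^sup>+y. ennreal (f y) * (ennreal (norm (x - y) powr (\<alpha> - CARD('n))) * (if infnorm (x - y) < 2 ^ N / 3 then 1 else 0)) \<partial>lborel) \<in> borel_measurable borel"
    by (intro sigma_finite_measure.borel_measurable_nn_integral sigma_finite_lborel) measurable
  then show ?thesis by (simp add: truncated_riesz_def[abs_def] indicator_def)
qed

lemma SUP_truncated_riesz:
  fixes f :: "real ^ 'n \<Rightarrow> real"
  assumes [measurable]: "f \<in> borel_measurable borel"
  shows "incseq (\<lambda>N. truncated_riesz \<alpha> N f x)" "(SUP N. truncated_riesz \<alpha> N f x) = riesz_potential \<alpha> f x"
proof -
  define k where "k N y = ennreal (f y) * (ennreal (norm (x - y) powr (\<alpha> - CARD('n))) * indicator {y. infnorm (x - y) < 2 ^ N / 3} y)" for N :: nat and y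
  have inc: "k N y \<le> k M y" if "N \<le> M" for N M y
  proof -
    have "(2::real) ^ N / 3 \<le> 2 ^ M / 3" using that by (intro divide_right_mono power_increasing) auto
    then have "infnorm (x - y) < 2 ^ M / 3" if "infnorm (x - y) < 2 ^ N / 3" using that by linarith
    then show ?thesis unfolding k_def by (intro mult_left_mono) (auto simp: indicator_def)
  qed
  show "incseq (\<lambda>N. truncated_riesz \<alpha> N f x)"
    unfolding incseq_def truncated_riesz_def k_def[symmetric] using inc by (intro allI impI nn_integral_mono)
  have [measurable]: "k N \<in> borel_measurable lborel" for N
    unfolding k_def[abs_def] indicator_def by measurable
  have "(SUP N. truncated_riesz \<alpha> N f x) = (\<integral>\<^sup>+y. (SUP N. k N y) \<partial>lborel)"
    unfolding truncated_riesz_def k_def[symmetric]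
    by (rule nn_integral_monotone_convergence_SUP[symmetric]) (use inc in \<open>auto simp: incseq_def le_fun_def\<close>)
  also have "(\<lambda>y. SUP N. k N y) = (\<lambda>y. ennreal (f y) * ennreal (norm (x - y) powr (\<alpha> - CARD('n))))"
  proof (intro ext antisym)
    fix y
    show "(SUP N. k N y) \<le> ennreal (f y) * ennreal (norm (x - y) powr (\<alpha> - CARD('n)))"
      unfolding k_def by (intro SUP_least mult_left_mono) (auto simp: indicator_def)
    obtain N where "3 * infnorm (x - y) < 2 ^ N" using real_arch_pow[of 2] by auto
    then have "k N y = ennreal (f y) * ennreal (norm (x - y) powr (\<alpha> - CARD('n)))" by (simp add: k_def)
    then show "ennreal (f y) * ennreal (norm (x - y) powr (\<alpha> - CARD('n))) \<le> (SUP N. k N y)"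
      by (intro SUP_upper2[of N]) auto
  qed
  finally show "(SUP N. truncated_riesz \<alpha> N f x) = riesz_potential \<alpha> f x" by (simp add: riesz_potential_def)
qed

lemma truncated_riesz_le_dyadic:
  fixes f :: "real ^ 'n \<Rightarrow> real" and \<alpha> :: real
  assumes f: "f \<in> borel_measurable borel" "\<And>x. 0 \<le> f x" "\<And>u Q. Q \<in> grid u \<Longrightarrow> set_integrable lborel Q f"
    and \<alpha>: "\<alpha> \<le> CARD('n)"
  shows "truncated_riesz \<alpha> N f x \<le> ennreal (6 powr (CARD('n) - \<alpha>)) *
    (\<Sum>S\<in>UNIV. SUP K. ennreal (dyadic_op \<alpha> (grid_upto (third_shift N S) K) f x))"
proof -
  let ?k = "\<lambda>S K y. ennreal (dyadic_kernel \<alpha> (grid_upto (third_shift N S) K) x y)"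
  have k0: "0 \<le> dyadic_coeff \<alpha> Q" for Q :: "(real ^ 'n) set" by (simp add: dyadic_coeff_def)
  have mk: "?k S K \<in> borel_measurable lborel" for S K
    unfolding dyadic_kernel_def using grid_fmeasurable(1)[OF subsetD[OF grid_upto(2)]]
    by (intro measurable_compose[OF _ measurable_ennreal] borel_measurable_sum borel_measurable_times borel_measurable_const borel_measurable_indicator) auto
  have incK: "incseq (\<lambda>K. ?k S K y)" for S y
    unfolding incseq_def by (intro allI impI ennreal_leI dyadic_kernel_mono grid_upto(1) grid_upto(3))
  have "ennreal (norm (x - y) powr (\<alpha> - CARD('n))) * indicator {y. infnorm (x - y) < 2 ^ N / 3} y
    \<le> ennreal (6 powr (CARD('n) - \<alpha>)) * (\<Sum>S\<in>UNIV. SUP K. ?k S K y)" for y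
  proof (cases "x \<noteq> y \<and> infnorm (x - y) < 2 ^ N / 3")
    case True
    from riesz_kernel_le_dyadic[OF \<alpha> conjunct1[OF True] conjunct2[OF True]]
    obtain S Q where Q: "Q \<in> grid (third_shift N S)" "x \<in> Q" "y \<in> Q"
      "norm (x - y) powr (\<alpha> - CARD('n)) \<le> 6 powr (CARD('n) - \<alpha>) * dyadic_coeff \<alpha> Q" by blast
    obtain K where K: "Q \<in> grid_upto (third_shift N S) K" using grid_upto(4)[OF Q(1)] by blast
    have "dyadic_coeff \<alpha> Q * (indicator Q x * indicator Q y) \<le> dyadic_kernel \<alpha> (grid_upto (third_shift N S) K) x y"
      unfolding dyadic_kernel_def using K grid_upto(1) k0 by (intro member_le_sum) auto
    then have "ennreal (dyadic_coeff \<alpha> Q) \<le> ?k S K y" using Q by (intro ennreal_leI) simp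
    also have "\<dots> \<le> (SUP K. ?k S K y)" by (rule SUP_upper) simp
    also have "\<dots> \<le> (\<Sum>S\<in>UNIV. SUP K. ?k S K y)" by (rule member_le_sum) auto
    finally have "ennreal (6 powr (CARD('n) - \<alpha>)) * ennreal (dyadic_coeff \<alpha> Q)
      \<le> ennreal (6 powr (CARD('n) - \<alpha>)) * (\<Sum>S\<in>UNIV. SUP K. ?k S K y)" by (rule mult_left_mono) simp
    moreover have "ennreal (norm (x - y) powr (\<alpha> - CARD('n))) \<le> ennreal (6 powr (CARD('n) - \<alpha>)) * ennreal (dyadic_coeff \<alpha> Q)"
      using Q(4) k0 by (simp add: ennreal_mult[symmetric] ennreal_leI)
    ultimately have "ennreal (norm (x - y) powr (\<alpha> - CARD('n))) \<le> ennreal (6 powr (CARD('n) - \<alpha>)) * (\<Sum>S\<in>UNIV. SUP K. ?k S K y)"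
      by (rule order.trans[rotated])
    moreover have "indicator {y. infnorm (x - y) < 2 ^ N / 3} y = (1 :: ennreal)" using True by simp
    ultimately show ?thesis by (simp only: mult_1_right)
  next
    case False
    then have "ennreal (norm (x - y) powr (\<alpha> - CARD('n))) * indicator {y. infnorm (x - y) < 2 ^ N / 3} y = 0"
      by (auto simp: indicator_def)
    then show ?thesis by (simp only: zero_le)
  qed
  then have "truncated_riesz \<alpha> N f x \<le> (\<integral>\<^sup>+y. ennreal (f y) * (ennreal (6 powr (CARD('n) - \<alpha>)) * (\<Sum>S\<in>UNIV. SUP K. ?k S K y)) \<partial>lborel)"
    unfolding truncated_riesz_def by (intro nn_integral_mono mult_left_mono) auto
  also have "\<dots> = (\<integral>\<^sup>+y. ennreal (6 powr (CARD('n) - \<alpha>)) * (\<Sum>S\<in>UNIV. SUP K. ennreal (f y) * ?k S K y) \<partial>lborel)"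
  proof (rule nn_integral_cong)
    fix y
    have "ennreal (f y) * (\<Sum>S\<in>UNIV. SUP K. ?k S K y) = (\<Sum>S\<in>UNIV. SUP K. ennreal (f y) * ?k S K y)"
      by (simp only: sum_distrib_left SUP_mult_left_ennreal)
    then show "ennreal (f y) * (ennreal (6 powr (CARD('n) - \<alpha>)) * (\<Sum>S\<in>UNIV. SUP K. ?k S K y))
      = ennreal (6 powr (CARD('n) - \<alpha>)) * (\<Sum>S\<in>UNIV. SUP K. ennreal (f y) * ?k S K y)"
      by (subst mult.left_commute) (rule arg_cong)
  qed
  also have "\<dots> = ennreal (6 powr (CARD('n) - \<alpha>)) * (\<Sum>S\<in>UNIV. \<integral>\<^sup>+y. (SUP K. ennreal (f y) * ?k S K y) \<partial>lborel)"
  proof -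
    note f(1) [measurable] and mk [measurable]
    have meas: "(\<lambda>y. SUP K. ennreal (f y) * ?k S K y) \<in> borel_measurable lborel" for S by measurable
    show ?thesis
      by (subst nn_integral_cmult[OF borel_measurable_sum[OF meas]]) (subst nn_integral_sum[OF meas], rule refl)
  qed
  also have "(\<lambda>S. \<integral>\<^sup>+y. (SUP K. ennreal (f y) * ?k S K y) \<partial>lborel) = (\<lambda>S. SUP K. ennreal (dyadic_op \<alpha> (grid_upto (third_shift N S) K) f x))"
  proof (rule ext)
    fix S
    have "(\<integral>\<^sup>+y. (SUP K. ennreal (f y) * ?k S K y) \<partial>lborel) = (SUP K. \<integral>\<^sup>+y. ennreal (f y) * ?k S K y \<partial>lborel)"
    proof (rule nn_integral_monotone_convergence_SUP)
      show "incseq (\<lambda>K y. ennreal (f y) * ?k S K y)"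
        using incK by (auto simp: incseq_def le_fun_def intro!: mult_left_mono)
      show "(\<lambda>y. ennreal (f y) * ?k S K y) \<in> borel_measurable lborel" for K using f(1) mk by measurable
    qed
    also have "(\<lambda>K. \<integral>\<^sup>+y. ennreal (f y) * ?k S K y \<partial>lborel) = (\<lambda>K. ennreal (dyadic_op \<alpha> (grid_upto (third_shift N S) K) f x))"
      using f(3) subsetD[OF grid_upto(2)] by (intro ext nn_integral_dyadic_kernel[OF grid_upto(1) grid_upto(2) f(1) f(2)]) blast
    finally show "(\<integral>\<^sup>+y. (SUP K. ennreal (f y) * ?k S K y) \<partial>lborel) = (SUP K. ennreal (dyadic_op \<alpha> (grid_upto (third_shift N S) K) f x))" .
  qed
  finally show ?thesis .
qed

lemma riesz_potential_scale:
  assumes [measurable]: "f \<in> borel_measurable borel" and t: "0 < t"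
  shows "riesz_potential \<alpha> f x = ennreal t * riesz_potential \<alpha> (\<lambda>y. f y / t) x"
proof -
  have "ennreal (f y) = ennreal t * ennreal (f y / t)" for y
    using t by (cases "0 \<le> f y") (auto simp: ennreal_mult[symmetric] ennreal_neg divide_nonpos_pos)
  then show ?thesis unfolding riesz_potential_def
    by (subst nn_integral_cmult[symmetric]) (auto simp: mult.assoc)
qed

text \<open>
  Boundedness of \<open>T\<close> from \<open>L^p(w^p)\<close> to \<open>L^q(w^q)\<close> on nonnegative functions. The norm of \<open>f\<close> is only bounded by
  \<open>t > 0\<close>, which covers functions of norm zero without a case distinction.
\<close>
definition weighted_bound ::
  "real \<Rightarrow> real \<Rightarrow> real \<Rightarrow> (real ^ 'n \<Rightarrow> real) \<Rightarrow> ((real ^ 'n \<Rightarrow> real) \<Rightarrow> real ^ 'n \<Rightarrow> ennreal) \<Rightarrow> bool" where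
  "weighted_bound p q C w T \<longleftrightarrow> (\<forall>f t. f \<in> borel_measurable borel \<longrightarrow> (\<forall>x. 0 \<le> f x) \<longrightarrow> 0 < t \<longrightarrow>
     (\<integral>\<^sup>+x. ennreal (f x powr p * w x powr p) \<partial>lborel) \<le> ennreal (t powr p) \<longrightarrow>
     (\<integral>\<^sup>+x. epow (T f x) q * ennreal (w x powr q) \<partial>lborel) \<le> ennreal (C * t powr q))"

text \<open>
  The number of shifted grids does not depend on the truncation, so the dyadic bound passes to the limit by monotone
  convergence. The dyadic estimate is for functions of norm at most one; homogeneity gives the rest.
\<close>
theorem riesz_potential_weighted_bound:
  fixes \<alpha> p q A :: real
  assumes \<alpha>: "0 < \<alpha>" "\<alpha> < CARD('n)" and p: "1 < p" and q: "0 < q" "1 / p - 1 / q = \<alpha> / CARD('n)" and A: "0 \<le> A"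
  shows "\<exists>C\<ge>0. \<forall>w :: real ^ 'n \<Rightarrow> real. Apq_cells p q A w \<longrightarrow> weighted_bound p q C w (riesz_potential \<alpha>)"
proof -
  from dyadic_op_bound[OF \<alpha>(1) p q A]
  obtain C where C: "0 \<le> C" and bound': "\<forall>(w :: real ^ 'n \<Rightarrow> real) u F f. Apq_cells p q A w \<longrightarrow> finite F \<longrightarrow> F \<subseteq> grid u \<longrightarrow>
    f \<in> borel_measurable borel \<longrightarrow> (\<forall>x. 0 \<le> f x) \<longrightarrow> integrable lborel (\<lambda>x. f x powr p * w x powr p) \<longrightarrow>
    (LINT x|lborel. f x powr p * w x powr p) \<le> 1 \<longrightarrow>
    integrable lborel (\<lambda>x. dyadic_op \<alpha> F f x powr q * w x powr q) \<and>
    (LINT x|lborel. dyadic_op \<alpha> F f x powr q * w x powr q) \<le> C" by (elim exE conjE)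
  note bound = bound'[rule_format]
  define m where "m = real (card (UNIV :: 'n set set))"
  define c where "c = 6 powr (CARD('n) - \<alpha>)"
  define C' where "C' = c powr q * (m powr q * (m * C))"
  have c: "0 < c" by (simp add: c_def)
  have C': "0 \<le> C'" using C by (simp add: C'_def m_def)
  have unit: "(\<integral>\<^sup>+x. epow (riesz_potential \<alpha> f x) q * ennreal (w x powr q) \<partial>lborel) \<le> ennreal C'"
    if w: "Apq_cells p q A w" and f: "f \<in> borel_measurable borel" "\<And>x. 0 \<le> f x"
      and f1: "(\<integral>\<^sup>+x. ennreal (f x powr p * w x powr p) \<partial>lborel) \<le> 1" for w f :: "real ^ 'n \<Rightarrow> real"
  proof -
    note wm [measurable] = Apq_cellsD(1)[OF w]
    note f(1) [measurable]
    have int: "integrable lborel (\<lambda>x. f x powr p * w x powr p)"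
      using f1 by (intro integrableI_nonneg) (auto intro: order.strict_trans1)
    have le1: "(LINT x|lborel. f x powr p * w x powr p) \<le> 1"
      using f1 nn_integral_eq_integral[OF int] by simp
    have loc: "set_integrable lborel Q f" if "Q \<in> grid u" for Q u
      by (rule Apq_cells_integrable_on[OF w p that f int])
    define D where "D N S x = (SUP K. ennreal (dyadic_op \<alpha> (grid_upto (third_shift N S) K) f x))" for N S x
    have [measurable]: "(\<lambda>x. dyadic_op \<alpha> (grid_upto u K) f x) \<in> borel_measurable borel" for K u
      using dyadic_op_measurable[OF grid_upto(2)] .
    have Dm [measurable]: "(\<lambda>x. D N S x) \<in> borel_measurable borel" for N S unfolding D_def by measurable
    have Dbound: "(\<integral>\<^sup>+x. epow (D N S x) q * ennreal (w x powr q) \<partial>lborel) \<le> ennreal C" for N S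
      unfolding D_def
    proof (rule nn_integral_epow_dyadic_SUP[OF f(2) loc wm q(1)])
      fix K
      from bound[OF w grid_upto(1) grid_upto(2) f(1) f(2) int le1, of "third_shift N S" K] f(2)
      show "(\<integral>\<^sup>+x. ennreal (dyadic_op \<alpha> (grid_upto (third_shift N S) K) f x powr q * w x powr q) \<partial>lborel) \<le> ennreal C"
        by (subst nn_integral_eq_integral) (auto intro: ennreal_leI)
    qed
    have N: "(\<integral>\<^sup>+x. epow (truncated_riesz \<alpha> N f x) q * ennreal (w x powr q) \<partial>lborel) \<le> ennreal C'" for N
    proof -
      have "epow (truncated_riesz \<alpha> N f x) q \<le> ennreal (c powr q) * (ennreal (m powr q) * (\<Sum>S\<in>UNIV. epow (D N S x) q))" for x
      proof -
        have "epow (truncated_riesz \<alpha> N f x) q \<le> epow (ennreal c * (\<Sum>S\<in>UNIV. D N S x)) q"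
          using truncated_riesz_le_dyadic[OF f loc, where \<alpha> = \<alpha> and N = N and x = x] \<alpha> q(1) by (intro epow_mono) (auto simp: c_def D_def)
        also have "\<dots> = ennreal (c powr q) * epow (\<Sum>S\<in>UNIV. D N S x) q" using c by (rule epow_cmult)
        also have "\<dots> \<le> ennreal (c powr q) * (ennreal (m powr q) * (\<Sum>S\<in>UNIV. epow (D N S x) q))"
          unfolding m_def using q(1) by (intro mult_left_mono epow_sum_le) auto
        finally show ?thesis .
      qed
      then have "(\<integral>\<^sup>+x. epow (truncated_riesz \<alpha> N f x) q * ennreal (w x powr q) \<partial>lborel)
        \<le> (\<integral>\<^sup>+x. (ennreal (c powr q) * (ennreal (m powr q) * (\<Sum>S\<in>UNIV. epow (D N S x) q))) * ennreal (w x powr q) \<partial>lborel)"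
        by (intro nn_integral_mono mult_right_mono) auto
      also have "\<dots> = (\<integral>\<^sup>+x. ennreal (c powr q) * (ennreal (m powr q) * (\<Sum>S\<in>UNIV. epow (D N S x) q * ennreal (w x powr q))) \<partial>lborel)"
        by (simp add: sum_distrib_right mult.assoc)
      also have "\<dots> = ennreal (c powr q) * (ennreal (m powr q) * (\<Sum>S\<in>UNIV. \<integral>\<^sup>+x. epow (D N S x) q * ennreal (w x powr q) \<partial>lborel))"
        by (simp add: nn_integral_cmult nn_integral_sum)
      also have "\<dots> \<le> ennreal (c powr q) * (ennreal (m powr q) * (\<Sum>S\<in>(UNIV :: 'n set set). ennreal C))"
        using Dbound by (intro mult_left_mono sum_mono) auto
      also have "(\<Sum>S\<in>(UNIV :: 'n set set). ennreal C) = ennreal (m * C)"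
        using C by (simp add: m_def ennreal_of_nat_eq_real_of_nat ennreal_mult)
      also have "ennreal (c powr q) * (ennreal (m powr q) * ennreal (m * C)) = ennreal C'"
        using C by (simp add: C'_def ennreal_mult m_def)
      finally show ?thesis .
    qed
    note SR = SUP_truncated_riesz[OF f(1), of \<alpha>]
    have "(\<integral>\<^sup>+x. epow (riesz_potential \<alpha> f x) q * ennreal (w x powr q) \<partial>lborel)
      = (\<integral>\<^sup>+x. (SUP N. epow (truncated_riesz \<alpha> N f x) q * ennreal (w x powr q)) \<partial>lborel)"
      unfolding SR(2)[symmetric] epow_SUP[OF SR(1) q(1)] by (simp add: SUP_mult_right_ennreal)
    also have "\<dots> = (SUP N. \<integral>\<^sup>+x. epow (truncated_riesz \<alpha> N f x) q * ennreal (w x powr q) \<partial>lborel)"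
    proof (rule nn_integral_monotone_convergence_SUP)
      show "incseq (\<lambda>N x. epow (truncated_riesz \<alpha> N f x) q * ennreal (w x powr q))"
        using SR(1) q(1) by (auto simp: incseq_def le_fun_def intro!: mult_right_mono epow_mono)
    qed measurable
    also have "\<dots> \<le> ennreal C'" using N by (intro SUP_least) auto
    finally show ?thesis .
  qed
  have "(\<integral>\<^sup>+x. epow (riesz_potential \<alpha> f x) q * ennreal (w x powr q) \<partial>lborel) \<le> ennreal (C' * t powr q)"
    if w: "Apq_cells p q A w" and f: "f \<in> borel_measurable borel" "\<forall>x. 0 \<le> f x" and t: "0 < t"
      and ft: "(\<integral>\<^sup>+x. ennreal (f x powr p * w x powr p) \<partial>lborel) \<le> ennreal (t powr p)" for w f :: "real ^ 'n \<Rightarrow> real" and t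
  proof -
    note wm [measurable] = Apq_cellsD(1)[OF w]
    note f(1) [measurable]
    define g where "g x = f x / t" for x
    have gm [measurable]: "g \<in> borel_measurable borel" unfolding g_def[abs_def] by measurable
    have "(\<integral>\<^sup>+x. ennreal (g x powr p * w x powr p) \<partial>lborel) = (\<integral>\<^sup>+x. ennreal (t powr (- p)) * ennreal (f x powr p * w x powr p) \<partial>lborel)"
      using t f(2) by (intro nn_integral_cong) (simp add: g_def powr_divide powr_minus_divide ennreal_mult[symmetric])
    also have "\<dots> = ennreal (t powr (- p)) * (\<integral>\<^sup>+x. ennreal (f x powr p * w x powr p) \<partial>lborel)" by (simp add: nn_integral_cmult)
    also have "\<dots> \<le> ennreal (t powr (- p)) * ennreal (t powr p)" using ft by (rule mult_left_mono) simp
    also have "\<dots> = 1" using t by (simp add: ennreal_mult[symmetric] powr_add[symmetric])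
    finally have g1: "(\<integral>\<^sup>+x. ennreal (g x powr p * w x powr p) \<partial>lborel) \<le> 1" .
    have "(\<integral>\<^sup>+x. epow (riesz_potential \<alpha> f x) q * ennreal (w x powr q) \<partial>lborel)
      = (\<integral>\<^sup>+x. ennreal (t powr q) * (epow (riesz_potential \<alpha> g x) q * ennreal (w x powr q)) \<partial>lborel)"
      using riesz_potential_scale[OF f(1) t, of \<alpha>] t by (simp add: epow_cmult g_def[abs_def] mult.assoc)
    also have "\<dots> = ennreal (t powr q) * (\<integral>\<^sup>+x. epow (riesz_potential \<alpha> g x) q * ennreal (w x powr q) \<partial>lborel)"
      by (rule nn_integral_cmult) measurable
    also have "\<dots> \<le> ennreal (t powr q) * ennreal C'"
      using f(2) t g1 by (intro mult_left_mono unit w) (auto simp: g_def)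
    also have "\<dots> = ennreal (C' * t powr q)" using C' by (simp add: ennreal_mult[symmetric] mult.commute)
    finally show ?thesis .
  qed
  then have "Apq_cells p q A w \<Longrightarrow> weighted_bound p q C' w (riesz_potential \<alpha>)" for w :: "real ^ 'n \<Rightarrow> real"
    unfolding weighted_bound_def by (intro allI impI)
  then show ?thesis using C' by (intro exI[of _ C'] conjI allI impI)
qed

section \<open>The John-Nirenberg inequality at a finite level\<close>

definition cell_avg :: "(real ^ 'n) set \<Rightarrow> (real ^ 'n \<Rightarrow> real) \<Rightarrow> real" where
  "cell_avg Q b = (LINT x:Q|lborel. b x) / measure lborel Q"

definition bmo_cells :: "real \<Rightarrow> (real ^ 'n \<Rightarrow> real) \<Rightarrow> bool" where
  "bmo_cells B b \<longleftrightarrow> b \<in> borel_measurable borel \<and>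
     (\<forall>u. \<forall>Q\<in>grid u. set_integrable lborel Q b \<and>
        (LINT x:Q|lborel. \<bar>b x - cell_avg Q b\<bar>) \<le> B * measure lborel Q)"

lemma bmo_cellsD:
  assumes "bmo_cells B b"
  shows "b \<in> borel_measurable borel"
    and "\<And>Q. Q \<in> grid u \<Longrightarrow> set_integrable lborel Q b"
    and "\<And>Q. Q \<in> grid u \<Longrightarrow> (LINT x:Q|lborel. \<bar>b x - cell_avg Q b\<bar>) \<le> B * measure lborel Q"
  using assms unfolding bmo_cells_def by blast+

lemma set_integrable_const_grid: "Q \<in> grid u \<Longrightarrow> set_integrable lborel Q (\<lambda>_. c :: real)"
  using grid_fmeasurable(2)[of Q u] by (auto simp: set_integrable_def fmeasurable_def)

lemma set_integral_const_grid: "Q \<in> grid u \<Longrightarrow> (LINT x:Q|lborel. c :: real) = c * measure lborel Q"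
  using grid_fmeasurable(2)[of Q u] by (simp add: set_lebesgue_integral_def fmeasurable_def)

lemma cell_avg_diff_le:
  assumes R: "R \<in> grid u" "set_integrable lborel R b"
  shows "\<bar>cell_avg R b - c\<bar> * measure lborel R \<le> (LINT x:R|lborel. \<bar>b x - c\<bar>)"
proof -
  have "(LINT x:R|lborel. b x - c) = (LINT x:R|lborel. b x) - c * measure lborel R"
    using R set_integrable_const_grid[OF R(1)] by (subst set_integral_diff) (auto simp: set_integral_const_grid)
  also have "\<dots> = (cell_avg R b - c) * measure lborel R"
    using grid_fmeasurable(3)[OF R(1)] by (simp add: cell_avg_def field_simps)
  finally have "\<bar>cell_avg R b - c\<bar> * measure lborel R = \<bar>LINT x:R|lborel. b x - c\<bar>"
    by (simp add: abs_mult)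
  also have "\<dots> \<le> (LINT x:R|lborel. \<bar>b x - c\<bar>)"
    unfolding set_lebesgue_integral_def by (rule order.trans[OF integral_abs_bound]) (simp add: abs_mult)
  finally show ?thesis .
qed

lemma cell_grid [simp]: "cell u k y \<in> grid u"
  by (auto simp: grid_def)

lemma set_integrable_oscillation:
  assumes "Q \<in> grid u" "set_integrable lborel Q (b :: real ^ 'n \<Rightarrow> real)"
  shows "set_integrable lborel Q (\<lambda>x. \<bar>b x - c\<bar>)"
  using assms set_integrable_const_grid[OF assms(1), of c] by (intro set_integrable_abs set_integral_diff(1))

text \<open>
  A child occupies the fraction \<open>2^(-n)\<close> of its parent.
\<close>
lemma cell_avg_child_le:
  fixes b :: "real ^ 'n \<Rightarrow> real"
  assumes b: "bmo_cells B b"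
  shows "\<bar>cell_avg (cell u (k + 1) x) b - cell_avg (cell u k x) b\<bar> \<le> 2 ^ CARD('n) * B"
proof -
  let ?Q = "cell u k x" and ?R = "cell u (k + 1) x"
  have sub: "?R \<subseteq> ?Q" by (rule cell_mono) simp
  have "\<bar>cell_avg ?R b - cell_avg ?Q b\<bar> * measure lborel ?R \<le> (LINT x:?R|lborel. \<bar>b x - cell_avg ?Q b\<bar>)"
    by (rule cell_avg_diff_le[OF cell_grid bmo_cellsD(2)[OF b cell_grid]])
  also have "\<dots> \<le> (LINT x:?Q|lborel. \<bar>b x - cell_avg ?Q b\<bar>)"
    using sum_set_integral_disjoint_le[of "{?R}" "\<lambda>R. R" ?Q lborel "\<lambda>x. \<bar>b x - cell_avg ?Q b\<bar>"] sub
      set_integrable_oscillation[OF cell_grid bmo_cellsD(2)[OF b cell_grid]]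
    by (simp add: disjoint_family_on_def)
  also have "\<dots> \<le> B * measure lborel ?Q" by (rule bmo_cellsD(3)[OF b cell_grid])
  also have "measure lborel ?Q = 2 ^ CARD('n) * measure lborel ?R"
  proof -
    have "(2::real) powi (- k) = 2 * 2 powi (- (k + 1))"
      using power_int_add_1'[of "2::real" "- (k + 1)"] by simp
    then show ?thesis by (simp only: measure_cell power_mult_distrib)
  qed
  finally have "\<bar>cell_avg ?R b - cell_avg ?Q b\<bar> * measure lborel ?R \<le> (2 ^ CARD('n) * B) * measure lborel ?R"
    by (simp only: mult_ac)
  then show ?thesis using measure_cell_pos[of u "k + 1" x] by simp
qed

lemma cell_avg_measurable [measurable]: "(\<lambda>x. cell_avg (cell u j x) b) \<in> borel_measurable borel"
proof (rule measurableI)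
  fix A :: "real set" assume "A \<in> sets borel"
  have "(\<lambda>x. cell_avg (cell u j x) b) -` A \<inter> space borel = \<Union>{Q \<in> range (cell u j). cell_avg Q b \<in> A}"
  proof (intro equalityI subsetI)
    fix x assume "x \<in> (\<lambda>x. cell_avg (cell u j x) b) -` A \<inter> space borel"
    then show "x \<in> \<Union>{Q \<in> range (cell u j). cell_avg Q b \<in> A}" by (intro UnionI[of "cell u j x"]) auto
  next
    fix x assume "x \<in> \<Union>{Q \<in> range (cell u j). cell_avg Q b \<in> A}"
    then obtain y where "x \<in> cell u j y" "cell_avg (cell u j y) b \<in> A" by auto
    then show "x \<in> (\<lambda>x. cell_avg (cell u j x) b) -` A \<inter> space borel" by (simp add: cell_eqI)
  qed
  also have "\<dots> \<in> sets borel"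
  proof (rule sets.countable_Union)
    have "{Q \<in> range (cell u j). cell_avg Q b \<in> A} \<subseteq> grid u" by (auto simp: grid_def)
    then show "countable {Q \<in> range (cell u j). cell_avg Q b \<in> A}" by (rule countable_subset) (rule countable_grid)
  qed auto
  finally show "(\<lambda>x. cell_avg (cell u j x) b) -` A \<inter> space borel \<in> sets borel" .
qed simp

text \<open>
  The complement of \<open>G\<close> fills half of \<open>Q\<close> and carries the proportion \<open>1 / \<kappa>\<close> of the mass. Using \<open>1 / (\<kappa> + 1)\<close>
  instead keeps the bound meaningful for every \<open>\<kappa> \<ge> 0\<close>.
\<close>
lemma half_mass_complement:
  fixes v :: "real ^ 'n \<Rightarrow> real"
  assumes Q: "Q \<in> grid u" and v: "set_integrable lborel Q v" "\<And>x. 0 < v x"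
    and half: "\<And>E. E \<subseteq> Q \<Longrightarrow> E \<in> sets borel \<Longrightarrow> measure lborel Q \<le> 2 * measure lborel E \<Longrightarrow>
      (LINT x:Q|lborel. v x) \<le> \<kappa> * (LINT x:E|lborel. v x)" and \<kappa>: "0 \<le> \<kappa>"
    and G: "G \<subseteq> Q" "G \<in> sets borel" "2 * measure lborel G \<le> measure lborel Q"
  shows "(LINT x:G|lborel. v x) \<le> (1 - 1 / (\<kappa> + 1)) * (LINT x:Q|lborel. v x)"
proof -
  let ?E = "Q - G"
  have V: "0 < (LINT x:Q|lborel. v x)"
    using grid_fmeasurable[OF Q] v by (intro set_integral_pos) auto
  have "measure lborel ?E = measure lborel Q - measure lborel G"
    using grid_fmeasurable[OF Q] G by (intro measure_Diff) (auto simp: fmeasurable_def)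
  then have "(LINT x:Q|lborel. v x) \<le> \<kappa> * (LINT x:?E|lborel. v x)"
    using grid_fmeasurable[OF Q] G by (intro half) auto
  moreover have "(LINT x:Q|lborel. v x) = (LINT x:G|lborel. v x) + (LINT x:?E|lborel. v x)"
  proof -
    have eq: "Q = G \<union> ?E" using G by auto
    show ?thesis
      using grid_fmeasurable[OF Q] G by (subst eq, intro set_integral_Un set_integrable_subset[OF v(1)]) auto
  qed
  moreover have "0 \<le> (LINT x:?E|lborel. v x)"
    unfolding set_lebesgue_integral_def using less_imp_le[OF v(2)] by (intro Bochner_Integration.integral_nonneg) simp
  ultimately have "(\<kappa> + 1) * (LINT x:G|lborel. v x) \<le> \<kappa> * (LINT x:Q|lborel. v x)"
    by (simp add: algebra_simps)
  then show ?thesis using \<kappa> by (simp add: field_simps)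
qed

lemma exp_abs_triangle: "0 \<le> c \<Longrightarrow> \<bar>y - z\<bar> \<le> L \<Longrightarrow> exp (c * \<bar>x - z\<bar>) \<le> exp (c * L) * exp (c * \<bar>x - y\<bar>)" for c :: real
proof -
  assume *: "0 \<le> c" "\<bar>y - z\<bar> \<le> L"
  have "c * \<bar>x - z\<bar> \<le> c * (L + \<bar>x - y\<bar>)" using * by (intro mult_left_mono) auto
  then show ?thesis by (simp add: exp_add[symmetric] distrib_left)
qed

text \<open>
  The function \<open>b\<close> is replaced by its averages over cells of level \<open>k + N\<close>, which makes the inequality a finite statement,
  proved by induction on \<open>N\<close>. Below \<open>Q\<close> the process stops at the first cells whose average differs
  from that of \<open>Q\<close> by more than \<open>2 B\<close>. They fill at most half of \<open>Q\<close>, hence carry at most the proportion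
  \<open>\<theta>\<close> of the mass; their averages differ from that of \<open>Q\<close> by at most \<open>2 B + 2^n B\<close>, since
  their parents were not stopped; and inside them the induction hypothesis applies. Outside of them the
  difference is at most \<open>2 B\<close>. The hypothesis \<open>absorb\<close> says that the constant \<open>C\<close> survives this step.
\<close>
lemma john_nirenberg_discrete:
  fixes v b :: "real ^ 'n \<Rightarrow> real" and \<kappa> B c C \<theta> :: real
  assumes b: "bmo_cells B b" "0 < B"
    and A_inf: "A_infinity_cells \<kappa> v" and \<kappa>: "0 \<le> \<kappa>"
    and \<theta>: "\<theta> = 1 - 1 / (\<kappa> + 1)" and c: "0 < c" and C: "0 \<le> C"
    and absorb: "exp (c * (2 * B)) + exp (c * (2 * B + 2 ^ CARD('n) * B)) * C * \<theta> \<le> C"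
  shows "(\<integral>\<^sup>+x\<in>cell u k y. ennreal (exp (c * \<bar>cell_avg (cell u (k + int N) x) b - cell_avg (cell u k y) b\<bar>) * v x) \<partial>lborel)
    \<le> ennreal (C * (LINT x:cell u k y|lborel. v x))"
proof (induction N arbitrary: k y rule: less_induct)
  case (less N)
  note v = A_infinity_cellsD(1)[OF A_inf] A_infinity_cellsD(2)[OF A_inf] A_infinity_cellsD(3)[OF A_inf]
    and half = A_infinity_cellsD(4)[OF A_inf]
  define Q where "Q = cell u k y"
  define \<beta> where "\<beta> j x = cell_avg (cell u (k + int j) x) b" for j x
  define bQ where "bQ = cell_avg Q b"
  define l where "l = 2 * B"
  define L where "L = 2 * B + 2 ^ CARD('n) * B"
  define stopped where "stopped x \<longleftrightarrow> (\<exists>j\<le>N. l < \<bar>\<beta> j x - bQ\<bar>)" for x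
  \<comment> \<open>the stopping level; it is positive because \<open>\<beta> 0\<close> equals \<open>bQ\<close> on \<open>Q\<close>\<close>
  define J where "J x = (LEAST j. l < \<bar>\<beta> j x - bQ\<bar>)" for x
  define S where "S x = cell u (k + int (J x)) x" for x
  define G where "G = S ` {x \<in> Q. stopped x}"
  have Qg: "Q \<in> grid u" by (simp add: Q_def)
  have \<beta>0: "\<beta> 0 x = bQ" if "x \<in> Q" for x
    using that by (simp add: \<beta>_def bQ_def Q_def cell_eqI)
  have J: "l < \<bar>\<beta> (J x) x - bQ\<bar>" "J x \<le> N" "\<And>i. i < J x \<Longrightarrow> \<bar>\<beta> i x - bQ\<bar> \<le> l" if "stopped x" for x
  proof -
    from that obtain j where j: "j \<le> N" "l < \<bar>\<beta> j x - bQ\<bar>" by (auto simp: stopped_def)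
    show "l < \<bar>\<beta> (J x) x - bQ\<bar>" unfolding J_def using j(2) by (rule LeastI)
    have "J x \<le> j" unfolding J_def using j(2) by (rule Least_le)
    with j(1) show "J x \<le> N" by simp
    show "\<bar>\<beta> i x - bQ\<bar> \<le> l" if "i < J x" for i
      using not_less_Least[of i "\<lambda>j. l < \<bar>\<beta> j x - bQ\<bar>"] that by (simp add: J_def not_less)
  qed
  have Jpos: "0 < J x" if "x \<in> Q" "stopped x" for x
  proof (rule ccontr)
    assume "\<not> 0 < J x"
    then have "\<beta> (J x) x = bQ" using \<beta>0[OF that(1)] by simp
    with J(1)[OF that(2)] b(2) show False by (simp add: l_def)
  qed
  \<comment> \<open>all points of a stopping cell stop at the same level, so distinct stopping cells are disjoint\<close>
  have S_const: "S z = S x" if x: "x \<in> Q" "stopped x" and z: "z \<in> S x" for x z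
  proof -
    have eq: "cell u (k + int i) z = cell u (k + int i) x" if "i \<le> J x" for i
    proof (rule cell_eqI)
      have "S x \<subseteq> cell u (k + int i) x" unfolding S_def using that by (intro cell_mono) simp
      with z show "z \<in> cell u (k + int i) x" by auto
    qed
    then have \<beta>eq: "\<beta> i z = \<beta> i x" if "i \<le> J x" for i using that by (simp add: \<beta>_def)
    have "J z = J x" unfolding J_def[of z]
    proof (rule Least_equality)
      show "l < \<bar>\<beta> (J x) z - bQ\<bar>" using J(1)[OF x(2)] \<beta>eq[of "J x"] by simp
      fix i assume i: "l < \<bar>\<beta> i z - bQ\<bar>"
      show "J x \<le> i"
      proof (rule ccontr)
        assume "\<not> J x \<le> i"
        then have "i < J x" by simp
        with J(3)[OF x(2) this] \<beta>eq[of i] i show False by simp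
      qed
    qed
    then show ?thesis using eq[of "J x"] by (simp add: S_def)
  qed
  have S_sub: "S x \<subseteq> Q" if "x \<in> Q" for x
  proof -
    have "S x \<subseteq> cell u k x" unfolding S_def by (intro cell_mono) simp
    also have "\<dots> = Q" using that by (simp add: Q_def cell_eqI)
    finally show ?thesis .
  qed
  have fin: "finite G"
  proof (rule finite_subset)
    show "G \<subseteq> (\<Union>j\<le>N. {cell u (k + int j) x | x. x \<in> cell u k y})"
      unfolding G_def S_def using J(2) by (auto simp: Q_def)
    show "finite (\<Union>j\<le>N. {cell u (k + int j) x | x. x \<in> cell u k y})"
      by (intro finite_UN_I finite_subcells) simp
  qed
  have Ggrid: "G \<subseteq> grid u" by (auto simp: G_def S_def)
  have Gm: "R \<in> sets borel" "R \<subseteq> Q" "R \<in> fmeasurable lborel" if "R \<in> G" for R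
    using that Ggrid grid_fmeasurable[of R u] S_sub by (auto simp: G_def)
  have disj: "disjoint_family_on (\<lambda>R. R) G"
    unfolding disjoint_family_on_def
  proof (intro ballI impI)
    fix R R' assume R: "R \<in> G" "R' \<in> G" "R \<noteq> R'"
    show "R \<inter> R' = {}"
    proof (rule ccontr)
      assume "R \<inter> R' \<noteq> {}"
      then obtain z where z: "z \<in> R" "z \<in> R'" by auto
      from R(1) obtain x where x: "x \<in> Q" "stopped x" "R = S x" by (auto simp: G_def)
      from R(2) obtain x' where x': "x' \<in> Q" "stopped x'" "R' = S x'" by (auto simp: G_def)
      have "R = S z" "R' = S z" using S_const[of x z] S_const[of x' z] x x' z by auto
      with R(3) show False by simp
    qed
  qed
  have UG: "\<Union>G \<in> sets borel" "\<Union>G \<subseteq> Q" using fin Gm by (auto intro!: sets.finite_Union)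
  have intb: "set_integrable lborel R b" if "R \<in> grid u" for R using bmo_cellsD(2)[OF b(1) that] .
  have weak: "l * measure lborel (\<Union>G) \<le> (LINT x:Q|lborel. \<bar>b x - bQ\<bar>)"
  proof (rule laminar_weak_type[OF fin laminar_subset[OF laminar_grid Ggrid]])
    show "R \<subseteq> Q \<and> R \<in> fmeasurable lborel" if "R \<in> G" for R using Gm[OF that] by simp
    show "set_integrable lborel Q (\<lambda>x. \<bar>b x - bQ\<bar>)" using set_integrable_oscillation[OF Qg intb[OF Qg]] .
    show "l * measure lborel R \<le> (LINT x:R|lborel. \<bar>b x - bQ\<bar>)" if R: "R \<in> G" for R
    proof -
      from R obtain x where x: "x \<in> Q" "stopped x" "R = S x" by (auto simp: G_def)
      have "l \<le> \<bar>cell_avg R b - bQ\<bar>" using J(1)[OF x(2)] by (simp add: \<beta>_def x(3) S_def)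
      then have "l * measure lborel R \<le> \<bar>cell_avg R b - bQ\<bar> * measure lborel R" by (intro mult_right_mono) auto
      also have "\<dots> \<le> (LINT x:R|lborel. \<bar>b x - bQ\<bar>)" using R Ggrid intb by (intro cell_avg_diff_le) auto
      finally show ?thesis .
    qed
    show "Q \<in> sets lborel" using grid_fmeasurable(1)[OF Qg] by simp
  qed (use b(2) in \<open>auto simp: l_def\<close>)
  also have "\<dots> \<le> B * measure lborel Q" unfolding bQ_def using bmo_cellsD(3)[OF b(1) Qg] .
  finally have halfG: "2 * measure lborel (\<Union>G) \<le> measure lborel Q" using b(2) by (simp add: l_def)
  define V where "V R = (LINT x:R|lborel. v x)" for R
  have V0: "0 \<le> V R" for R unfolding V_def set_lebesgue_integral_def
    using less_imp_le[OF v(2)] by (intro Bochner_Integration.integral_nonneg) simp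
  have intv: "set_integrable lborel R v" if "R \<subseteq> Q" "R \<in> sets borel" for R
    using set_integrable_subset[OF v(3)[OF Qg]] that by simp
  have nnV: "(\<integral>\<^sup>+x\<in>R. ennreal (v x) \<partial>lborel) = ennreal (V R)" if "R \<subseteq> Q" "R \<in> sets borel" for R
  proof -
    have "(\<integral>\<^sup>+x\<in>R. ennreal (v x) \<partial>lborel) = (\<integral>\<^sup>+x. ennreal (indicator R x * v x) \<partial>lborel)"
      by (intro nn_integral_cong) (auto simp: indicator_def)
    also have "\<dots> = ennreal (V R)"
      unfolding V_def set_lebesgue_integral_def real_scaleR_def
      using intv[OF that] less_imp_le[OF v(2)] by (intro nn_integral_eq_integral) (auto simp: set_integrable_def)
    finally show ?thesis .
  qed
  have VG: "(\<Sum>R\<in>G. V R) \<le> \<theta> * V Q"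
  proof -
    have "(\<Sum>R\<in>G. V R) \<le> V (\<Union>G)"
      unfolding V_def using fin disj Gm UG intv less_imp_le[OF v(2)]
      by (intro sum_set_integral_disjoint_le) auto
    also have "\<dots> \<le> \<theta> * V Q"
      unfolding V_def \<theta> by (rule half_mass_complement[OF Qg v(3)[OF Qg] v(2) half[OF Qg] \<kappa> UG(2,1) halfG])
    finally show ?thesis .
  qed
  define h where "h x = exp (c * \<bar>\<beta> N x - bQ\<bar>)" for x
  note v(1) [measurable]
  have hm [measurable]: "h \<in> borel_measurable borel" unfolding h_def[abs_def] \<beta>_def by measurable
  have hv0: "0 \<le> h x * v x" for x using v(2)[of x] by (simp add: h_def less_imp_le)
  have R_bound: "(\<integral>\<^sup>+x\<in>R. ennreal (h x * v x) \<partial>lborel) \<le> ennreal (exp (c * L) * C * V R)" if R: "R \<in> G" for R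
  proof -
    from R obtain x where x: "x \<in> Q" "stopped x" "R = S x" by (auto simp: G_def)
    define j where "j = J x"
    have j: "0 < j" "j \<le> N" using Jpos[OF x(1,2)] J(2)[OF x(2)] by (simp_all add: j_def)
    have Rc: "R = cell u (k + int j) x" by (simp add: x(3) S_def j_def)
    have "\<bar>cell_avg R b - bQ\<bar> \<le> L"
    proof -
      have "\<bar>\<beta> (j - 1) x - bQ\<bar> \<le> l" using j by (intro J(3)[OF x(2)]) (simp add: j_def)
      moreover have "\<bar>cell_avg R b - \<beta> (j - 1) x\<bar> \<le> 2 ^ CARD('n) * B"
        using cell_avg_child_le[OF b(1), of u "k + int (j - 1)" x] j unfolding Rc \<beta>_def
        by (simp add: of_nat_diff)
      ultimately show ?thesis unfolding L_def l_def by linarith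
    qed
    then have "h z \<le> exp (c * L) * exp (c * \<bar>\<beta> N z - cell_avg R b\<bar>)" for z
      unfolding h_def using c by (intro exp_abs_triangle) auto
    then have le: "h z * v z \<le> exp (c * L) * (exp (c * \<bar>\<beta> N z - cell_avg R b\<bar>) * v z)" for z
      using v(2)[of z] by (simp add: mult.assoc[symmetric] mult_right_mono)
    have "(\<integral>\<^sup>+x\<in>R. ennreal (h x * v x) \<partial>lborel)
      \<le> (\<integral>\<^sup>+z. ennreal (exp (c * L)) * (ennreal (exp (c * \<bar>\<beta> N z - cell_avg R b\<bar>) * v z) * indicator R z) \<partial>lborel)"
    proof (rule nn_integral_mono)
      fix z
      have "ennreal (h z * v z) \<le> ennreal (exp (c * L)) * ennreal (exp (c * \<bar>\<beta> N z - cell_avg R b\<bar>) * v z)"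
        using le[of z] v(2)[of z] by (simp add: ennreal_mult[symmetric] ennreal_leI)
      then show "ennreal (h z * v z) * indicator R z \<le>
        ennreal (exp (c * L)) * (ennreal (exp (c * \<bar>\<beta> N z - cell_avg R b\<bar>) * v z) * indicator R z)"
        by (simp add: indicator_def)
    qed
    also have "\<dots> = ennreal (exp (c * L)) * (\<integral>\<^sup>+z\<in>R. ennreal (exp (c * \<bar>\<beta> N z - cell_avg R b\<bar>) * v z) \<partial>lborel)"
    proof -
      have [measurable]: "R \<in> sets borel" using Gm(1)[OF R] .
      show ?thesis unfolding \<beta>_def by (intro nn_integral_cmult) measurable
    qed
    also have "\<dots> \<le> ennreal (exp (c * L)) * ennreal (C * V R)"
    proof (rule mult_left_mono)
      have "k + int N = k + int j + int (N - j)" using j by simp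
      then show "(\<integral>\<^sup>+z\<in>R. ennreal (exp (c * \<bar>\<beta> N z - cell_avg R b\<bar>) * v z) \<partial>lborel) \<le> ennreal (C * V R)"
        using less[of "N - j" "k + int j" x] j unfolding Rc \<beta>_def V_def by simp
    qed simp
    also have "\<dots> = ennreal (exp (c * L) * C * V R)" using C V0 by (simp add: ennreal_mult[symmetric] mult.assoc)
    finally show ?thesis .
  qed
  have off: "h x \<le> exp (c * l)" if "x \<in> Q - \<Union>G" for x
  proof -
    have "\<not> stopped x" using that by (auto simp: G_def S_def)
    then have "\<bar>\<beta> N x - bQ\<bar> \<le> l" by (auto simp: stopped_def not_less)
    then show ?thesis using c by (simp add: h_def)
  qed
  have "(\<integral>\<^sup>+x\<in>Q. ennreal (h x * v x) \<partial>lborel)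
    \<le> (\<integral>\<^sup>+x. ennreal (exp (c * l)) * (ennreal (v x) * indicator Q x) + (\<Sum>R\<in>G. ennreal (h x * v x) * indicator R x) \<partial>lborel)"
  proof (rule nn_integral_mono)
    fix x
    show "ennreal (h x * v x) * indicator Q x \<le> ennreal (exp (c * l)) * (ennreal (v x) * indicator Q x) + (\<Sum>R\<in>G. ennreal (h x * v x) * indicator R x)"
    proof (cases "x \<in> \<Union>G")
      case True
      then obtain R where R: "R \<in> G" "x \<in> R" by auto
      have "ennreal (h x * v x) * indicator Q x \<le> ennreal (h x * v x) * indicator R x"
        using R by (simp add: indicator_def)
      also have "\<dots> \<le> (\<Sum>R\<in>G. ennreal (h x * v x) * indicator R x)" using R fin by (intro member_le_sum) auto
      finally show ?thesis by (rule add_increasing[OF zero_le])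
    next
      case False
      have "ennreal (h x * v x) * indicator Q x \<le> ennreal (exp (c * l)) * (ennreal (v x) * indicator Q x)"
      proof (cases "x \<in> Q")
        case True
        have "h x * v x \<le> exp (c * l) * v x" using off[of x] True False v(2)[of x] by (intro mult_right_mono) auto
        then show ?thesis using True v(2)[of x] by (simp add: ennreal_mult[symmetric] ennreal_leI)
      qed simp
      then show ?thesis by (rule add_increasing2[OF zero_le])
    qed
  qed
  also have "\<dots> = ennreal (exp (c * l)) * (\<integral>\<^sup>+x\<in>Q. ennreal (v x) \<partial>lborel) + (\<Sum>R\<in>G. \<integral>\<^sup>+x\<in>R. ennreal (h x * v x) \<partial>lborel)"
  proof -
    have [measurable]: "Q \<in> sets borel" using grid_fmeasurable(1)[OF Qg] .
    have m: "(\<lambda>x. ennreal (h x * v x) * indicator R x) \<in> borel_measurable lborel" if "R \<in> G" for R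
      using Gm(1)[OF that] by measurable
    show ?thesis
      by (subst nn_integral_add[OF _ borel_measurable_sum[OF m]], measurable)
        (simp add: nn_integral_cmult nn_integral_sum[OF m])
  qed
  also have "\<dots> \<le> ennreal (exp (c * l)) * ennreal (V Q) + (\<Sum>R\<in>G. ennreal (exp (c * L) * C * V R))"
    using R_bound nnV[of Q] grid_fmeasurable(1)[OF Qg] by (intro add_mono mult_left_mono sum_mono) auto
  also have "\<dots> = ennreal (exp (c * l) * V Q + exp (c * L) * C * (\<Sum>R\<in>G. V R))"
    using C V0 by (subst sum_ennreal) (auto simp: ennreal_mult[symmetric] sum_nonneg sum_distrib_left)
  also have "\<dots> \<le> ennreal (C * V Q)"
  proof (rule ennreal_leI)
    have "exp (c * L) * C * (\<Sum>R\<in>G. V R) \<le> exp (c * L) * C * (\<theta> * V Q)"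
      using VG C by (intro mult_left_mono) auto
    then have "exp (c * l) * V Q + exp (c * L) * C * (\<Sum>R\<in>G. V R) \<le> (exp (c * l) + exp (c * L) * C * \<theta>) * V Q"
      by (simp add: algebra_simps)
    also have "\<dots> \<le> C * V Q" using absorb V0 unfolding l_def L_def by (intro mult_right_mono) auto
    finally show "exp (c * l) * V Q + exp (c * L) * C * (\<Sum>R\<in>G. V R) \<le> C * V Q" .
  qed
  finally show ?case by (simp add: h_def \<beta>_def bQ_def Q_def V_def)
qed

section \<open>Convergence of dyadic averages\<close>

text \<open>
  The function is first clipped to a bounded one. A measurable function is the limit almost everywhere of continuous functions; clipping
  these as well makes the convergence dominated.
\<close>
lemma set_lborel_L1_continuous_approx:
  fixes b :: "'a::euclidean_space \<Rightarrow> real"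
  assumes b: "b \<in> borel_measurable borel" "set_integrable lborel Q b" and Q: "Q \<in> sets borel" "emeasure lborel Q < \<infinity>" and e: "0 < e"
  shows "\<exists>g M. continuous_on UNIV g \<and> (\<forall>x. \<bar>g x\<bar> \<le> M) \<and> (LINT x:Q|lborel. \<bar>b x - g x\<bar>) < e"
proof -
  note b(1) [measurable] Q(1) [measurable]
  define clip where "clip M t = max (- M) (min M t)" for M t :: real
  have clip_le: "\<bar>clip M t\<bar> \<le> M" if "0 \<le> M" for M t using that by (auto simp: clip_def)
  have clip_le': "\<bar>clip M t\<bar> \<le> \<bar>t\<bar>" if "0 \<le> M" for M t using that by (auto simp: clip_def)
  have clip_cont: "continuous_on UNIV (clip M)" for M unfolding clip_def by (intro continuous_intros)
  have [measurable]: "(\<lambda>x. clip M (f x)) \<in> borel_measurable N" if "f \<in> borel_measurable N" for f :: "'a \<Rightarrow> real" and M N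
    using that unfolding clip_def by measurable
  have intb: "integrable lborel (\<lambda>x. indicator Q x * b x)" using b(2) by (simp add: set_integrable_def)
  have "(\<lambda>n. LINT x|lborel. indicator Q x * \<bar>b x - clip (real n) (b x)\<bar>) \<longlonglongrightarrow> (LINT x|(lborel :: 'a measure). (0 :: real))"
  proof (rule Bochner_Integration.integral_dominated_convergence)
    show "integrable lborel (\<lambda>x. 2 * \<bar>indicator Q x * b x\<bar>)" using intb by simp
    show "AE x in lborel. (\<lambda>n. indicator Q x * \<bar>b x - clip (real n) (b x)\<bar>) \<longlonglongrightarrow> 0"
    proof (intro AE_I2)
      fix x
      obtain N where N: "\<bar>b x\<bar> \<le> real N" using real_arch_simple by blast
      have "\<forall>\<^sub>F n in sequentially. indicator Q x * \<bar>b x - clip (real n) (b x)\<bar> = 0"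
        using eventually_ge_at_top[of N]
      proof (rule eventually_mono)
        fix n assume "N \<le> n"
        then have "real N \<le> real n" by simp
        then show "indicator Q x * \<bar>b x - clip (real n) (b x)\<bar> = 0" using N by (auto simp: clip_def)
      qed
      then show "(\<lambda>n. indicator Q x * \<bar>b x - clip (real n) (b x)\<bar>) \<longlonglongrightarrow> 0" by (rule tendsto_eventually)
    qed
    show "AE x in lborel. norm (indicator Q x * \<bar>b x - clip (real n) (b x)\<bar>) \<le> 2 * \<bar>indicator Q x * b x\<bar>" for n
    proof (intro AE_I2)
      fix x
      have "\<bar>b x - clip (real n) (b x)\<bar> \<le> 2 * \<bar>b x\<bar>" using clip_le'[of "real n" "b x"] by linarith
      then show "norm (indicator Q x * \<bar>b x - clip (real n) (b x)\<bar>) \<le> 2 * \<bar>indicator Q x * b x\<bar>" by (simp add: indicator_def)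
    qed
  qed measurable
  then have "(\<lambda>n. LINT x|lborel. indicator Q x * \<bar>b x - clip (real n) (b x)\<bar>) \<longlonglongrightarrow> 0" by simp
  then have "\<forall>\<^sub>F n in sequentially. (LINT x|lborel. indicator Q x * \<bar>b x - clip (real n) (b x)\<bar>) < e / 2"
    using e by (intro order_tendstoD) auto
  then obtain n where n: "(LINT x|lborel. indicator Q x * \<bar>b x - clip (real n) (b x)\<bar>) < e / 2"
    using eventually_happens trivial_limit_sequentially by blast
  define M where "M = real n"
  have M: "0 \<le> M" by (simp add: M_def)
  have "b \<in> borel_measurable (lebesgue_on UNIV)" using b(1) by (simp add: lebesgue_on_UNIV_eq measurable_completion)
  then have "b measurable_on UNIV" by (intro lebesgue_measurable_imp_measurable_on) (auto simp: lebesgue_on_UNIV_eq)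
  then obtain Z G where Z: "negligible Z" and G: "\<And>k. continuous_on UNIV (G k)" "\<And>x. x \<notin> Z \<Longrightarrow> (\<lambda>k. G k x) \<longlonglongrightarrow> b x"
    unfolding measurable_on_def by auto
  have Gm [measurable]: "G k \<in> borel_measurable borel" for k using G(1) by (rule borel_measurable_continuous_onI)
  have AEZ: "AE x in lborel. x \<notin> Z"
    using Z unfolding negligible_iff_null_sets by (metis AE_completion_iff AE_not_in)
  have "(\<lambda>k. LINT x|lborel. indicator Q x * \<bar>clip M (b x) - clip M (G k x)\<bar>) \<longlonglongrightarrow> (LINT x|(lborel :: 'a measure). (0 :: real))"
  proof (rule Bochner_Integration.integral_dominated_convergence)
    show "integrable lborel (\<lambda>x. 2 * M * indicator Q x)" using Q by simp
    show "AE x in lborel. (\<lambda>k. indicator Q x * \<bar>clip M (b x) - clip M (G k x)\<bar>) \<longlonglongrightarrow> 0"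
      using AEZ
    proof (rule eventually_mono)
      fix x assume "x \<notin> Z"
      then have "(\<lambda>k. clip M (G k x)) \<longlonglongrightarrow> clip M (b x)"
        using G(2) continuous_on_tendsto_compose[OF clip_cont[of M]] by auto
      then have "(\<lambda>k. indicator Q x * \<bar>clip M (b x) - clip M (G k x)\<bar>) \<longlonglongrightarrow> indicator Q x * \<bar>clip M (b x) - clip M (b x)\<bar>"
        by (intro tendsto_intros)
      then show "(\<lambda>k. indicator Q x * \<bar>clip M (b x) - clip M (G k x)\<bar>) \<longlonglongrightarrow> 0" by simp
    qed
    show "AE x in lborel. norm (indicator Q x * \<bar>clip M (b x) - clip M (G k x)\<bar>) \<le> 2 * M * indicator Q x" for k
    proof (intro AE_I2)
      fix x
      have "\<bar>clip M (b x) - clip M (G k x)\<bar> \<le> 2 * M" using clip_le[OF M, of "b x"] clip_le[OF M, of "G k x"] by linarith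
      then show "norm (indicator Q x * \<bar>clip M (b x) - clip M (G k x)\<bar>) \<le> 2 * M * indicator Q x" by (simp add: indicator_def)
    qed
  qed measurable
  then have "(\<lambda>k. LINT x|lborel. indicator Q x * \<bar>clip M (b x) - clip M (G k x)\<bar>) \<longlonglongrightarrow> 0" by simp
  then have "\<forall>\<^sub>F k in sequentially. (LINT x|lborel. indicator Q x * \<bar>clip M (b x) - clip M (G k x)\<bar>) < e / 2"
    using e by (intro order_tendstoD) auto
  then obtain k where k: "(LINT x|lborel. indicator Q x * \<bar>clip M (b x) - clip M (G k x)\<bar>) < e / 2"
    using eventually_happens trivial_limit_sequentially by blast
  define g where "g x = clip M (G k x)" for x
  have gm [measurable]: "g \<in> borel_measurable borel" unfolding g_def[abs_def] by measurable
  have intM: "integrable lborel (\<lambda>x. indicator Q x * f x)" if f: "f \<in> borel_measurable borel" "\<And>x. \<bar>f x\<bar> \<le> c" for f :: "'a \<Rightarrow> real" and c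
  proof (rule Bochner_Integration.integrable_bound)
    show "integrable lborel (\<lambda>x. c * indicator Q x)" using Q by simp
    show "(\<lambda>x. indicator Q x * f x) \<in> borel_measurable lborel" using f(1) by measurable
    show "AE x in lborel. norm (indicator Q x * f x) \<le> norm (c * indicator Q x)"
    proof (intro AE_I2)
      fix x
      have "\<bar>f x\<bar> \<le> \<bar>c\<bar>" using f(2)[of x] by linarith
      then show "norm (indicator Q x * f x) \<le> norm (c * indicator Q x)" by (simp add: indicator_def)
    qed
  qed
  have i2: "integrable lborel (\<lambda>x. indicator Q x * \<bar>clip M (b x) - g x\<bar>)"
  proof (rule intM[where c = "2 * M"])
    show "\<bar>\<bar>clip M (b x) - g x\<bar>\<bar> \<le> 2 * M" for x using clip_le[OF M, of "b x"] clip_le[OF M, of "G k x"] unfolding g_def by linarith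
  qed measurable
  have i1: "integrable lborel (\<lambda>x. indicator Q x * \<bar>b x - clip M (b x)\<bar>)"
  proof (rule Bochner_Integration.integrable_bound)
    show "integrable lborel (\<lambda>x. 2 * \<bar>indicator Q x * b x\<bar>)" using intb by simp
    show "AE x in lborel. norm (indicator Q x * \<bar>b x - clip M (b x)\<bar>) \<le> norm (2 * \<bar>indicator Q x * b x\<bar>)"
    proof (intro AE_I2)
      fix x
      have "\<bar>b x - clip M (b x)\<bar> \<le> 2 * \<bar>b x\<bar>" using clip_le'[OF M, of "b x"] by linarith
      then show "norm (indicator Q x * \<bar>b x - clip M (b x)\<bar>) \<le> norm (2 * \<bar>indicator Q x * b x\<bar>)" by (simp add: indicator_def)
    qed
  qed measurable
  have "(LINT x:Q|lborel. \<bar>b x - g x\<bar>) \<le> (LINT x|lborel. indicator Q x * \<bar>b x - clip M (b x)\<bar> + indicator Q x * \<bar>clip M (b x) - g x\<bar>)"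
    unfolding set_lebesgue_integral_def
  proof (rule integral_mono_AE')
    show "integrable lborel (\<lambda>x. indicator Q x * \<bar>b x - clip M (b x)\<bar> + indicator Q x * \<bar>clip M (b x) - g x\<bar>)" using i1 i2 by simp
    show "AE x in lborel. indicator Q x *\<^sub>R \<bar>b x - g x\<bar> \<le> indicator Q x * \<bar>b x - clip M (b x)\<bar> + indicator Q x * \<bar>clip M (b x) - g x\<bar>"
      by (intro AE_I2) (auto simp: indicator_def)
    show "AE x in lborel. 0 \<le> indicator Q x * \<bar>b x - clip M (b x)\<bar> + indicator Q x * \<bar>clip M (b x) - g x\<bar>" by simp
  qed
  also have "\<dots> = (LINT x|lborel. indicator Q x * \<bar>b x - clip M (b x)\<bar>) + (LINT x|lborel. indicator Q x * \<bar>clip M (b x) - g x\<bar>)"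
    using i1 i2 by (rule Bochner_Integration.integral_add)
  also have "\<dots> < e" using n k unfolding M_def[symmetric] g_def by linarith
  finally have "(LINT x:Q|lborel. \<bar>b x - g x\<bar>) < e" .
  moreover have "continuous_on UNIV g" unfolding g_def
    using continuous_on_compose2[OF clip_cont[of M] G(1)[of k]] by simp
  moreover have "\<bar>g x\<bar> \<le> M" for x unfolding g_def using M by (rule clip_le)
  ultimately show ?thesis by blast
qed

lemma norm_diff_cell_le:
  fixes u :: "real ^ 'n"
  assumes "x \<in> cell u j z" "y \<in> cell u j z"
  shows "norm (x - y) \<le> CARD('n) * 2 powi (- j)"
proof -
  have "\<bar>(x - y) $ i\<bar> \<le> 2 powi (- j)" for i
    using assms unfolding cell_eq_half_open_cube half_open_cube_def
    by (simp add: abs_le_iff) (smt (verit))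
  then have "(\<Sum>i\<in>UNIV. \<bar>(x - y) $ i\<bar>) \<le> (\<Sum>i\<in>(UNIV :: 'n set). 2 powi (- j))" by (intro sum_mono)
  then show ?thesis using norm_le_l1_cart[of "x - y"] by simp
qed

text \<open>
  Averaging over the cells of level \<open>j\<close> is a contraction of \<open>L^1\<close> on every coarser cell.
\<close>
lemma cell_avg_partition:
  fixes u :: "real ^ 'n" and h :: "real ^ 'n \<Rightarrow> real"
  assumes jk: "k \<le> j" and h: "set_integrable lborel (cell u k y) h"
  shows "set_integrable lborel (cell u k y) (\<lambda>x. cell_avg (cell u j x) h)"
    and "(LINT x:cell u k y|lborel. \<bar>cell_avg (cell u j x) h\<bar>) \<le> (LINT x:cell u k y|lborel. \<bar>h x\<bar>)"
proof -
  define P where "P = {cell u j x | x. x \<in> cell u k y}"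
  have fin: "finite P" unfolding P_def by (rule finite_subcells)
  have Pg: "R \<in> grid u" if "R \<in> P" for R using that by (auto simp: P_def)
  have Psub: "R \<subseteq> cell u k y" if R: "R \<in> P" for R
  proof -
    obtain x where x: "x \<in> cell u k y" "R = cell u j x" using R unfolding P_def by blast
    then show ?thesis using cell_mono[OF jk, of u x] by (simp add: cell_eqI)
  qed
  have disj: "disjoint_family_on (\<lambda>R. R) P"
    unfolding disjoint_family_on_def
  proof (intro ballI impI)
    fix R R' assume R: "R \<in> P" "R' \<in> P" "R \<noteq> R'"
    then obtain x x' where x: "R = cell u j x" "R' = cell u j x'" unfolding P_def by blast
    show "R \<inter> R' = {}"
    proof (rule ccontr)
      assume "R \<inter> R' \<noteq> {}"
      then obtain z where "z \<in> cell u j x" "z \<in> cell u j x'" using x by auto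
      then have "R = R'" unfolding x by (metis cell_eqI)
      with R(3) show False by simp
    qed
  qed
  have eq: "indicator (cell u k y) x * f (cell u j x) = (\<Sum>R\<in>P. indicator R x * f R)" for f :: "(real ^ 'n) set \<Rightarrow> real" and x
  proof (cases "x \<in> cell u k y")
    case True
    then have xP: "cell u j x \<in> P" by (auto simp: P_def)
    have "(\<Sum>R\<in>P. indicator R x * f R) = (\<Sum>R\<in>P. if R = cell u j x then f R else 0)"
    proof (rule sum.cong[OF refl])
      fix R assume "R \<in> P"
      then obtain x' where "R = cell u j x'" unfolding P_def by blast
      then have "x \<in> R \<longleftrightarrow> R = cell u j x" by (auto simp: cell_eq_iff)
      then show "indicator R x * f R = (if R = cell u j x then f R else 0)" by (simp add: indicator_def)
    qed
    then show ?thesis using fin xP True by simp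
  next
    case False
    then have "x \<notin> R" if "R \<in> P" for R using Psub[OF that] by auto
    then show ?thesis using False by (simp add: indicator_def)
  qed
  have intR: "integrable lborel (\<lambda>x. indicator R x * c)" if "R \<in> P" for R and c :: real
    using set_integrable_const_grid[OF Pg[OF that], of c] by (simp add: set_integrable_def)
  show "set_integrable lborel (cell u k y) (\<lambda>x. cell_avg (cell u j x) h)"
    unfolding set_integrable_def real_scaleR_def eq[where f = "\<lambda>R. cell_avg R h"]
    using intR by (intro Bochner_Integration.integrable_sum)
  have "(LINT x:cell u k y|lborel. \<bar>cell_avg (cell u j x) h\<bar>) = (\<Sum>R\<in>P. LINT x|lborel. indicator R x * \<bar>cell_avg R h\<bar>)"
    unfolding set_lebesgue_integral_def real_scaleR_def eq[where f = "\<lambda>R. \<bar>cell_avg R h\<bar>"]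
    using intR by (intro Bochner_Integration.integral_sum)
  also have "\<dots> = (\<Sum>R\<in>P. \<bar>cell_avg R h - 0\<bar> * measure lborel R)"
    using set_integral_const_grid[OF Pg] by (intro sum.cong refl) (simp add: set_lebesgue_integral_def)
  also have "\<dots> \<le> (\<Sum>R\<in>P. LINT x:R|lborel. \<bar>h x - 0\<bar>)"
  proof (rule sum_mono)
    fix R assume R: "R \<in> P"
    have "set_integrable lborel R h"
      using set_integrable_subset[OF h] Psub[OF R] grid_fmeasurable(1)[OF Pg[OF R]] by simp
    then show "\<bar>cell_avg R h - 0\<bar> * measure lborel R \<le> (LINT x:R|lborel. \<bar>h x - 0\<bar>)"
      using Pg[OF R] by (rule cell_avg_diff_le[rotated])
  qed
  also have "\<dots> \<le> (LINT x:cell u k y|lborel. \<bar>h x - 0\<bar>)"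
    using fin disj Psub grid_fmeasurable(1)[OF Pg] set_integrable_abs[OF h]
    by (intro sum_set_integral_disjoint_le) auto
  finally show "(LINT x:cell u k y|lborel. \<bar>cell_avg (cell u j x) h\<bar>) \<le> (LINT x:cell u k y|lborel. \<bar>h x\<bar>)" by simp
qed

text \<open>
  For a continuous function the averages converge uniformly on a cell; the contraction property
  carries the convergence over to \<open>L^1\<close> limits of continuous functions.
\<close>
lemma cell_avg_tendsto_L1:
  fixes u :: "real ^ 'n" and b :: "real ^ 'n \<Rightarrow> real"
  assumes b: "b \<in> borel_measurable borel" "set_integrable lborel (cell u k y) b"
  shows "(\<lambda>N. LINT x:cell u k y|lborel. \<bar>cell_avg (cell u (k + int N) x) b - b x\<bar>) \<longlonglongrightarrow> 0"
proof (rule LIMSEQ_I)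
  fix r :: real assume r: "0 < r"
  define Q where "Q = cell u k y"
  define m where "m = measure lborel Q"
  have Qg: "Q \<in> grid u" by (simp add: Q_def)
  have m: "0 < m" using grid_fmeasurable(3)[OF Qg] by (simp add: m_def)
  have bQ: "set_integrable lborel Q b" using b(2) by (simp add: Q_def)
  from set_lborel_L1_continuous_approx[OF b(1) bQ grid_fmeasurable(1)[OF Qg], of "r / 4"] r
  obtain g M where g: "continuous_on UNIV g" "\<And>x. \<bar>g x\<bar> \<le> M" "(LINT x:Q|lborel. \<bar>b x - g x\<bar>) < r / 4"
    using grid_fmeasurable(2)[OF Qg] by (auto simp: fmeasurable_def)
  have gm [measurable]: "g \<in> borel_measurable borel" using g(1) by (rule borel_measurable_continuous_onI)
  note b(1) [measurable]
  have [measurable]: "Q \<in> sets borel" using grid_fmeasurable(1)[OF Qg] .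
  have intg: "set_integrable lborel R g" if "R \<in> grid u" for R
    unfolding set_integrable_def
  proof (rule Bochner_Integration.integrable_bound)
    show "integrable lborel (\<lambda>x. indicator R x *\<^sub>R M)" using set_integrable_const_grid[OF that, of M] by (simp add: set_integrable_def)
    show "(\<lambda>x. indicator R x *\<^sub>R g x) \<in> borel_measurable lborel" using grid_fmeasurable(1)[OF that] by measurable
    show "AE x in lborel. norm (indicator R x *\<^sub>R g x) \<le> norm (indicator R x *\<^sub>R M)"
    proof (intro AE_I2)
      fix x
      have "\<bar>g x\<bar> \<le> \<bar>M\<bar>" using g(2)[of x] by linarith
      then show "norm (indicator R x *\<^sub>R g x) \<le> norm (indicator R x *\<^sub>R M)" by (simp add: indicator_def)
    qed
  qed
  have "compact (closure Q)"
  proof -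
    have "bounded Q" unfolding Q_def cell_eq_half_open_cube by (rule bounded_subset[OF bounded_cbox half_open_cube_between(2)])
    then show ?thesis by (simp add: compact_closure)
  qed
  then have "uniformly_continuous_on (closure Q) g"
    using g(1) continuous_on_subset by (intro compact_uniformly_continuous) auto
  then obtain d where d: "0 < d" "\<And>x x'. x \<in> closure Q \<Longrightarrow> x' \<in> closure Q \<Longrightarrow> dist x' x < d \<Longrightarrow> dist (g x') (g x) < r / (4 * m)"
    unfolding uniformly_continuous_on_def using r m by (metis divide_pos_pos mult_pos_pos zero_less_numeral)
  have "(\<lambda>N. (CARD('n) * 2 powi (- k)) * (1 / 2) ^ N) \<longlonglongrightarrow> (CARD('n) * 2 powi (- k)) * 0"
    by (intro tendsto_mult tendsto_const LIMSEQ_power_zero) simp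
  then have "\<forall>\<^sub>F N in sequentially. (CARD('n) * 2 powi (- k)) * (1 / 2) ^ N < d"
    using d(1) by (intro order_tendstoD(2)[of _ "(CARD('n) * 2 powi (- k)) * 0"]) auto
  then obtain N0 where N0: "\<And>N. N0 \<le> N \<Longrightarrow> (CARD('n) * 2 powi (- k)) * (1 / 2) ^ N < d"
    unfolding eventually_sequentially by blast
  show "\<exists>N0. \<forall>N\<ge>N0. norm ((LINT x:cell u k y|lborel. \<bar>cell_avg (cell u (k + int N) x) b - b x\<bar>) - 0) < r"
  proof (intro exI[of _ N0] allI impI)
    fix N assume N: "N0 \<le> N"
    define j where "j = k + int N"
    have jk: "k \<le> j" by (simp add: j_def)
    have small: "CARD('n) * 2 powi (- j) < d"
    proof -
      have "(2::real) powi (- j) = 2 powi (- k) * (1 / 2) ^ N"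
        unfolding j_def by (simp add: power_int_diff power_int_minus field_simps power_int_add)
      then show ?thesis using N0[OF N] by (simp add: mult.assoc)
    qed
    have near: "\<bar>cell_avg (cell u j x) g - g x\<bar> \<le> r / (4 * m)" if x: "x \<in> Q" for x
    proof -
      let ?R = "cell u j x"
      have RQ: "?R \<subseteq> Q" using x cell_mono[OF jk, of u x] by (simp add: Q_def cell_eqI)
      have "\<bar>cell_avg ?R g - g x\<bar> * measure lborel ?R \<le> (LINT z:?R|lborel. \<bar>g z - g x\<bar>)"
        by (rule cell_avg_diff_le[OF cell_grid intg[OF cell_grid]])
      also have "\<dots> \<le> (LINT z:?R|lborel. r / (4 * m))"
      proof (rule set_integral_mono)
        show "set_integrable lborel ?R (\<lambda>z. \<bar>g z - g x\<bar>)" by (rule set_integrable_oscillation[OF cell_grid intg[OF cell_grid]])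
        show "set_integrable lborel ?R (\<lambda>z. r / (4 * m))" by (rule set_integrable_const_grid[OF cell_grid])
        fix z assume z: "z \<in> ?R"
        have "norm (z - x) < d" using norm_diff_cell_le[OF z cell_refl] small by linarith
        then have "dist (g z) (g x) < r / (4 * m)"
          using z x RQ closure_subset[of Q] by (intro d(2)) (auto simp: dist_norm)
        then show "\<bar>g z - g x\<bar> \<le> r / (4 * m)" by (simp add: dist_real_def)
      qed
      also have "\<dots> = r / (4 * m) * measure lborel ?R" by (rule set_integral_const_grid[OF cell_grid])
      finally show ?thesis by (rule mult_right_le_imp_le[OF _ measure_cell_pos])
    qed
    define h where "h x = b x - g x" for x
    have inth: "set_integrable lborel Q h" unfolding h_def by (rule set_integral_diff(1)[OF bQ intg[OF Qg]])
    have avg_h: "cell_avg (cell u j x) h = cell_avg (cell u j x) b - cell_avg (cell u j x) g" if x: "x \<in> Q" for x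
    proof -
      have RQ: "cell u j x \<subseteq> Q" using x cell_mono[OF jk, of u x] by (simp add: Q_def cell_eqI)
      have "set_integrable lborel (cell u j x) b" using set_integrable_subset[OF bQ _ RQ] by simp
      then show ?thesis unfolding cell_avg_def h_def using intg[OF cell_grid, of j x]
        by (subst set_integral_diff) (auto simp: diff_divide_distrib)
    qed
    note cp = cell_avg_partition[OF jk inth[unfolded Q_def], folded Q_def]
    have i1: "integrable lborel (\<lambda>x. indicator Q x * \<bar>cell_avg (cell u j x) h\<bar>)"
      using set_integrable_abs[OF cp(1)] by (simp add: set_integrable_def)
    have i2: "integrable lborel (\<lambda>x. indicator Q x * (r / (4 * m)))"
      using set_integrable_const_grid[OF Qg, of "r / (4 * m)"] by (simp add: set_integrable_def)
    have i3: "integrable lborel (\<lambda>x. indicator Q x * \<bar>h x\<bar>)"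
      using set_integrable_abs[OF inth] by (simp add: set_integrable_def)
    have "(LINT x:Q|lborel. \<bar>cell_avg (cell u j x) b - b x\<bar>)
      \<le> (LINT x|lborel. (indicator Q x * \<bar>cell_avg (cell u j x) h\<bar> + indicator Q x * (r / (4 * m))) + indicator Q x * \<bar>h x\<bar>)"
      unfolding set_lebesgue_integral_def
    proof (rule integral_mono_AE')
      show "integrable lborel (\<lambda>x. (indicator Q x * \<bar>cell_avg (cell u j x) h\<bar> + indicator Q x * (r / (4 * m))) + indicator Q x * \<bar>h x\<bar>)"
        by (intro Bochner_Integration.integrable_add i1 i2 i3)
      show "AE x in lborel. indicator Q x *\<^sub>R \<bar>cell_avg (cell u j x) b - b x\<bar>
        \<le> (indicator Q x * \<bar>cell_avg (cell u j x) h\<bar> + indicator Q x * (r / (4 * m))) + indicator Q x * \<bar>h x\<bar>"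
      proof (intro AE_I2)
        fix x
        show "indicator Q x *\<^sub>R \<bar>cell_avg (cell u j x) b - b x\<bar>
          \<le> (indicator Q x * \<bar>cell_avg (cell u j x) h\<bar> + indicator Q x * (r / (4 * m))) + indicator Q x * \<bar>h x\<bar>"
        proof (cases "x \<in> Q")
          case True
          have "\<bar>cell_avg (cell u j x) b - b x\<bar> \<le> \<bar>cell_avg (cell u j x) h\<bar> + r / (4 * m) + \<bar>h x\<bar>"
            using near[OF True] avg_h[OF True] h_def[of x] by linarith
          then show ?thesis using True by simp
        qed simp
      qed
      show "AE x in lborel. 0 \<le> (indicator Q x * \<bar>cell_avg (cell u j x) h\<bar> + indicator Q x * (r / (4 * m))) + indicator Q x * \<bar>h x\<bar>"
        using r m by (intro AE_I2) simp
    qed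
    also have "\<dots> = (LINT x:Q|lborel. \<bar>cell_avg (cell u j x) h\<bar>) + r / (4 * m) * m + (LINT x:Q|lborel. \<bar>h x\<bar>)"
      using i1 i2 i3 set_integral_const_grid[OF Qg, of "r / (4 * m)"]
      by (subst Bochner_Integration.integral_add, simp, simp, subst Bochner_Integration.integral_add)
        (simp_all add: set_lebesgue_integral_def m_def)
    also have "\<dots> \<le> (LINT x:Q|lborel. \<bar>h x\<bar>) + r / 4 + (LINT x:Q|lborel. \<bar>h x\<bar>)"
      using cp(2) m by simp
    also have "\<dots> < r" using g(3) r by (simp add: h_def)
    finally have "(LINT x:Q|lborel. \<bar>cell_avg (cell u j x) b - b x\<bar>) < r" .
    moreover have "0 \<le> (LINT x:Q|lborel. \<bar>cell_avg (cell u j x) b - b x\<bar>)"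
      unfolding set_lebesgue_integral_def by (rule Bochner_Integration.integral_nonneg) simp
    ultimately show "norm ((LINT x:cell u k y|lborel. \<bar>cell_avg (cell u (k + int N) x) b - b x\<bar>) - 0) < r"
      by (simp add: Q_def j_def)
  qed
qed

section \<open>Exponentials of BMO functions and weights\<close>

text \<open>
  The averages of \<open>b\<close> over shrinking cells converge to \<open>b\<close> in \<open>L^1\<close>, hence almost everywhere along a subsequence,
  and the lemma of Fatou removes the discretisation from \<open>john_nirenberg_discrete\<close>.
\<close>
lemma weighted_john_nirenberg:
  fixes \<kappa> B :: real
  assumes \<kappa>: "0 \<le> \<kappa>" and B: "0 < B"
  shows "\<exists>c>0. \<exists>C\<ge>0. \<forall>u (v :: real ^ 'n \<Rightarrow> real) b Q.
    bmo_cells B b \<longrightarrow> A_infinity_cells \<kappa> v \<longrightarrow> Q \<in> grid u \<longrightarrow>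
    (\<integral>\<^sup>+x\<in>Q. ennreal (exp (c * \<bar>b x - cell_avg Q b\<bar>) * v x) \<partial>lborel) \<le> ennreal (C * (LINT x:Q|lborel. v x))"
proof -
  define \<theta> where "\<theta> = 1 - 1 / (\<kappa> + 1)"
  have \<theta>: "0 \<le> \<theta>" "\<theta> < 1" using \<kappa> by (auto simp: \<theta>_def field_simps)
  define L where "L = 2 * B + 2 ^ CARD('n) * B"
  have L: "0 < L" using B by (simp add: L_def add_pos_pos)
  \<comment> \<open>then \<open>exp (c L) \<theta> = 2 \<theta> / (1 + \<theta>)\<close>, which is at most \<open>(1 + \<theta>) / 2\<close> and leaves room for absorption\<close>
  define c where "c = ln (2 / (1 + \<theta>)) / L"
  have "0 < ln (2 / (1 + \<theta>))" using \<theta> by (intro ln_gt_zero) (simp add: field_simps)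
  then have c: "0 < c" using L by (simp add: c_def)
  define C where "C = exp (c * (2 * B)) * 2 / (1 - \<theta>)"
  have C: "0 \<le> C" using \<theta> by (simp add: C_def)
  have "exp (c * L) = 2 / (1 + \<theta>)" using L \<theta> by (simp add: c_def)
  moreover have "2 / (1 + \<theta>) * \<theta> \<le> (1 + \<theta>) / 2"
  proof -
    have "0 \<le> (1 - \<theta>) * (1 - \<theta>)" by simp
    then have "4 * \<theta> \<le> (1 + \<theta>) * (1 + \<theta>)" by (simp add: algebra_simps)
    then show ?thesis using \<theta> by (simp add: field_simps)
  qed
  ultimately have "exp (c * L) * \<theta> \<le> (1 + \<theta>) / 2" by simp
  then have "C * (exp (c * L) * \<theta>) \<le> C * ((1 + \<theta>) / 2)" using C by (rule mult_left_mono)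
  moreover have "exp (c * (2 * B)) = C * ((1 - \<theta>) / 2)" using \<theta> by (simp add: C_def)
  ultimately have absorb: "exp (c * (2 * B)) + exp (c * (2 * B + 2 ^ CARD('n) * B)) * C * \<theta> \<le> C"
    unfolding L_def[symmetric] by (simp add: algebra_simps)
  have "(\<integral>\<^sup>+x\<in>Q. ennreal (exp (c * \<bar>b x - cell_avg Q b\<bar>) * v x) \<partial>lborel) \<le> ennreal (C * (LINT x:Q|lborel. v x))"
    if b: "bmo_cells B b" and A_inf: "A_infinity_cells \<kappa> v" and Q: "Q \<in> grid u"
    for u and v b :: "real ^ 'n \<Rightarrow> real" and Q
  proof -
    obtain k y where Qc: "Q = cell u k y" using Q by (auto simp: grid_def)
    note bm [measurable] = bmo_cellsD(1)[OF b]
    note [measurable] = A_infinity_cellsD(1)[OF A_inf]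
    have [measurable]: "Q \<in> sets borel" using grid_fmeasurable(1)[OF Q] .
    define \<beta> where "\<beta> N x = cell_avg (cell u (k + int N) x) b" for N x
    have \<beta>m [measurable]: "(\<lambda>x. \<beta> N x) \<in> borel_measurable borel" for N unfolding \<beta>_def by measurable
    have bound: "(\<integral>\<^sup>+x\<in>Q. ennreal (exp (c * \<bar>\<beta> N x - cell_avg Q b\<bar>) * v x) \<partial>lborel) \<le> ennreal (C * (LINT x:Q|lborel. v x))" for N
      unfolding Qc \<beta>_def by (rule john_nirenberg_discrete[OF b B A_inf \<kappa> \<theta>_def c C absorb])
    have intb: "set_integrable lborel Q b" using bmo_cellsD(2)[OF b Q] .
    define d where "d N x = indicator Q x * (\<beta> N x - b x)" for N x
    have "\<exists>r::nat \<Rightarrow> nat. strict_mono r \<and> (AE x in lborel. (\<lambda>n. d (r n) x) \<longlonglongrightarrow> 0)"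
    proof (rule tendsto_L1_AE_subseq)
      show "integrable lborel (d N)" for N
      proof -
        have "set_integrable lborel Q (\<lambda>x. \<beta> N x - b x)"
          unfolding \<beta>_def Qc using intb[unfolded Qc]
          by (intro set_integral_diff(1) cell_avg_partition(1)) auto
        then show ?thesis by (simp add: d_def[abs_def] set_integrable_def)
      qed
      show "(\<lambda>N. LINT x|lborel. norm (d N x)) \<longlonglongrightarrow> 0"
        using cell_avg_tendsto_L1[OF bm intb[unfolded Qc]]
        by (simp add: d_def set_lebesgue_integral_def abs_mult Qc \<beta>_def)
    qed
    then obtain r :: "nat \<Rightarrow> nat" where r: "AE x in lborel. (\<lambda>n. d (r n) x) \<longlonglongrightarrow> 0" by blast
    define h where "h t x = ennreal (exp (c * \<bar>t - cell_avg Q b\<bar>) * v x) * indicator Q x" for t x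
    have [measurable]: "(\<lambda>x. h (\<beta> N x) x) \<in> borel_measurable lborel" for N unfolding h_def by measurable
    have "(\<integral>\<^sup>+x. h (b x) x \<partial>lborel) = (\<integral>\<^sup>+x. liminf (\<lambda>n. h (\<beta> (r n) x) x) \<partial>lborel)"
    proof (rule nn_integral_cong_AE)
      show "AE x in lborel. h (b x) x = liminf (\<lambda>n. h (\<beta> (r n) x) x)"
        using r
      proof (rule eventually_mono)
        fix x assume lim: "(\<lambda>n. d (r n) x) \<longlonglongrightarrow> 0"
        have "(\<lambda>n. h (\<beta> (r n) x) x) \<longlonglongrightarrow> h (b x) x"
        proof (cases "x \<in> Q")
          case True
          then have "(\<lambda>n. \<beta> (r n) x - b x) \<longlonglongrightarrow> 0" using lim by (simp add: d_def)
          then have "(\<lambda>n. \<beta> (r n) x) \<longlonglongrightarrow> b x" by (simp add: LIM_zero_iff)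
          then have "(\<lambda>n. exp (c * \<bar>\<beta> (r n) x - cell_avg Q b\<bar>) * v x) \<longlonglongrightarrow> exp (c * \<bar>b x - cell_avg Q b\<bar>) * v x"
            by (intro tendsto_intros)
          then show ?thesis using True by (simp add: h_def)
        qed (simp add: h_def)
        then show "h (b x) x = liminf (\<lambda>n. h (\<beta> (r n) x) x)"
          using lim_imp_Liminf[OF trivial_limit_sequentially] by metis
      qed
    qed
    also have "\<dots> \<le> liminf (\<lambda>n. \<integral>\<^sup>+x. h (\<beta> (r n) x) x \<partial>lborel)"
      by (rule nn_integral_liminf) measurable
    also have "\<dots> \<le> limsup (\<lambda>n. \<integral>\<^sup>+x. h (\<beta> (r n) x) x \<partial>lborel)"
      by (rule Liminf_le_Limsup) simp
    also have "\<dots> \<le> ennreal (C * (LINT x:Q|lborel. v x))"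
      using bound by (intro Limsup_bounded always_eventually) (simp add: h_def)
    finally show ?thesis by (simp add: h_def)
  qed
  note * = this
  show ?thesis
    by (rule exI[of _ c], rule conjI[OF c], rule exI[of _ C], rule conjI[OF C]) (intro allI impI, rule *)
qed

text \<open>
  The John-Nirenberg inequality allows \<open>b\<close> to be replaced on \<open>Q\<close> by its average in the exponent.
\<close>
lemma exp_perturbed_integral:
  fixes v b :: "real ^ 'n \<Rightarrow> real"
  assumes [measurable]: "v \<in> borel_measurable borel" "b \<in> borel_measurable borel" and v: "\<And>x. 0 < v x"
    and Q: "Q \<in> grid u" and s: "\<bar>s\<bar> \<le> c" and C: "0 \<le> C"
    and JN: "(\<integral>\<^sup>+x\<in>Q. ennreal (exp (c * \<bar>b x - cell_avg Q b\<bar>) * v x) \<partial>lborel) \<le> ennreal (C * (LINT x:Q|lborel. v x))"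
  shows "set_integrable lborel Q (\<lambda>x. v x * exp (s * b x))"
    and "(LINT x:Q|lborel. v x * exp (s * b x)) \<le> exp (s * cell_avg Q b) * (C * (LINT x:Q|lborel. v x))"
proof -
  have [measurable]: "Q \<in> sets borel" using grid_fmeasurable(1)[OF Q] .
  have V0: "0 \<le> (LINT x:Q|lborel. v x)" unfolding set_lebesgue_integral_def
    using less_imp_le[OF v] by (intro Bochner_Integration.integral_nonneg) simp
  have le: "v x * exp (s * b x) \<le> exp (s * cell_avg Q b) * (exp (c * \<bar>b x - cell_avg Q b\<bar>) * v x)" for x
  proof -
    have "s * (b x - cell_avg Q b) \<le> \<bar>s\<bar> * \<bar>b x - cell_avg Q b\<bar>" by (metis abs_ge_self abs_mult)
    also have "\<dots> \<le> c * \<bar>b x - cell_avg Q b\<bar>" using s by (rule mult_right_mono) simp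
    finally have "exp (s * b x) \<le> exp (s * cell_avg Q b + c * \<bar>b x - cell_avg Q b\<bar>)" by (simp add: algebra_simps)
    then have "v x * exp (s * b x) \<le> v x * (exp (s * cell_avg Q b) * exp (c * \<bar>b x - cell_avg Q b\<bar>))"
      using v[of x] by (intro mult_left_mono) (auto simp: exp_add)
    then show ?thesis by (simp only: mult_ac)
  qed
  have "(\<integral>\<^sup>+x. ennreal (indicator Q x * (v x * exp (s * b x))) \<partial>lborel)
    \<le> (\<integral>\<^sup>+x. ennreal (exp (s * cell_avg Q b)) * (ennreal (exp (c * \<bar>b x - cell_avg Q b\<bar>) * v x) * indicator Q x) \<partial>lborel)"
  proof (rule nn_integral_mono)
    fix x
    have "ennreal (v x * exp (s * b x)) \<le> ennreal (exp (s * cell_avg Q b)) * ennreal (exp (c * \<bar>b x - cell_avg Q b\<bar>) * v x)"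
      using le[of x] v[of x] by (simp add: ennreal_mult[symmetric] ennreal_leI)
    then show "ennreal (indicator Q x * (v x * exp (s * b x)))
      \<le> ennreal (exp (s * cell_avg Q b)) * (ennreal (exp (c * \<bar>b x - cell_avg Q b\<bar>) * v x) * indicator Q x)"
      by (simp add: indicator_def)
  qed
  also have "\<dots> = ennreal (exp (s * cell_avg Q b)) * (\<integral>\<^sup>+x\<in>Q. ennreal (exp (c * \<bar>b x - cell_avg Q b\<bar>) * v x) \<partial>lborel)"
    by (rule nn_integral_cmult) measurable
  also have "\<dots> \<le> ennreal (exp (s * cell_avg Q b)) * ennreal (C * (LINT x:Q|lborel. v x))"
    using JN by (rule mult_left_mono) simp
  also have "\<dots> = ennreal (exp (s * cell_avg Q b) * (C * (LINT x:Q|lborel. v x)))"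
    using C V0 by (simp add: ennreal_mult)
  finally have nn: "(\<integral>\<^sup>+x. ennreal (indicator Q x * (v x * exp (s * b x))) \<partial>lborel)
    \<le> ennreal (exp (s * cell_avg Q b) * (C * (LINT x:Q|lborel. v x)))" .
  have pos: "0 \<le> indicator Q x * (v x * exp (s * b x))" for x using v[of x] by (simp add: less_imp_le)
  have int: "integrable lborel (\<lambda>x. indicator Q x * (v x * exp (s * b x)))"
  proof (rule integrableI_nonneg)
    show "(\<integral>\<^sup>+x. ennreal (indicator Q x * (v x * exp (s * b x))) \<partial>lborel) < \<infinity>"
      using nn by (rule order.strict_trans1) simp
  qed (use pos in auto)
  then show "set_integrable lborel Q (\<lambda>x. v x * exp (s * b x))" by (simp add: set_integrable_def)
  have "ennreal (LINT x|lborel. indicator Q x * (v x * exp (s * b x))) \<le> ennreal (exp (s * cell_avg Q b) * (C * (LINT x:Q|lborel. v x)))"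
    using nn nn_integral_eq_integral[OF int] pos by simp
  then show "(LINT x:Q|lborel. v x * exp (s * b x)) \<le> exp (s * cell_avg Q b) * (C * (LINT x:Q|lborel. v x))"
    using C V0 by (subst (asm) ennreal_le_iff) (simp_all add: set_lebesgue_integral_def)
qed

text \<open>
  The averages of \<open>b\<close> enter the two factors of the \<open>A_(p,q)\<close> product as \<open>exp (\<epsilon> b_Q)\<close> and \<open>exp (- \<epsilon> b_Q)\<close>
  and cancel. One \<open>\<epsilon>\<close> serves all weights and functions with the given constants, so it can be chosen before
  the four real functions built from a complex symbol.
\<close>
theorem Apq_cells_exp_bmo:
  fixes p q A B :: real
  assumes pq: "1 < p" "1 < q" and A: "0 \<le> A" and B: "0 < B"
  shows "\<exists>\<epsilon>>0. \<exists>A'\<ge>0. \<forall>(w :: real ^ 'n \<Rightarrow> real) b. Apq_cells p q A w \<longrightarrow> bmo_cells B b \<longrightarrow>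
    Apq_cells p q A' (\<lambda>x. w x * exp (\<epsilon> * b x))"
proof -
  define p' where "p' = p / (p - 1)"
  have p': "0 < p'" using pq by (simp add: p'_def)
  define \<kappa>1 where "\<kappa>1 = 4 * (A * 4 powr (1 / q)) powr p'"
  define \<kappa>2 where "\<kappa>2 = 4 * (A * 4 powr ((p - 1) / p)) powr q"
  have \<kappa>: "0 \<le> \<kappa>1" "0 \<le> \<kappa>2" by (simp_all add: \<kappa>1_def \<kappa>2_def)
  from weighted_john_nirenberg[OF \<kappa>(1) B, where 'n = 'n]
  obtain c1 C1 where c1: "0 < c1" and C1: "0 \<le> C1" and jn1: "\<forall>u (v :: real ^ 'n \<Rightarrow> real) b Q.
    bmo_cells B b \<longrightarrow> A_infinity_cells \<kappa>1 v \<longrightarrow> Q \<in> grid u \<longrightarrow>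
    (\<integral>\<^sup>+x\<in>Q. ennreal (exp (c1 * \<bar>b x - cell_avg Q b\<bar>) * v x) \<partial>lborel) \<le> ennreal (C1 * (LINT x:Q|lborel. v x))"
    by (elim exE conjE)
  from weighted_john_nirenberg[OF \<kappa>(2) B, where 'n = 'n]
  obtain c2 C2 where c2: "0 < c2" and C2: "0 \<le> C2" and jn2: "\<forall>u (v :: real ^ 'n \<Rightarrow> real) b Q.
    bmo_cells B b \<longrightarrow> A_infinity_cells \<kappa>2 v \<longrightarrow> Q \<in> grid u \<longrightarrow>
    (\<integral>\<^sup>+x\<in>Q. ennreal (exp (c2 * \<bar>b x - cell_avg Q b\<bar>) * v x) \<partial>lborel) \<le> ennreal (C2 * (LINT x:Q|lborel. v x))"
    by (elim exE conjE)
  define \<epsilon> where "\<epsilon> = min (c2 / q) (c1 / p')"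
  have \<epsilon>: "0 < \<epsilon>" "q * \<epsilon> \<le> c2" "p' * \<epsilon> \<le> c1"
    using c1 c2 pq p' by (auto simp: \<epsilon>_def min_def field_simps)
  define A' where "A' = C2 powr (1 / q) * C1 powr ((p - 1) / p) * A"
  have A': "0 \<le> A'" using A by (simp add: A'_def)
  have "Apq_cells p q A' (\<lambda>x. w x * exp (\<epsilon> * b x))"
    if w: "Apq_cells p q A w" and b: "bmo_cells B b" for w b :: "real ^ 'n \<Rightarrow> real"
    unfolding Apq_cells_def
  proof (intro conjI allI ballI)
    note wm [measurable] = Apq_cellsD(1)[OF w] and wpos = Apq_cellsD(2)[OF w]
    note bm [measurable] = bmo_cellsD(1)[OF b]
    show "(\<lambda>x. w x * exp (\<epsilon> * b x)) \<in> borel_measurable borel" by measurable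
    show "0 < w x * exp (\<epsilon> * b x)" for x using wpos[of x] by simp
    fix u :: "real ^ 'n" and Q assume Q: "Q \<in> grid u"
    have eq2: "(w x * exp (\<epsilon> * b x)) powr q = w x powr q * exp (q * \<epsilon> * b x)" for x
      using wpos[of x] by (simp add: powr_mult exp_powr_real mult_ac)
    have eq1: "(w x * exp (\<epsilon> * b x)) powr (- p') = w x powr (- p') * exp (- (p' * \<epsilon>) * b x)" for x
      using wpos[of x] by (simp add: powr_mult exp_powr_real mult_ac)
    note A_inf = Apq_cells_A_infinity[OF w pq A, folded \<kappa>2_def p'_def, folded \<kappa>1_def]
    note J2 = jn2[rule_format, OF b A_inf(1) Q] and J1 = jn1[rule_format, OF b A_inf(2) Q]
    note v2 = A_infinity_cellsD(1)[OF A_inf(1)] A_infinity_cellsD(2)[OF A_inf(1)]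
    note v1 = A_infinity_cellsD(1)[OF A_inf(2)] A_infinity_cellsD(2)[OF A_inf(2)]
    have s: "\<bar>q * \<epsilon>\<bar> \<le> c2" "\<bar>- (p' * \<epsilon>)\<bar> \<le> c1" using \<epsilon> pq p' by (simp_all add: abs_mult)
    note P2 = exp_perturbed_integral[OF v2(1) bm v2(2) Q s(1) C2 J2]
    note P1 = exp_perturbed_integral[OF v1(1) bm v1(2) Q s(2) C1 J1]
    show "set_integrable lborel Q (\<lambda>x. (w x * exp (\<epsilon> * b x)) powr q)" unfolding eq2 by (rule P2(1))
    show "set_integrable lborel Q (\<lambda>x. (w x * exp (\<epsilon> * b x)) powr (- (p / (p - 1))))"
      unfolding p'_def[symmetric] eq1 by (rule P1(1))
    define V2 where "V2 = (LINT x:Q|lborel. w x powr q)"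
    define V1 where "V1 = (LINT x:Q|lborel. w x powr (- p'))"
    define a where "a = cell_avg Q b"
    have V0: "0 \<le> V1" "0 \<le> V2" unfolding V1_def V2_def set_lebesgue_integral_def
      by (auto intro!: Bochner_Integration.integral_nonneg)
    have "(LINT x:Q|lborel. (w x * exp (\<epsilon> * b x)) powr q) powr (1 / q) \<le> (exp (q * \<epsilon> * a) * (C2 * V2)) powr (1 / q)"
      unfolding eq2 using P2(2) pq(2)
      by (intro powr_mono2) (auto simp: a_def V2_def set_lebesgue_integral_def intro!: Bochner_Integration.integral_nonneg)
    also have "\<dots> = exp (\<epsilon> * a) * (C2 powr (1 / q) * V2 powr (1 / q))"
      using C2 V0 pq(2) by (simp add: powr_mult exp_powr_real)
    finally have 2: "(LINT x:Q|lborel. (w x * exp (\<epsilon> * b x)) powr q) powr (1 / q) \<le> exp (\<epsilon> * a) * (C2 powr (1 / q) * V2 powr (1 / q))" .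
    have "(LINT x:Q|lborel. (w x * exp (\<epsilon> * b x)) powr (- p')) powr ((p - 1) / p) \<le> (exp (- (p' * \<epsilon>) * a) * (C1 * V1)) powr ((p - 1) / p)"
      unfolding eq1 using P1(2) pq(1)
      by (intro powr_mono2) (auto simp: a_def V1_def set_lebesgue_integral_def intro!: Bochner_Integration.integral_nonneg)
    also have "\<dots> = exp (- (p' * \<epsilon>) * a * ((p - 1) / p)) * (C1 powr ((p - 1) / p) * V1 powr ((p - 1) / p))"
      using C1 V0 by (simp add: powr_mult exp_powr_real)
    also have "- (p' * \<epsilon>) * a * ((p - 1) / p) = - (\<epsilon> * a)" using pq(1) by (simp add: p'_def)
    finally have 1: "(LINT x:Q|lborel. (w x * exp (\<epsilon> * b x)) powr (- p')) powr ((p - 1) / p) \<le> exp (- (\<epsilon> * a)) * (C1 powr ((p - 1) / p) * V1 powr ((p - 1) / p))" .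
    have "(LINT x:Q|lborel. (w x * exp (\<epsilon> * b x)) powr q) powr (1 / q) * (LINT x:Q|lborel. (w x * exp (\<epsilon> * b x)) powr (- p')) powr ((p - 1) / p)
      \<le> (exp (\<epsilon> * a) * (C2 powr (1 / q) * V2 powr (1 / q))) * (exp (- (\<epsilon> * a)) * (C1 powr ((p - 1) / p) * V1 powr ((p - 1) / p)))"
      using 1 2 by (intro mult_mono) auto
    also have "\<dots> = (exp (\<epsilon> * a) * exp (- (\<epsilon> * a))) * (C2 powr (1 / q) * C1 powr ((p - 1) / p)) * (V2 powr (1 / q) * V1 powr ((p - 1) / p))"
      by (simp only: mult_ac)
    also have "exp (\<epsilon> * a) * exp (- (\<epsilon> * a)) = 1" by (simp add: exp_add[symmetric])
    also have "1 * (C2 powr (1 / q) * C1 powr ((p - 1) / p)) * (V2 powr (1 / q) * V1 powr ((p - 1) / p))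
      \<le> 1 * (C2 powr (1 / q) * C1 powr ((p - 1) / p)) * (A * measure lborel Q powr (1 / q + (p - 1) / p))"
      using Apq_cellsD(5)[OF w Q] unfolding V2_def V1_def p'_def by (intro mult_left_mono) auto
    also have "\<dots> = A' * measure lborel Q powr (1 / q + (p - 1) / p)" by (simp add: A'_def)
    finally show "(LINT x:Q|lborel. (w x * exp (\<epsilon> * b x)) powr q) powr (1 / q) *
        (LINT x:Q|lborel. (w x * exp (\<epsilon> * b x)) powr (- (p / (p - 1)))) powr ((p - 1) / p)
        \<le> A' * measure lborel Q powr (1 / q + (p - 1) / p)" by (simp only: p'_def)
  qed
  note * = this
  show ?thesis
    by (rule exI[of _ \<epsilon>], rule conjI[OF \<epsilon>(1)], rule exI[of _ A'], rule conjI[OF A']) (intro allI impI, rule *)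
qed

section \<open>Borel versions of weights, symbols and kernels\<close>

lemma locally_integrable_measurable:
  fixes f :: "real ^ 'n \<Rightarrow> 'b::{banach, second_countable_topology}"
  assumes "locally_integrable f" shows "f \<in> borel_measurable lebesgue"
proof (rule borel_measurable_LIMSEQ_metric)
  show "(\<lambda>x. indicator (cball 0 (real n)) x *\<^sub>R f x) \<in> borel_measurable lebesgue" for n
    using assms unfolding locally_integrable_def set_integrable_def by (intro borel_measurable_integrable) simp
  fix x :: "real ^ 'n"
  obtain N where N: "norm x \<le> real N" using real_arch_simple by blast
  have "\<forall>\<^sub>F n in sequentially. indicator (cball 0 (real n)) x *\<^sub>R f x = f x"
    using eventually_ge_at_top[of N]
  proof (rule eventually_mono)
    fix n assume "N \<le> n"
    then have "norm x \<le> real n" using N by simp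
    then show "indicator (cball 0 (real n)) x *\<^sub>R f x = f x" by simp
  qed
  then show "(\<lambda>n. indicator (cball 0 (real n)) x *\<^sub>R f x) \<longlonglongrightarrow> f x" by (rule tendsto_eventually)
qed

lemma lebesgue_borel_version_complex:
  fixes f :: "real ^ 'n \<Rightarrow> complex"
  assumes "f \<in> borel_measurable lebesgue"
  shows "\<exists>f'\<in>borel_measurable borel. AE x in lebesgue. f x = f' x"
proof -
  have "(\<lambda>x. Re (f x)) \<in> borel_measurable lebesgue" "(\<lambda>x. Im (f x)) \<in> borel_measurable lebesgue"
    using assms by simp_all
  note versions = this[THEN completion_ex_borel_measurable_real]
  from versions(1) obtain g where g: "g \<in> borel_measurable lborel" "AE x in lborel. Re (f x) = g x" by (elim bexE)
  from versions(2) obtain h where h: "h \<in> borel_measurable lborel" "AE x in lborel. Im (f x) = h x" by (elim bexE)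
  have "(\<lambda>x. Complex (g x) (h x)) \<in> borel_measurable borel"
    using g(1) h(1) by (subst borel_measurable_complex_iff) simp
  moreover have "AE x in lborel. f x = Complex (g x) (h x)"
    using g(2) h(2) by eventually_elim (simp add: complex_eq_iff)
  then have "AE x in lebesgue. f x = Complex (g x) (h x)" by (rule AE_completion)
  ultimately show ?thesis
    by (intro bexI[of "\<lambda>f'. AE x in lebesgue. f x = f' x" "\<lambda>x. Complex (g x) (h x)"])
qed

text \<open>
  Closed cubes and half-open cubes differ by a null set, and so do a function and its Borel version.
\<close>
lemma cube_transfer:
  fixes f f' :: "real ^ 'n \<Rightarrow> 'b::euclidean_space"
  assumes f': "f' \<in> borel_measurable borel" "AE x in lebesgue. f x = f' x" and h: "0 \<le> h"
  shows "set_integrable lebesgue (cbox a (\<chi> i. a $ i + h)) f \<longleftrightarrow> set_integrable lborel (half_open_cube a h) f'"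
    and "(LINT x:cbox a (\<chi> i. a $ i + h)|lebesgue. f x) = (LINT x:half_open_cube a h|lborel. f' x)"
proof -
  let ?C = "cbox a (\<chi> i. a $ i + h)" and ?H = "half_open_cube a h"
  note f'(1) [measurable]
  have m': "(\<lambda>x. indicator ?H x *\<^sub>R f' x) \<in> borel_measurable lborel" by measurable
  then have m: "(\<lambda>x. indicator ?H x *\<^sub>R f' x) \<in> borel_measurable lebesgue" by (rule measurable_completion)
  have ae: "AE x in lebesgue. indicator ?H x *\<^sub>R f' x = indicator ?C x *\<^sub>R f x"
    using f'(2) AE_completion[OF AE_half_open_cube_iff[OF h, of a]]
    by eventually_elim (simp add: indicator_def)
  have mC: "(\<lambda>x. indicator ?C x *\<^sub>R f x) \<in> borel_measurable lebesgue"
    using m ae by (rule borel_measurable_AE)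
  show "set_integrable lebesgue ?C f \<longleftrightarrow> set_integrable lborel ?H f'"
    unfolding set_integrable_def
    by (rule trans[OF integrable_cong_AE[OF m mC ae, symmetric] integrable_completion[OF m']])
  show "(LINT x:?C|lebesgue. f x) = (LINT x:?H|lborel. f' x)"
    unfolding set_lebesgue_integral_def
    by (rule trans[OF integral_cong_AE[OF m mC ae, symmetric] integral_completion[OF m']])
qed

lemma cell_as_cube:
  fixes u :: "real ^ 'n"
  assumes "Q \<in> grid u"
  obtains a h where "0 < h" "Q = half_open_cube a h" "cbox a (\<chi> i. a $ i + h) \<in> cubes"
    "measure lebesgue (cbox a (\<chi> i. a $ i + h)) = measure lborel Q"
proof -
  obtain k y where Q: "Q = cell u k y" using assms by (auto simp: grid_def)
  define a where "a = (\<chi> i. u $ i + of_int \<lfloor>2 powi k * (y $ i - u $ i)\<rfloor> * 2 powi (- k))"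
  define h where "h = (2::real) powi (- k)"
  have h: "0 < h" by (simp add: h_def)
  have Qh: "Q = half_open_cube a h" unfolding Q a_def h_def by (rule cell_eq_half_open_cube)
  have "measure lebesgue (cbox a (\<chi> i. a $ i + h)) = measure lborel Q"
    using emeasure_cube(1)[of h a] emeasure_half_open_cube[of h a] h by (simp add: Qh measure_def)
  moreover have "cbox a (\<chi> i. a $ i + h) \<in> cubes" using h unfolding cubes_def by blast
  ultimately show ?thesis using that[OF h Qh] by blast
qed

text \<open>
  On the null set where the Borel version of \<open>w\<close> fails to be positive it is replaced by one.
\<close>
lemma A_pq_borel_version:
  fixes w :: "real ^ 'n \<Rightarrow> real"
  assumes w: "w \<in> A_pq p q"
  shows "\<exists>w' A. 0 \<le> A \<and> Apq_cells p q A w' \<and> (AE x in lebesgue. w x = w' x)"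
proof -
  define f where "f Q = avg Q (\<lambda>x. w x powr q) powr (1 / q) * avg Q (\<lambda>x. w x powr (- (p / (p - 1)))) powr (1 / (p / (p - 1)))" for Q
  have conj: "weight w \<and> (AE x in lebesgue. 0 < w x) \<and>
      (\<forall>Q\<in>cubes. set_integrable lebesgue Q (\<lambda>x. w x powr q) \<and> set_integrable lebesgue Q (\<lambda>x. w x powr (- (p / (p - 1))))) \<and>
      bdd_above (f ` cubes)"
    using w unfolding A_pq_def Let_def mem_Collect_eq f_def .
  note wt = conjunct1[OF conj] conjunct1[OF conjunct2[OF conj]]
    and int' = conjunct1[OF conjunct2[OF conjunct2[OF conj]]] and bdd = conjunct2[OF conjunct2[OF conjunct2[OF conj]]]
  have int: "set_integrable lebesgue Q (\<lambda>x. w x powr q)" "set_integrable lebesgue Q (\<lambda>x. w x powr (- (p / (p - 1))))" if "Q \<in> cubes" for Q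
    by (rule conjunct1[OF bspec[OF int' that]], rule conjunct2[OF bspec[OF int' that]])
  have "w \<in> borel_measurable lebesgue" using wt(1) locally_integrable_measurable by (auto simp: weight_def)
  from completion_ex_borel_measurable_real[OF this]
  obtain v where v: "v \<in> borel_measurable lborel" "AE x in lborel. w x = v x" by (elim bexE)
  define w' where "w' x = (if 0 < v x then v x else 1)" for x
  have w'm: "w' \<in> borel_measurable borel" using v(1) unfolding w'_def[abs_def] by measurable
  have w'pos: "0 < w' x" for x by (simp add: w'_def)
  have ae: "AE x in lebesgue. w x = w' x"
    using wt(2) AE_completion[OF v(2)] by eventually_elim (simp add: w'_def)
  have mp: "(\<lambda>x. w' x powr s) \<in> borel_measurable borel" for s using w'm by measurable
  have aep: "AE x in lebesgue. w x powr s = w' x powr s" for s using ae by eventually_elim simp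
  from bdd obtain A0 where "\<forall>y\<in>f ` cubes. y \<le> A0" unfolding bdd_above_def by (elim exE)
  then have A0: "f Q \<le> A0" if "Q \<in> cubes" for Q using that by (rule bspec[OF _ imageI])
  define A where "A = max A0 0"
  have "Apq_cells p q A w'"
    unfolding Apq_cells_def
  proof (intro conjI allI ballI)
    fix u :: "real ^ 'n" and Q assume Q: "Q \<in> grid u"
    from cell_as_cube[OF Q] obtain a h where h: "0 < h" and Qh: "Q = half_open_cube a h"
      and C: "cbox a (\<chi> i. a $ i + h) \<in> cubes" and m: "measure lebesgue (cbox a (\<chi> i. a $ i + h)) = measure lborel Q" .
    have h0: "0 \<le> h" using h by simp
    note tr = cube_transfer[OF mp aep h0, where a = a, folded Qh]
    show "set_integrable lborel Q (\<lambda>x. w' x powr q)" using int(1)[OF C] tr(1) by simp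
    show "set_integrable lborel Q (\<lambda>x. w' x powr (- (p / (p - 1))))" using int(2)[OF C] tr(1) by simp
    define \<mu> where "\<mu> = measure lborel Q"
    have \<mu>: "0 < \<mu>" unfolding \<mu>_def using grid_fmeasurable(3)[OF Q] .
    have I0: "0 \<le> (LINT x:Q|lborel. w' x powr s)" for s
      unfolding set_lebesgue_integral_def by (rule Bochner_Integration.integral_nonneg) simp
    have "((LINT x:Q|lborel. w' x powr q) / \<mu>) powr (1 / q) * ((LINT x:Q|lborel. w' x powr (- (p / (p - 1)))) / \<mu>) powr ((p - 1) / p) \<le> A"
      using A0[OF C] unfolding f_def avg_def m tr(2) A_def \<mu>_def by (simp add: divide_inverse mult.commute)
    then have "((LINT x:Q|lborel. w' x powr q) powr (1 / q) * (LINT x:Q|lborel. w' x powr (- (p / (p - 1)))) powr ((p - 1) / p)) / \<mu> powr (1 / q + (p - 1) / p) \<le> A"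
      using I0 \<mu> by (simp add: powr_divide powr_add)
    then show "(LINT x:Q|lborel. w' x powr q) powr (1 / q) * (LINT x:Q|lborel. w' x powr (- (p / (p - 1)))) powr ((p - 1) / p)
       \<le> A * measure lborel Q powr (1 / q + (p - 1) / p)"
      using \<mu> by (simp add: pos_divide_le_eq \<mu>_def)
  qed (use w'm w'pos in auto)
  then show ?thesis using ae by (intro exI[of _ w'] exI[of _ A]) (simp add: A_def)
qed

text \<open>
  The linear functional \<open>z \<mapsto> s Re z + t Im z\<close> commutes with averages and is bounded by \<open>2 |z|\<close>.
\<close>
lemma BMO_borel_version:
  fixes b :: "real ^ 'n \<Rightarrow> complex"
  assumes b: "b \<in> BMO"
  shows "\<exists>b' B. 0 < B \<and> b' \<in> borel_measurable borel \<and> (AE x in lebesgue. b x = b' x) \<and>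
    (\<forall>s t. \<bar>s\<bar> \<le> 1 \<longrightarrow> \<bar>t\<bar> \<le> 1 \<longrightarrow> bmo_cells B (\<lambda>x. s * Re (b' x) + t * Im (b' x)))"
proof -
  have loc: "locally_integrable b" and bdd: "bdd_above ((\<lambda>Q. avg Q (\<lambda>x. norm (b x - avg Q b))) ` cubes)"
    using b by (auto simp: BMO_def)
  from lebesgue_borel_version_complex[OF locally_integrable_measurable[OF loc]]
  obtain b' where b': "b' \<in> borel_measurable borel" and ae: "AE x in lebesgue. b x = b' x" by (elim bexE)
  from bdd obtain B0 where "\<forall>y\<in>(\<lambda>Q. avg Q (\<lambda>x. norm (b x - avg Q b))) ` cubes. y \<le> B0" unfolding bdd_above_def by (elim exE)
  then have B0: "avg Q (\<lambda>x. norm (b x - avg Q b)) \<le> B0" if "Q \<in> cubes" for Q using that by (rule bspec[OF _ imageI])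
  define B where "B = 2 * max B0 1"
  have B: "0 < B" by (simp add: B_def)
  note b' [measurable]
  have "bmo_cells B (\<lambda>x. s * Re (b' x) + t * Im (b' x))" if st: "\<bar>s\<bar> \<le> 1" "\<bar>t\<bar> \<le> 1" for s t
    unfolding bmo_cells_def
  proof (intro conjI allI ballI)
    show "(\<lambda>x. s * Re (b' x) + t * Im (b' x)) \<in> borel_measurable borel" by measurable
    define L where "L z = s * Re z + t * Im z" for z
    have L_diff: "L y - L z = L (y - z)" for y z by (simp add: L_def algebra_simps)
    have L_le: "\<bar>L z\<bar> \<le> 2 * norm z" for z
    proof -
      have "\<bar>L z\<bar> \<le> \<bar>s\<bar> * \<bar>Re z\<bar> + \<bar>t\<bar> * \<bar>Im z\<bar>" unfolding L_def by (metis abs_mult abs_triangle_ineq)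
      also have "\<dots> \<le> 1 * \<bar>Re z\<bar> + 1 * \<bar>Im z\<bar>" using st by (intro add_mono mult_right_mono) auto
      also have "\<dots> \<le> 2 * norm z" using abs_Re_le_cmod[of z] abs_Im_le_cmod[of z] by simp
      finally show ?thesis .
    qed
    fix u :: "real ^ 'n" and Q assume Q: "Q \<in> grid u"
    from cell_as_cube[OF Q] obtain a h where h: "0 < h" and Qh: "Q = half_open_cube a h"
      and C: "cbox a (\<chi> i. a $ i + h) \<in> cubes" and m: "measure lebesgue (cbox a (\<chi> i. a $ i + h)) = measure lborel Q" .
    have h0: "0 \<le> h" using h by simp
    have \<mu>: "0 < measure lborel Q" using grid_fmeasurable(3)[OF Q] .
    have intQ: "set_integrable lborel Q b'"
      using cube_transfer(1)[OF b' ae h0, of a, folded Qh] loc unfolding locally_integrable_def by simp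
    then have intb: "integrable lborel (\<lambda>x. indicator Q x *\<^sub>R b' x)" by (simp add: set_integrable_def)
    have intRI: "integrable lborel (\<lambda>x. indicator Q x * Re (b' x))" "integrable lborel (\<lambda>x. indicator Q x * Im (b' x))"
      using integrable_Re[OF intb] integrable_Im[OF intb] by simp_all
    show intL: "set_integrable lborel Q (\<lambda>x. s * Re (b' x) + t * Im (b' x))"
    proof -
      have "integrable lborel (\<lambda>x. s * (indicator Q x * Re (b' x)) + t * (indicator Q x * Im (b' x)))"
        using intRI by simp
      then show ?thesis by (simp add: set_integrable_def algebra_simps)
    qed
    define c where "c = avg (cbox a (\<chi> i. a $ i + h)) b"
    have c_eq: "c = (LINT x:Q|lborel. b' x) /\<^sub>R measure lborel Q"
      unfolding c_def avg_def m cube_transfer(2)[OF b' ae h0, of a, folded Qh] ..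
    have "(LINT x:Q|lborel. s * Re (b' x) + t * Im (b' x)) = (LINT x|lborel. s * (indicator Q x * Re (b' x)) + t * (indicator Q x * Im (b' x)))"
      unfolding set_lebesgue_integral_def by (intro Bochner_Integration.integral_cong refl) (simp add: algebra_simps)
    also have "\<dots> = s * (LINT x|lborel. indicator Q x * Re (b' x)) + t * (LINT x|lborel. indicator Q x * Im (b' x))"
      using intRI by simp
    also have "(LINT x|lborel. indicator Q x * Re (b' x)) = Re (LINT x:Q|lborel. b' x)"
      using integral_Re[OF intb] by (simp add: set_lebesgue_integral_def)
    also have "(LINT x|lborel. indicator Q x * Im (b' x)) = Im (LINT x:Q|lborel. b' x)"
      using integral_Im[OF intb] by (simp add: set_lebesgue_integral_def)
    finally have avgL: "cell_avg Q (\<lambda>x. s * Re (b' x) + t * Im (b' x)) = L c"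
      using \<mu> by (simp add: cell_avg_def c_eq L_def field_simps)
    have aec: "AE x in lebesgue. norm (b x - c) = norm (b' x - c)" using ae by eventually_elim simp
    have mc: "(\<lambda>x. norm (b' x - c)) \<in> borel_measurable borel" by measurable
    have "(LINT x:Q|lborel. norm (b' x - c)) /\<^sub>R measure lborel Q \<le> B0"
      using B0[OF C] unfolding c_def[symmetric] unfolding avg_def m cube_transfer(2)[OF mc aec h0, of a, folded Qh] .
    then have osc: "(LINT x:Q|lborel. norm (b' x - c)) \<le> B0 * measure lborel Q"
      using \<mu> by (simp add: field_simps)
    have intosc: "set_integrable lborel Q (\<lambda>x. norm (b' x - c))"
    proof -
      have "set_integrable lborel Q (\<lambda>x. c)" using grid_fmeasurable(2)[OF Q] by (auto simp: set_integrable_def fmeasurable_def)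
      then show ?thesis using intQ by (intro set_integrable_norm set_integral_diff(1))
    qed
    have "(LINT x:Q|lborel. \<bar>L (b' x) - L c\<bar>) \<le> (LINT x:Q|lborel. 2 * norm (b' x - c))"
      using intosc L_le set_integrable_oscillation[OF Q intL, of "L c"]
      by (intro set_integral_mono) (auto simp: L_diff L_def[symmetric])
    also have "\<dots> = 2 * (LINT x:Q|lborel. norm (b' x - c))" by simp
    also have "\<dots> \<le> 2 * (max B0 1 * measure lborel Q)"
      using osc \<mu> by (intro mult_left_mono order.trans[OF osc] mult_right_mono) auto
    finally show "(LINT x:Q|lborel. \<bar>(s * Re (b' x) + t * Im (b' x)) - cell_avg Q (\<lambda>x. s * Re (b' x) + t * Im (b' x))\<bar>) \<le> B * measure lborel Q"
      unfolding avgL by (simp add: L_def B_def)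
  qed
  then show ?thesis using B b' ae by (intro exI[of _ b'] exI[of _ B] conjI allI impI)
qed

text \<open>
  A function continuous in each variable separately is jointly measurable: it is the limit of the functions
  obtained by moving \<open>y\<close> to the corner of its dyadic cell, and those depend on \<open>y\<close> only through
  countably many values. On the diagonal, where nothing is known, every function of the sequence is set to zero.
\<close>
lemma off_diagonal_kernel_measurable:
  fixes K :: "real ^ 'n \<Rightarrow> real ^ 'n \<Rightarrow> complex"
  assumes K: "\<And>x y. x \<noteq> y \<Longrightarrow> isCont (\<lambda>u. K u y) x \<and> isCont (\<lambda>v. K x v) y"
  shows "(\<lambda>z. if fst z = snd z then 0 else K (fst z) (snd z)) \<in> borel_measurable (borel \<Otimes>\<^sub>M borel)"
proof -
  let ?M = "borel \<Otimes>\<^sub>M borel :: ((real ^ 'n) \<times> (real ^ 'n)) measure"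
  define corner where "corner j z = (\<chi> i. real_of_int (z $ i) / 2 ^ j)" for j :: nat and z :: "int ^ 'n"
  define index where "index j y = (\<chi> i. \<lfloor>2 ^ j * y $ i\<rfloor>)" for j :: nat and y :: "real ^ 'n"
  have diag: "{z \<in> space ?M. fst z = snd z} \<in> sets ?M"
  proof -
    have "closed {z :: (real ^ 'n) \<times> (real ^ 'n). fst z = snd z}" by (intro closed_Collect_eq continuous_intros)
    then have "{z :: (real ^ 'n) \<times> (real ^ 'n). fst z = snd z} \<in> sets borel" by (rule borel_closed)
    then show ?thesis by (simp add: borel_prod[symmetric] space_pair_measure)
  qed
  have index_m: "index j \<in> measurable borel (count_space UNIV)" for j
  proof (subst measurable_count_space_eq2_countable, safe)
    fix z :: "int ^ 'n"
    have "index j -` {z} \<inter> space borel = (\<Inter>i. {y. \<lfloor>2 ^ j * y $ i\<rfloor> = z $ i})"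
      by (auto simp: index_def vec_eq_iff)
    also have "\<dots> \<in> sets borel"
    proof (intro sets.countable_INT'')
      fix i
      have "{y :: real ^ 'n. \<lfloor>2 ^ j * y $ i\<rfloor> = z $ i} = {y. of_int (z $ i) \<le> 2 ^ j * y $ i} \<inter> {y. 2 ^ j * y $ i < of_int (z $ i) + 1}"
        by (auto simp: floor_eq_iff)
      also have "\<dots> \<in> sets borel" by measurable
      finally show "{y :: real ^ 'n. \<lfloor>2 ^ j * y $ i\<rfloor> = z $ i} \<in> sets borel" .
    qed auto
    finally show "index j -` {z} \<inter> space borel \<in> sets borel" .
  qed auto
  have Kd: "(\<lambda>x. indicator (- {d}) x *\<^sub>R K x d) \<in> borel_measurable borel" for d
    using K by (intro borel_measurable_continuous_on_indicator continuous_at_imp_continuous_on) auto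
  have approx: "(\<lambda>z. if fst z = snd z then 0 else indicator (- {corner j (index j (snd z))}) (fst z) *\<^sub>R K (fst z) (corner j (index j (snd z)))) \<in> borel_measurable ?M" for j
  proof (rule measurable_If[OF _ _ diag])
    show "(\<lambda>z. indicator (- {corner j (index j (snd z))}) (fst z) *\<^sub>R K (fst z) (corner j (index j (snd z)))) \<in> borel_measurable ?M"
    proof (rule measurable_compose_countable[where g = "\<lambda>z. index j (snd z)" and f = "\<lambda>i z. indicator (- {corner j i}) (fst z) *\<^sub>R K (fst z) (corner j i)"])
      show "(\<lambda>z. indicator (- {corner j i}) (fst z) *\<^sub>R K (fst z) (corner j i)) \<in> borel_measurable ?M" for i
        using measurable_compose[OF measurable_fst Kd] .
      show "(\<lambda>z. index j (snd z)) \<in> measurable ?M (count_space UNIV)"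
        using measurable_compose[OF measurable_snd index_m] .
    qed
  qed simp
  show ?thesis
  proof (rule borel_measurable_LIMSEQ_metric[OF approx])
    fix z :: "(real ^ 'n) \<times> (real ^ 'n)"
    show "(\<lambda>j. if fst z = snd z then 0 else indicator (- {corner j (index j (snd z))}) (fst z) *\<^sub>R K (fst z) (corner j (index j (snd z))))
      \<longlonglongrightarrow> (if fst z = snd z then 0 else K (fst z) (snd z))"
    proof (cases "fst z = snd z")
      case False
      define x y where "x = fst z" and "y = snd z"
      have xy: "x \<noteq> y" using False by (simp add: x_def y_def)
      have lim: "(\<lambda>j. corner j (index j y)) \<longlonglongrightarrow> y"
      proof (rule vec_tendstoI)
        fix i
        have "(\<lambda>j. of_int \<lfloor>2 ^ j * y $ i\<rfloor> / 2 ^ j) \<longlonglongrightarrow> y $ i"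
        proof (rule tendsto_sandwich[of "\<lambda>j. y $ i - (1 / 2) ^ j" _ _ "\<lambda>j. y $ i"])
          show "(\<lambda>j. y $ i - (1 / 2) ^ j) \<longlonglongrightarrow> y $ i"
            using tendsto_diff[OF tendsto_const LIMSEQ_power_zero[of "1 / 2 :: real"], of "y $ i"] by simp
          have "y $ i - (1 / 2) ^ j \<le> of_int \<lfloor>2 ^ j * y $ i\<rfloor> / 2 ^ j" for j
          proof -
            have "2 ^ j * y $ i - 1 \<le> of_int \<lfloor>2 ^ j * y $ i\<rfloor>" by linarith
            then have "(2 ^ j * y $ i - 1) / 2 ^ j \<le> of_int \<lfloor>2 ^ j * y $ i\<rfloor> / 2 ^ j" by (rule divide_right_mono) simp
            then show ?thesis by (simp add: diff_divide_distrib power_one_over)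
          qed
          then show "\<forall>\<^sub>F j in sequentially. y $ i - (1 / 2) ^ j \<le> of_int \<lfloor>2 ^ j * y $ i\<rfloor> / 2 ^ j" by simp
          have "of_int \<lfloor>2 ^ j * y $ i\<rfloor> / 2 ^ j \<le> y $ i" for j :: nat
            by (simp add: pos_divide_le_eq mult.commute)
          then show "\<forall>\<^sub>F j in sequentially. of_int \<lfloor>2 ^ j * y $ i\<rfloor> / 2 ^ j \<le> y $ i" by simp
        qed simp
        then show "((\<lambda>j. corner j (index j y) $ i) \<longlongrightarrow> y $ i) sequentially" by (simp add: corner_def index_def)
      qed
      have "\<forall>\<^sub>F j in sequentially. corner j (index j y) \<noteq> x"
        using tendsto_imp_eventually_ne[OF lim] xy by auto
      moreover have "(\<lambda>j. K x (corner j (index j y))) \<longlonglongrightarrow> K x y"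
        using K[OF xy] lim by (auto intro: isCont_tendsto_compose)
      ultimately have "(\<lambda>j. indicator (- {corner j (index j y)}) x *\<^sub>R K x (corner j (index j y))) \<longlonglongrightarrow> K x y"
        by (elim Lim_transform_eventually) (auto elim: eventually_mono)
      then show ?thesis using False by (simp add: x_def y_def)
    qed simp
  qed
qed

lemma power_le_exp:
  fixes x :: real
  assumes "0 < m" "0 \<le> x"
  shows "x ^ m \<le> real m ^ m * exp x"
proof -
  have "(x / m) ^ m \<le> (1 + x / m) ^ m" using assms by (intro power_mono) auto
  also have "\<dots> \<le> exp x" using assms by (intro exp_ge_one_plus_x_over_n_power_n) auto
  finally have "real m ^ m * (x / m) ^ m \<le> real m ^ m * exp x" by (rule mult_left_mono) simp
  moreover have "real m ^ m * (x / m) ^ m = x ^ m" using assms(1) by (simp add: power_mult_distrib[symmetric])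
  ultimately show ?thesis by simp
qed

text \<open>
  With the signs of \<open>Re z\<close> and \<open>Im z\<close> for \<open>s\<close> and \<open>t\<close>, one term of the sum is at least \<open>exp (\<epsilon> |z|)\<close>.
\<close>
lemma cmod_power_le_sum_exp:
  fixes z :: complex
  assumes "0 < m" "0 < \<epsilon>"
  shows "norm z ^ m \<le> (real m / \<epsilon>) ^ m * (\<Sum>(s, t)\<in>{-1, 1} \<times> {-1, 1}. exp (\<epsilon> * (s * Re z + t * Im z)))"
proof -
  have "norm z ^ m = (\<epsilon> * norm z) ^ m / \<epsilon> ^ m" using assms by (simp add: power_mult_distrib)
  also have "\<dots> \<le> real m ^ m * exp (\<epsilon> * norm z) / \<epsilon> ^ m"
    using assms by (intro divide_right_mono power_le_exp) auto
  also have "\<dots> = (real m / \<epsilon>) ^ m * exp (\<epsilon> * norm z)" by (simp add: power_divide)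
  also have "exp (\<epsilon> * norm z) \<le> (\<Sum>(s, t)\<in>{-1, 1} \<times> {-1, 1}. exp (\<epsilon> * (s * Re z + t * Im z)))"
  proof -
    have "exp (\<epsilon> * norm z) \<le> exp (\<epsilon> * (sgn (Re z + 0) * Re z + sgn (Im z) * Im z))"
      using cmod_le[of z] assms(2) by (simp add: abs_sgn mult.commute)
    also have "\<dots> \<le> exp (\<epsilon> * ((if 0 \<le> Re z then 1 else -1) * Re z + (if 0 \<le> Im z then 1 else -1) * Im z))"
      by (auto simp: sgn_if)
    also have "\<dots> = (\<lambda>(s, t). exp (\<epsilon> * (s * Re z + t * Im z))) (if 0 \<le> Re z then 1 else -1, if 0 \<le> Im z then 1 else -1)" by simp
    also have "\<dots> \<le> (\<Sum>(s, t)\<in>{-1, 1} \<times> {-1, 1}. exp (\<epsilon> * (s * Re z + t * Im z)))"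
      by (rule member_le_sum) auto
    finally show ?thesis .
  qed
  finally show ?thesis using assms by (simp add: mult_left_mono)
qed

section \<open>The commutator\<close>

text \<open>
  The Riesz potential conjugated by \<open>exp (\<epsilon> \<beta>)\<close>, summed over the four real functions \<open>\<beta> = s Re b + t Im b\<close>.
\<close>
definition exp_riesz_sum :: "real \<Rightarrow> real \<Rightarrow> (real ^ 'n \<Rightarrow> complex) \<Rightarrow> (real ^ 'n \<Rightarrow> real) \<Rightarrow> real ^ 'n \<Rightarrow> ennreal" where
  "exp_riesz_sum \<alpha> \<epsilon> b f x = (\<Sum>(s, t)\<in>{-1, 1} \<times> {-1, 1}.
     ennreal (exp (\<epsilon> * (s * Re (b x) + t * Im (b x)))) *
     riesz_potential \<alpha> (\<lambda>y. f y * exp (- \<epsilon> * (s * Re (b y) + t * Im (b y)))) x)"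

lemma exp_riesz_sum_measurable [measurable]:
  assumes [measurable]: "b \<in> borel_measurable borel" "f \<in> borel_measurable borel"
  shows "exp_riesz_sum \<alpha> \<epsilon> b f \<in> borel_measurable borel"
proof -
  have [measurable]: "riesz_potential \<alpha> (\<lambda>y. f y * exp (- \<epsilon> * (s * Re (b y) + t * Im (b y)))) \<in> borel_measurable borel" for s t
    by (rule riesz_potential_measurable) measurable
  show ?thesis unfolding exp_riesz_sum_def[abs_def] split_beta by measurable
qed

text \<open>
  Conjugation by \<open>exp (\<epsilon> \<beta>)\<close> is the same as replacing the weight \<open>w\<close> by \<open>w exp (\<epsilon> \<beta>)\<close> on both sides of the estimate.
\<close>
lemma exp_riesz_sum_weighted_bound:
  fixes \<alpha> p q A B :: real
  assumes \<alpha>: "0 < \<alpha>" "\<alpha> < CARD('n)" and p: "1 < p" and q: "1 < q" "1 / p - 1 / q = \<alpha> / CARD('n)" and A: "0 \<le> A" and B: "0 < B"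
  shows "\<exists>\<epsilon>>0. \<exists>C\<ge>0. \<forall>(w :: real ^ 'n \<Rightarrow> real) b. Apq_cells p q A w \<longrightarrow> b \<in> borel_measurable borel \<longrightarrow>
    (\<forall>s t. \<bar>s\<bar> \<le> 1 \<longrightarrow> \<bar>t\<bar> \<le> 1 \<longrightarrow> bmo_cells B (\<lambda>x. s * Re (b x) + t * Im (b x))) \<longrightarrow>
    weighted_bound p q C w (exp_riesz_sum \<alpha> \<epsilon> b)"
proof -
  from Apq_cells_exp_bmo[OF p q(1) A B, where 'n = 'n]
  obtain \<epsilon> A' where \<epsilon>: "0 < \<epsilon>" and A': "0 \<le> A'"
    and pert: "\<forall>(w :: real ^ 'n \<Rightarrow> real) b. Apq_cells p q A w \<longrightarrow> bmo_cells B b \<longrightarrow> Apq_cells p q A' (\<lambda>x. w x * exp (\<epsilon> * b x))"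
    by (elim exE conjE)
  have q0: "0 < q" using q(1) by simp
  from riesz_potential_weighted_bound[OF \<alpha> p q0 q(2) A']
  obtain C0 where C0: "0 \<le> C0"
    and riesz: "\<forall>w :: real ^ 'n \<Rightarrow> real. Apq_cells p q A' w \<longrightarrow> weighted_bound p q C0 w (riesz_potential \<alpha>)"
    by (elim exE conjE)
  define I where "I = ({-1, 1} \<times> {-1, 1} :: (real \<times> real) set)"
  have I: "finite I" "I \<noteq> {}" by (auto simp: I_def)
  define m where "m = real (card I)"
  define C where "C = m powr q * (m * C0)"
  have C: "0 \<le> C" using C0 by (simp add: C_def m_def)
  have "(\<integral>\<^sup>+x. epow (exp_riesz_sum \<alpha> \<epsilon> b f x) q * ennreal (w x powr q) \<partial>lborel) \<le> ennreal (C * \<tau> powr q)"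
    if w: "Apq_cells p q A w" and b: "b \<in> borel_measurable borel"
      and bmo: "\<forall>s t. \<bar>s\<bar> \<le> 1 \<longrightarrow> \<bar>t\<bar> \<le> 1 \<longrightarrow> bmo_cells B (\<lambda>x. s * Re (b x) + t * Im (b x))"
      and f: "f \<in> borel_measurable borel" "\<forall>x. 0 \<le> f x" and \<tau>: "0 < \<tau>"
      and f\<tau>: "(\<integral>\<^sup>+x. ennreal (f x powr p * w x powr p) \<partial>lborel) \<le> ennreal (\<tau> powr p)"
    for w :: "real ^ 'n \<Rightarrow> real" and b f \<tau>
  proof -
    note wm [measurable] = Apq_cellsD(1)[OF w] and wpos = Apq_cellsD(2)[OF w]
    note b [measurable] and f(1) [measurable]
    define \<beta> where "\<beta> i x = fst i * Re (b x) + snd i * Im (b x)" for i :: "real \<times> real" and x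
    have [measurable]: "(\<lambda>x. \<beta> i x) \<in> borel_measurable borel" for i unfolding \<beta>_def by measurable
    define R where "R i = riesz_potential \<alpha> (\<lambda>y. f y * exp (- \<epsilon> * \<beta> i y))" for i
    have Rm [measurable]: "R i \<in> borel_measurable borel" for i unfolding R_def by (rule riesz_potential_measurable) measurable
    define J where "J x = (\<Sum>i\<in>I. ennreal (exp (\<epsilon> * \<beta> i x)) * R i x)" for x
    have J_eq: "exp_riesz_sum \<alpha> \<epsilon> b f x = J x" for x
      by (simp add: exp_riesz_sum_def J_def I_def R_def \<beta>_def split_beta)
    have piece: "(\<integral>\<^sup>+x. epow (ennreal (exp (\<epsilon> * \<beta> i x)) * R i x) q * ennreal (w x powr q) \<partial>lborel) \<le> ennreal (C0 * \<tau> powr q)"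
      if i: "i \<in> I" for i
    proof -
      define W where "W x = w x * exp (\<epsilon> * \<beta> i x)" for x
      have "bmo_cells B (\<beta> i)" using bmo[rule_format, of "fst i" "snd i"] i by (auto simp: I_def \<beta>_def[abs_def])
      then have W: "Apq_cells p q A' W" unfolding W_def[abs_def] using pert w by blast
      have eq: "epow (ennreal (exp (\<epsilon> * \<beta> i x)) * R i x) q * ennreal (w x powr q) = epow (R i x) q * ennreal (W x powr q)" for x
      proof -
        have "ennreal (W x powr q) = ennreal (exp (\<epsilon> * \<beta> i x) powr q) * ennreal (w x powr q)"
          using wpos[of x] by (simp add: W_def powr_mult ennreal_mult mult.commute)
        moreover have "epow (ennreal (exp (\<epsilon> * \<beta> i x)) * R i x) q = ennreal (exp (\<epsilon> * \<beta> i x) powr q) * epow (R i x) q"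
          by (rule epow_cmult) simp
        ultimately show ?thesis by (simp only: mult_ac)
      qed
      have "(f x * exp (- \<epsilon> * \<beta> i x)) powr p * W x powr p = f x powr p * w x powr p" for x
      proof -
        have "(f x * exp (- \<epsilon> * \<beta> i x)) * W x = (f x * w x) * exp (- \<epsilon> * \<beta> i x + \<epsilon> * \<beta> i x)"
          by (simp only: W_def exp_add mult_ac)
        also have "\<dots> = f x * w x" by simp
        finally have "((f x * exp (- \<epsilon> * \<beta> i x)) * W x) powr p = (f x * w x) powr p" by (rule arg_cong)
        moreover have "0 \<le> W x" using wpos[of x] by (simp add: W_def)
        ultimately show ?thesis using f(2) wpos[of x] by (simp only: powr_mult mult_nonneg_nonneg exp_ge_zero less_imp_le)
      qed
      then have "(\<integral>\<^sup>+x. ennreal ((f x * exp (- \<epsilon> * \<beta> i x)) powr p * W x powr p) \<partial>lborel) \<le> ennreal (\<tau> powr p)"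
        using f\<tau> by (simp only:)
      then have "(\<integral>\<^sup>+x. epow (R i x) q * ennreal (W x powr q) \<partial>lborel) \<le> ennreal (C0 * \<tau> powr q)"
        unfolding R_def using f(2) \<tau> by (intro riesz[rule_format, OF W, unfolded weighted_bound_def, rule_format]) auto
      then show ?thesis unfolding eq .
    qed
    have "(\<integral>\<^sup>+x. epow (J x) q * ennreal (w x powr q) \<partial>lborel)
      \<le> (\<integral>\<^sup>+x. (ennreal (m powr q) * (\<Sum>i\<in>I. epow (ennreal (exp (\<epsilon> * \<beta> i x)) * R i x) q)) * ennreal (w x powr q) \<partial>lborel)"
      unfolding J_def m_def using I q0 by (intro nn_integral_mono mult_right_mono epow_sum_le) auto
    also have "\<dots> = (\<integral>\<^sup>+x. ennreal (m powr q) * (\<Sum>i\<in>I. epow (ennreal (exp (\<epsilon> * \<beta> i x)) * R i x) q * ennreal (w x powr q)) \<partial>lborel)"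
      by (simp add: sum_distrib_right mult.assoc)
    also have "\<dots> = ennreal (m powr q) * (\<Sum>i\<in>I. \<integral>\<^sup>+x. epow (ennreal (exp (\<epsilon> * \<beta> i x)) * R i x) q * ennreal (w x powr q) \<partial>lborel)"
      by (simp add: nn_integral_cmult nn_integral_sum)
    also have "\<dots> \<le> ennreal (m powr q) * (\<Sum>i\<in>I. ennreal (C0 * \<tau> powr q))"
      using piece by (intro mult_left_mono sum_mono) auto
    also have "\<dots> = ennreal (C * \<tau> powr q)"
      using C0 by (simp add: C_def m_def ennreal_of_nat_eq_real_of_nat ennreal_mult[symmetric] mult_ac)
    finally show ?thesis unfolding J_eq .
  qed
  then have *: "weighted_bound p q C w (exp_riesz_sum \<alpha> \<epsilon> b)"
    if "Apq_cells p q A w" "b \<in> borel_measurable borel"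
      "\<forall>s t. \<bar>s\<bar> \<le> 1 \<longrightarrow> \<bar>t\<bar> \<le> 1 \<longrightarrow> bmo_cells B (\<lambda>x. s * Re (b x) + t * Im (b x))"
    for w :: "real ^ 'n \<Rightarrow> real" and b
    unfolding weighted_bound_def using that by (intro allI impI)
  show ?thesis
    by (rule exI[of _ \<epsilon>], rule conjI[OF \<epsilon>], rule exI[of _ C], rule conjI[OF C]) (intro allI impI, rule *)
qed

lemma nn_integral_commutator_le:
  fixes b :: "real ^ 'n \<Rightarrow> complex" and f :: "real ^ 'n \<Rightarrow> real" and g :: "real ^ 'n \<Rightarrow> complex" and \<alpha> :: real
  assumes [measurable]: "b \<in> borel_measurable borel" "f \<in> borel_measurable borel" and f: "\<And>y. 0 \<le> f y"
    and m: "0 < m" and \<epsilon>: "0 < \<epsilon>" and C: "0 \<le> C"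
    and g: "\<And>y. norm (g y) \<le> C * norm (x - y) powr (\<alpha> - CARD('n)) * norm (b x - b y) ^ m * f y"
  shows "(\<integral>\<^sup>+y. ennreal (norm (g y)) \<partial>lborel) \<le> ennreal (C * (real m / \<epsilon>) ^ m) * exp_riesz_sum \<alpha> \<epsilon> b f x"
proof -
  define I where "I = ({-1, 1} \<times> {-1, 1} :: (real \<times> real) set)"
  define \<beta> where "\<beta> i x = fst i * Re (b x) + snd i * Im (b x)" for i :: "real \<times> real" and x
  have [measurable]: "(\<lambda>x. \<beta> i x) \<in> borel_measurable borel" for i unfolding \<beta>_def by measurable
  define D where "D = C * (real m / \<epsilon>) ^ m"
  have D: "0 \<le> D" using C \<epsilon> by (simp add: D_def)
  define k where "k i y = exp (\<epsilon> * \<beta> i x) * ((f y * exp (- \<epsilon> * \<beta> i y)) * norm (x - y) powr (\<alpha> - CARD('n)))" for i y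
  have k0: "0 \<le> k i y" for i y using f by (simp add: k_def)
  have le: "norm (g y) \<le> D * (\<Sum>i\<in>I. k i y)" for y
  proof -
    have "norm (b x - b y) ^ m \<le> (real m / \<epsilon>) ^ m * (\<Sum>i\<in>I. exp (\<epsilon> * (\<beta> i x - \<beta> i y)))"
      using cmod_power_le_sum_exp[OF m \<epsilon>, of "b x - b y"] by (simp add: I_def \<beta>_def split_beta algebra_simps)
    then have "C * norm (x - y) powr (\<alpha> - CARD('n)) * norm (b x - b y) ^ m * f y
      \<le> C * norm (x - y) powr (\<alpha> - CARD('n)) * ((real m / \<epsilon>) ^ m * (\<Sum>i\<in>I. exp (\<epsilon> * (\<beta> i x - \<beta> i y)))) * f y"
      using C f by (intro mult_right_mono mult_left_mono) auto
    also have "\<dots> = D * (\<Sum>i\<in>I. exp (\<epsilon> * (\<beta> i x - \<beta> i y)) * (f y * norm (x - y) powr (\<alpha> - CARD('n))))"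
      unfolding D_def sum_distrib_right[symmetric] by (simp only: mult_ac)
    also have "(\<Sum>i\<in>I. exp (\<epsilon> * (\<beta> i x - \<beta> i y)) * (f y * norm (x - y) powr (\<alpha> - CARD('n)))) = (\<Sum>i\<in>I. k i y)"
    proof (rule sum.cong[OF refl])
      fix i
      have "exp (\<epsilon> * (\<beta> i x - \<beta> i y)) = exp (\<epsilon> * \<beta> i x) * exp (- \<epsilon> * \<beta> i y)"
        by (simp add: exp_add[symmetric] algebra_simps)
      then show "exp (\<epsilon> * (\<beta> i x - \<beta> i y)) * (f y * norm (x - y) powr (\<alpha> - CARD('n))) = k i y"
        by (simp only: k_def mult_ac)
    qed
    finally show ?thesis using g[of y] by linarith
  qed
  have "(\<integral>\<^sup>+y. ennreal (norm (g y)) \<partial>lborel) \<le> (\<integral>\<^sup>+y. ennreal D * (\<Sum>i\<in>I. ennreal (k i y)) \<partial>lborel)"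
    using le D k0 by (intro nn_integral_mono) (simp add: ennreal_mult[symmetric] sum_nonneg ennreal_leI)
  also have "\<dots> = ennreal D * (\<Sum>i\<in>I. \<integral>\<^sup>+y. ennreal (k i y) \<partial>lborel)"
    unfolding k_def by (simp add: nn_integral_cmult nn_integral_sum)
  also have "(\<Sum>i\<in>I. \<integral>\<^sup>+y. ennreal (k i y) \<partial>lborel) = exp_riesz_sum \<alpha> \<epsilon> b f x"
  proof -
    have "(\<integral>\<^sup>+y. ennreal (k i y) \<partial>lborel) = ennreal (exp (\<epsilon> * \<beta> i x)) * riesz_potential \<alpha> (\<lambda>y. f y * exp (- \<epsilon> * \<beta> i y)) x" for i
      unfolding riesz_potential_def k_def using f
      by (subst nn_integral_cmult[symmetric]) (auto simp: ennreal_mult)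
    then show ?thesis by (simp add: exp_riesz_sum_def I_def \<beta>_def split_beta)
  qed
  finally show ?thesis by (simp add: D_def)
qed

text \<open>
  The bound for all \<open>\<tau>\<close> above \<open>M\<close> extends to \<open>M\<close> itself, also when \<open>M = 0\<close>. The summand one makes the
  constant positive.
\<close>
lemma powr_le_of_bound_above:
  fixes R M D q K :: real
  assumes "0 < q" "0 \<le> K" "0 \<le> R" "0 \<le> M" and le: "\<And>\<tau>. M < \<tau> \<Longrightarrow> R \<le> K * \<tau> powr q"
  shows "R powr (1 / q) \<le> (K powr (1 / q) + 1) * M"
proof -
  define D where "D = K powr (1 / q) + 1"
  have D: "0 < D" unfolding D_def by (rule add_nonneg_pos) simp_all
  have "R powr (1 / q) / D \<le> M"
  proof (rule dense_ge)
    fix \<tau> assume \<tau>: "M < \<tau>"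
    have "R powr (1 / q) \<le> (K * \<tau> powr q) powr (1 / q)" using le[OF \<tau>] assms by (intro powr_mono2) auto
    also have "\<dots> = K powr (1 / q) * \<tau>" using assms \<tau> by (simp add: powr_mult powr_powr)
    also have "\<dots> \<le> D * \<tau>" using assms(4) \<tau> by (intro mult_right_mono) (auto simp: D_def)
    finally show "R powr (1 / q) / D \<le> \<tau>" using D by (simp add: pos_divide_le_eq mult.commute)
  qed
  then show ?thesis using D by (simp add: pos_divide_le_eq mult.commute D_def)
qed

lemma multi_pow_measurable [measurable]:
  "(\<lambda>x. multi_pow x \<beta>) \<in> borel_measurable (borel :: (real ^ 'n::finite) measure)"
  unfolding multi_pow_def by measurable

text \<open>
  Weight, symbol and function are replaced by Borel versions, for which the commutator is dominated by
  \<open>exp_riesz_sum\<close>. As the \<open>q\<close>-th power of that sum is integrable against the positive weight \<open>w^q\<close>, the sum is finite almost everywhere, which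
  gives the convergence of the defining integral. For almost every \<open>x\<close> the two integrands agree for almost
  every \<open>y\<close>, so the results hold for the original functions.
\<close>
theorem theorem3p4:
  fixes m k l :: nat
    and \<alpha> p q C0 :: real
    and w :: "real ^ 'n \<Rightarrow> real"
    and b :: "real ^ 'n \<Rightarrow> complex"
    and a :: "('n \<Rightarrow> nat) \<Rightarrow> ('n \<Rightarrow> nat) \<Rightarrow> real"
    and P :: "real ^ 'n \<Rightarrow> real ^ 'n \<Rightarrow> real"
    and K :: "real ^ 'n \<Rightarrow> real ^ 'n \<Rightarrow> complex"
  assumes "0 < m"
    and "0 < \<alpha>" and "\<alpha> < real CARD('n)"
    and "1 < p" and "p < real CARD('n) / \<alpha>"
    and "1 / p - 1 / q = \<alpha> / real CARD('n)"
    and "w \<in> A_pq p q"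
    and "b \<in> BMO"
    and "\<And>x y. P x y = (\<Sum>\<beta> | multi_deg \<beta> \<le> k. \<Sum>\<gamma> | multi_deg \<gamma> \<le> l.
                           a \<beta> \<gamma> * multi_pow x \<beta> * multi_pow y \<gamma>)"
    and "nontrivial_poly P"
    and "fractional_kernel \<alpha> C0 K"
    and "bounded_on_L2 K"
  shows "\<exists>C>0. \<forall>f \<in> Lp_space p (\<lambda>x. w x powr p).
           kernel_converges (commutator_kernel P K b m) f \<and>
           kernel_op (commutator_kernel P K b m) f \<in> Lp_space q (\<lambda>x. w x powr q) \<and>
           Lp_norm q (\<lambda>x. w x powr q) (kernel_op (commutator_kernel P K b m) f)
             \<le> C * Lp_norm p (\<lambda>x. w x powr p) f"
proof -
  define n where "n = real CARD('n)"
  have n: "0 < n" by (simp add: n_def)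
  have m: "0 < m" and \<alpha>: "0 < \<alpha>" "\<alpha> < n" and p: "1 < p" and q_eq: "1 / p - 1 / q = \<alpha> / n"
    using assms(1-4,6) by (simp_all add: n_def)
  have "p * \<alpha> < n" using assms(5) \<alpha> by (simp add: n_def pos_less_divide_eq)
  then have "\<alpha> / n < 1 / p" using p n by (simp add: field_simps)
  then have "0 < 1 / q" using q_eq by linarith
  then have q0: "0 < q" by simp
  have "0 < \<alpha> / n" using \<alpha> n by simp
  then have "1 / q < 1 / p" using q_eq by linarith
  then have "p < q" using p q0 by (simp add: field_simps)
  then have q: "1 < q" using p by simp
  from A_pq_borel_version[OF assms(7)]
  obtain w' A where A: "0 \<le> A" and w': "Apq_cells p q A w'" and ae_w: "AE x in lebesgue. w x = w' x"
    by (elim exE conjE)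
  from BMO_borel_version[OF assms(8)]
  obtain b' B where B: "0 < B" and b': "b' \<in> borel_measurable borel" and ae_b: "AE x in lebesgue. b x = b' x"
    and bmo: "\<forall>s t. \<bar>s\<bar> \<le> 1 \<longrightarrow> \<bar>t\<bar> \<le> 1 \<longrightarrow> bmo_cells B (\<lambda>x. s * Re (b' x) + t * Im (b' x))"
    by (elim exE conjE)
  note b' [measurable]
  note w'm [measurable] = Apq_cellsD(1)[OF w'] and w'pos = Apq_cellsD(2)[OF w']
  from exp_riesz_sum_weighted_bound[OF assms(2,3) p q assms(6) A B]
  obtain \<epsilon> C where \<epsilon>: "0 < \<epsilon>" and C: "0 \<le> C"
    and bound: "\<forall>(w :: real ^ 'n \<Rightarrow> real) b. Apq_cells p q A w \<longrightarrow> b \<in> borel_measurable borel \<longrightarrow>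
      (\<forall>s t. \<bar>s\<bar> \<le> 1 \<longrightarrow> \<bar>t\<bar> \<le> 1 \<longrightarrow> bmo_cells B (\<lambda>x. s * Re (b x) + t * Im (b x))) \<longrightarrow>
      weighted_bound p q C w (exp_riesz_sum \<alpha> \<epsilon> b)"
    by (elim exE conjE)
  \<comment> \<open>the summand one makes the constant positive, as required by \<open>epow_cmult\<close>\<close>
  define C1 where "C1 = \<bar>C0\<bar> * (real m / \<epsilon>) ^ m + 1"
  have C1: "0 < C1" unfolding C1_def using \<epsilon> by (intro add_nonneg_pos mult_nonneg_nonneg) auto
  define D where "D = (C1 powr q * C) powr (1 / q) + 1"
  have D: "0 < D" unfolding D_def by (rule add_nonneg_pos) simp_all
  define K0 where "K0 z = (if fst z = snd z then 0 else K (fst z) (snd z))" for z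
  have K: "norm (K x y) \<le> C0 / norm (x - y) powr (real CARD('n) - \<alpha>)"
      "isCont (\<lambda>u. K u y) x \<and> isCont (\<lambda>v. K x v) y" if "x \<noteq> y" for x y
    using assms(11) that differentiable_imp_continuous_within unfolding fractional_kernel_def by blast+
  have K0m [measurable]: "K0 \<in> borel_measurable (borel \<Otimes>\<^sub>M borel)"
    unfolding K0_def using off_diagonal_kernel_measurable[OF K(2)] .
  have K0_le: "norm (K0 (x, y)) \<le> \<bar>C0\<bar> * norm (x - y) powr (\<alpha> - CARD('n))" for x y
  proof (cases "x = y")
    case False
    have "norm (K x y) \<le> C0 / norm (x - y) powr (real CARD('n) - \<alpha>)" by (rule K(1)[OF False])
    also have "\<dots> \<le> \<bar>C0\<bar> / norm (x - y) powr (real CARD('n) - \<alpha>)" by (intro divide_right_mono) auto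
    also have "\<dots> = \<bar>C0\<bar> * norm (x - y) powr (\<alpha> - CARD('n))"
      using powr_minus_divide[of "norm (x - y)" "CARD('n) - \<alpha>"] by simp
    finally show ?thesis using False by (simp add: K0_def)
  qed (simp add: K0_def)
  have Pm [measurable]: "(\<lambda>z. P (fst z) (snd z)) \<in> borel_measurable (borel \<Otimes>\<^sub>M borel)"
    unfolding assms(9) by measurable
  have estimate: "kernel_converges (commutator_kernel P K b m) f \<and>
           kernel_op (commutator_kernel P K b m) f \<in> Lp_space q (\<lambda>x. w x powr q) \<and>
           Lp_norm q (\<lambda>x. w x powr q) (kernel_op (commutator_kernel P K b m) f)
             \<le> D * Lp_norm p (\<lambda>x. w x powr p) f" if f: "f \<in> Lp_space p (\<lambda>x. w x powr p)" for f
  proof -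
    have fm: "f \<in> borel_measurable lebesgue" and fint: "integrable lebesgue (\<lambda>x. norm (f x) powr p * w x powr p)"
      using f by (simp_all add: Lp_space_def)
    from lebesgue_borel_version_complex[OF fm]
    obtain f' where f' [measurable]: "f' \<in> borel_measurable borel" and ae_f: "AE x in lebesgue. f x = f' x" by (elim bexE)
    define N where "N = (LINT x|lebesgue. norm (f x) powr p * w x powr p)"
    have N0: "0 \<le> N" unfolding N_def by (rule Bochner_Integration.integral_nonneg) simp
    define M where "M = Lp_norm p (\<lambda>x. w x powr p) f"
    have M: "M = N powr (1 / p)" by (simp add: M_def N_def Lp_norm_def)
    have M0: "0 \<le> M" by (simp add: M)
    have "(\<integral>\<^sup>+x. ennreal (norm (f' x) powr p * w' x powr p) \<partial>lborel) = (\<integral>\<^sup>+x. ennreal (norm (f' x) powr p * w' x powr p) \<partial>lebesgue)"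
      by (rule nn_integral_completion[symmetric])
    also have "\<dots> = (\<integral>\<^sup>+x. ennreal (norm (f x) powr p * w x powr p) \<partial>lebesgue)"
    proof (rule nn_integral_cong_AE)
      show "AE x in lebesgue. ennreal (norm (f' x) powr p * w' x powr p) = ennreal (norm (f x) powr p * w x powr p)"
        using ae_f ae_w by eventually_elim simp
    qed
    also have "\<dots> = ennreal N" unfolding N_def using fint by (intro nn_integral_eq_integral) auto
    finally have nnN: "(\<integral>\<^sup>+x. ennreal (norm (f' x) powr p * w' x powr p) \<partial>lborel) = ennreal N" .
    define J where "J x = exp_riesz_sum \<alpha> \<epsilon> b' (\<lambda>y. norm (f' y)) x" for x
    have Jm [measurable]: "J \<in> borel_measurable borel" unfolding J_def[abs_def] by (rule exp_riesz_sum_measurable) measurable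
    have J\<tau>: "(\<integral>\<^sup>+x. epow (J x) q * ennreal (w' x powr q) \<partial>lborel) \<le> ennreal (C * \<tau> powr q)" if \<tau>: "M < \<tau>" for \<tau>
      unfolding J_def
    proof (rule bound[THEN spec, THEN spec, THEN mp, THEN mp, THEN mp, OF w' b' bmo, unfolded weighted_bound_def, rule_format])
      show "0 < \<tau>" using \<tau> M0 by linarith
      have "N = M powr p" using N0 p by (simp add: M powr_powr)
      also have "\<dots> \<le> \<tau> powr p" using M0 \<tau> p by (intro powr_mono2) auto
      finally show "(\<integral>\<^sup>+x. ennreal (norm (f' x) powr p * w' x powr p) \<partial>lborel) \<le> ennreal (\<tau> powr p)"
        unfolding nnN by (rule ennreal_leI)
    qed auto
    have J_fin: "AE x in lborel. J x \<noteq> \<infinity>"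
    proof -
      have "(\<integral>\<^sup>+x. epow (J x) q * ennreal (w' x powr q) \<partial>lborel) \<noteq> \<infinity>"
        using J\<tau>[of "M + 1"] by (auto simp: top_unique)
      then have "AE x in lborel. epow (J x) q * ennreal (w' x powr q) \<noteq> \<infinity>" by (intro nn_integral_PInf_AE) measurable
      then show ?thesis
      proof (rule eventually_mono)
        fix x assume "epow (J x) q * ennreal (w' x powr q) \<noteq> \<infinity>"
        then show "J x \<noteq> \<infinity>" using w'pos[of x] by (auto simp: ennreal_top_mult)
      qed
    qed
    define G where "G z = exp (\<i> * complex_of_real (P (fst z) (snd z))) * K0 z * (b' (fst z) - b' (snd z)) ^ m * f' (snd z)" for z
    have Gm [measurable]: "G \<in> borel_measurable (borel \<Otimes>\<^sub>M borel)" unfolding G_def[abs_def] by measurable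
    have Gx [measurable]: "(\<lambda>y. G (x, y)) \<in> borel_measurable borel" for x using measurable_Pair2[OF Gm, of x] by simp
    have G_bound: "(\<integral>\<^sup>+y. ennreal (norm (G (x, y))) \<partial>lborel) \<le> ennreal C1 * J x" for x
    proof -
      have "(\<integral>\<^sup>+y. ennreal (norm (G (x, y))) \<partial>lborel) \<le> ennreal (\<bar>C0\<bar> * (real m / \<epsilon>) ^ m) * exp_riesz_sum \<alpha> \<epsilon> b' (\<lambda>y. norm (f' y)) x"
      proof (rule nn_integral_commutator_le[OF b' _ _ m \<epsilon>])
        fix y
        show "norm (G (x, y)) \<le> \<bar>C0\<bar> * norm (x - y) powr (\<alpha> - CARD('n)) * norm (b' x - b' y) ^ m * norm (f' y)"
          using K0_le[of x y] by (simp add: G_def norm_mult norm_power mult_right_mono)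
      qed auto
      also have "\<dots> \<le> ennreal C1 * J x" unfolding J_def C1_def by (intro mult_right_mono ennreal_leI) auto
      finally show ?thesis .
    qed
    define T where "T x = (LINT y|lborel. G (x, y))" for x
    have Tm [measurable]: "T \<in> borel_measurable borel"
    proof -
      have "(\<lambda>(x, y). G (x, y)) \<in> borel_measurable (borel \<Otimes>\<^sub>M lborel)" by simp
      then show ?thesis unfolding T_def[abs_def] by (rule lborel.borel_measurable_lebesgue_integral)
    qed
    have G_int: "integrable lborel (\<lambda>y. G (x, y))" if "J x \<noteq> \<infinity>" for x
    proof (rule integrableI_bounded)
      have "ennreal C1 * J x < \<infinity>" using that by (simp add: ennreal_mult_less_top less_top)
      with G_bound[of x] show "(\<integral>\<^sup>+y. ennreal (norm (G (x, y))) \<partial>lborel) < \<infinity>" by (rule order.strict_trans1)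
    qed simp
    have T_le: "ennreal (norm (T x) powr q) \<le> ennreal (C1 powr q) * epow (J x) q" if "J x \<noteq> \<infinity>" for x
    proof -
      have "ennreal (norm (T x)) \<le> (\<integral>\<^sup>+y. ennreal (norm (G (x, y))) \<partial>lborel)"
        unfolding T_def by (rule integral_norm_bound_ennreal[OF G_int[OF that]])
      then have "epow (ennreal (norm (T x))) q \<le> epow (ennreal C1 * J x) q"
        using G_bound[of x] q0 by (intro epow_mono) auto
      then show ?thesis by (simp add: epow_ennreal epow_cmult[OF C1])
    qed
    have T_int: "(\<integral>\<^sup>+x. ennreal (norm (T x) powr q * w' x powr q) \<partial>lborel) \<le> ennreal (C1 powr q * C * \<tau> powr q)" if \<tau>: "M < \<tau>" for \<tau>
    proof -
      have "(\<integral>\<^sup>+x. ennreal (norm (T x) powr q * w' x powr q) \<partial>lborel)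
        \<le> (\<integral>\<^sup>+x. ennreal (C1 powr q) * (epow (J x) q * ennreal (w' x powr q)) \<partial>lborel)"
      proof (rule nn_integral_mono_AE)
        show "AE x in lborel. ennreal (norm (T x) powr q * w' x powr q) \<le> ennreal (C1 powr q) * (epow (J x) q * ennreal (w' x powr q))"
          using J_fin
        proof (rule eventually_mono)
          fix x assume "J x \<noteq> \<infinity>"
          from mult_right_mono[OF T_le[OF this], of "ennreal (w' x powr q)"]
          show "ennreal (norm (T x) powr q * w' x powr q) \<le> ennreal (C1 powr q) * (epow (J x) q * ennreal (w' x powr q))"
            by (simp add: ennreal_mult mult.assoc)
        qed
      qed
      also have "\<dots> = ennreal (C1 powr q) * (\<integral>\<^sup>+x. epow (J x) q * ennreal (w' x powr q) \<partial>lborel)"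
        by (rule nn_integral_cmult) measurable
      also have "\<dots> \<le> ennreal (C1 powr q) * ennreal (C * \<tau> powr q)" using J\<tau>[OF \<tau>] by (rule mult_left_mono) simp
      also have "\<dots> = ennreal (C1 powr q * C * \<tau> powr q)" using C by (simp add: ennreal_mult[symmetric] mult.assoc)
      finally show ?thesis .
    qed
    have Tq: "integrable lborel (\<lambda>x. norm (T x) powr q * w' x powr q)"
    proof (rule integrableI_nonneg)
      show "(\<integral>\<^sup>+x. ennreal (norm (T x) powr q * w' x powr q) \<partial>lborel) < \<infinity>"
        using T_int[of "M + 1"] by (auto intro: order.strict_trans1)
    qed auto
    define R where "R = (LINT x|lborel. norm (T x) powr q * w' x powr q)"
    have R0: "0 \<le> R" unfolding R_def by (rule Bochner_Integration.integral_nonneg) simp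
    have R_le: "R \<le> (C1 powr q * C) * \<tau> powr q" if "M < \<tau>" for \<tau>
    proof -
      have "ennreal R \<le> ennreal (C1 powr q * C * \<tau> powr q)"
        unfolding R_def using T_int[OF that] nn_integral_eq_integral[OF Tq] by simp
      then show ?thesis using C by (subst (asm) ennreal_le_iff) simp_all
    qed
    define k where "k x y = commutator_kernel P K b m x y * f y" for x y
    have k_eq: "AE y in lebesgue. G (x, y) = k x y" if "b x = b' x" for x
    proof -
      have "AE y in lborel. y \<noteq> x" by (rule AE_lborel_singleton)
      from AE_completion[OF this] ae_b ae_f show ?thesis
      proof eventually_elim
        case (elim y)
        then show ?case using that by (simp add: G_def k_def K0_def commutator_kernel_def)
      qed
    qed
    have Gleb: "(\<lambda>y. G (x, y)) \<in> borel_measurable lebesgue" for x by (intro measurable_completion) simp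
    have kleb: "(\<lambda>y. k x y) \<in> borel_measurable lebesgue" if "b x = b' x" for x
      using borel_measurable_AE[OF Gleb k_eq[OF that]] .
    have conv: "kernel_converges (commutator_kernel P K b m) f"
      unfolding kernel_converges_def k_def[symmetric] using ae_b AE_completion[OF J_fin]
    proof eventually_elim
      case (elim x)
      have "integrable lebesgue (\<lambda>y. G (x, y))" using G_int[OF elim(2)] by (subst integrable_completion) simp_all
      then show ?case using kleb[OF elim(1)] k_eq[OF elim(1)] by (rule integrable_cong_AE_imp)
    qed
    have T_eq: "AE x in lebesgue. T x = kernel_op (commutator_kernel P K b m) f x"
      using ae_b
    proof eventually_elim
      case (elim x)
      have "T x = (LINT y|lebesgue. G (x, y))" unfolding T_def by (rule integral_completion[symmetric]) simp
      also have "\<dots> = (LINT y|lebesgue. k x y)" by (rule integral_cong_AE[OF Gleb kleb[OF elim] k_eq[OF elim]])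
      finally show ?case by (simp add: kernel_op_def k_def)
    qed
    define U where "U = kernel_op (commutator_kernel P K b m) f"
    have Um: "U \<in> borel_measurable lebesgue"
      unfolding U_def using Tm T_eq by (intro borel_measurable_AE[OF measurable_completion]) simp_all
    have TqU: "AE x in lebesgue. norm (T x) powr q * w' x powr q = norm (U x) powr q * w x powr q"
      using T_eq ae_w by eventually_elim (simp add: U_def)
    have Tqm: "(\<lambda>x. norm (T x) powr q * w' x powr q) \<in> borel_measurable lborel" by measurable
    have Tqleb: "(\<lambda>x. norm (T x) powr q * w' x powr q) \<in> borel_measurable lebesgue" using Tqm by (rule measurable_completion)
    have Uqleb: "(\<lambda>x. norm (U x) powr q * w x powr q) \<in> borel_measurable lebesgue" using Tqleb TqU by (rule borel_measurable_AE)
    have "integrable lebesgue (\<lambda>x. norm (T x) powr q * w' x powr q)" using Tq integrable_completion[OF Tqm] by simp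
    then have "integrable lebesgue (\<lambda>x. norm (U x) powr q * w x powr q)" using Uqleb TqU by (rule integrable_cong_AE_imp)
    then have UL: "U \<in> Lp_space q (\<lambda>x. w x powr q)" using Um by (simp add: Lp_space_def)
    have "(LINT x|lebesgue. norm (U x) powr q * w x powr q) = R"
      unfolding R_def using integral_cong_AE[OF Tqleb Uqleb TqU] integral_completion[OF Tqm] by simp
    then have "Lp_norm q (\<lambda>x. w x powr q) U = R powr (1 / q)" by (simp add: Lp_norm_def)
    also have "\<dots> \<le> D * M"
      unfolding D_def using q0 C R0 M0 R_le by (intro powr_le_of_bound_above) auto
    finally show ?thesis using conv UL by (simp add: U_def M_def)
  qed
  show ?thesis by (rule exI[of _ D], rule conjI[OF D], rule ballI, rule estimate)
qed

end
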